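(* Let $m_0$ be a Borel probability measure on $\mathcal G$ with bounded support, let the costs satisfy the standing assumptions listed in the context, and assume that $G_i[m']\in C^1(\mathbb R_+)$ for all $i\in\{1,\dots,N\}$, $m'\in\mathcal P_1(\mathcal G)$. Let $\mu\in\mathcal P_{m_0}(\Gamma_C)$ (for some $C>0$) be a relaxed equilibrium and let $(u,m)$ be the associated mild solution. Then for any $(x,t)\in Q_m$, with $x\in J_i\setminus\{0\}$: (a) $-p_1+H_i(|x|,p_2,t)=0$ for every $(p_1,p_2)\in D^+_{x,t}u(x,t)$; (b) $u$ is differentiable at $(x,t)$.
   Context: Junction: $N>1$ is an integer, $(e_i)$ is the canonical basis of $\mathbb R^N$, $\mathbb R_+=[0,\infty)$, $J_i=\mathbb R_+e_i$, $\mathcal G=\bigcup_{i=1}^N J_i\subset\mathbb R^N$, vertex $0$; $d(x,y)=|x-y|$ if $x,y$ lie in the same edge, $d(x,y)=|x|+|y|$ otherwise. Fix $T>0$, $p>1$. Trajectories: $\Gamma_t[x]$ is the set of $y\in C([t,T];\mathcal G)\cap W^{1,p}(t,T;\mathbb R^N)$ with $y(t)=x$; $\Gamma[x]=\Gamma_0[x]$; $\bar y=|y|$. For $C>0$: $\Gamma_C[x]=\{y\in\Gamma[x]:\|y\|_{L^\infty(0,T)}\le C,\ \|y'\|_{L^p(0,T)}\le C\}$, $\Gamma_C=\bigcup_x\Gamma_C[x]$, with the topology of uniform convergence. Measures: $\mathcal P(X)$ is the set of Borel probability measures on $X$; $\mathcal P_1(\mathcal G)$ is the set of those on $\mathcal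 G$ with finite first moment, with the Kantorovich–Rubinstein distance $d_1$. $m^\mu(t)=e_t\sharp\mu$ with $e_t(y)=y(t)$. $\mathcal P_{m_0}(\Gamma_C)$ is the set of $\mu\in\mathcal P(\Gamma_C)$ with $e_0\sharp\mu=m_0$. Costs: $m\mapsto L_i[m]$ is continuous from $\mathcal P_1(\mathcal G)$ to $C^1(\mathbb R_+\times\mathbb R)$ (functions of $(x,a)$; $C^1$ convergence on compact sets), $G_i\in C_b(\mathcal P_1(\mathcal G);C_b(\mathbb R_+))$, $L_*,G_*\in C_b(\mathcal P_1(\mathcal G);\mathbb R)$, where $C_b$ denotes bounded continuous functions. Standing assumptions: (1) there is $C_0>0$ with $L_i[m](x,a)\ge C_0(|a|^p-1)$ and $L_*[m]\ge-C_0$ for all $i,m,x,a$; (2) for any $r>0$ there is a modulus $\omega_r$ with $|L_i[m_1](x,a)-L_i[m_2](x,a)|\le(1+|a|^p)\omega_r(d_1(m_1,m_2))$ for all $i$, $m_1,m_2\in\mathcal P_1(\mathcal G)$, $x\in[0,r]$, $a\in\mathbb R$; (3) for any $r>0$ there is $\tilde c(r)\ge0$ with $|\partial_xL_i[m](x,a)|\le\tilde c(r)(|a|^p+1)$ and $|\partial_aL_i[m](x,a)|\le\tilde c(r)(|a|^{p-1}+1)$ for all $i,m$, $x\in[0,r]$, $a\in\mathbb R$; (4) $a\mapsto L_i[m](x,a)$ is strictly convex for all $i$, $m$, $x\in\mathbb R_+$. $L_0[m]=\min\{L_*[m],\min_iL_i[m](0,0)\}$; $L[m](y(t),y'(t))=\sum_iL_i[m](\bar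 y(t),\bar y'(t))\mathbf 1_{y(t)\in J_i\setminus\{0\}}+L_0[m]\mathbf 1_{y(t)=0}$; $G[m](x)=\sum_iG_i[m](|x|)\mathbf 1_{x\in J_i\setminus\{0\}}+\min\{G_*[m],\min_iG_i[m](0)\}\mathbf 1_{x=0}$; $J_t^\mu(x;y)=\int_t^TL[m^\mu(\tau)](y(\tau),y'(\tau))\,d\tau+G[m^\mu(T)](y(T))$ for $y\in\Gamma_t[x]$. Relaxed equilibrium: $\mu\in\mathcal P_{m_0}(\Gamma_C)$ such that every $y\in\operatorname{supp}(\mu)$ belongs, for some $x\in\operatorname{supp}(m_0)$, to $\{y\in\Gamma_C[x]:J_0^\mu(x;y)=\min_{\tilde y\in\Gamma[x]}J_0^\mu(x;\tilde y)\}$. The associated mild solution is $(u,m)$ with $m(t)=m^\mu(t)$, $u(x,t)=\inf_{y\in\Gamma_t[x]}J_t^\mu(x;y)$. $H_i(x,q,t)=\sup_{\zeta\in\mathbb R}\{-q\zeta-L_i[m(t)](x,\zeta)\}$ for $x\in\mathbb R_+$, $q\in\mathbb R$, $t\in[0,T]$. $Q_m=\{(x,t)\in\mathcal G\times(0,T):x\in(\mathcal G\setminus\{0\})\cap\operatorname{supp}(m(t))\}$. For $(x,t)\in Q_m$ with $x=\bar xe_i$ (and $y=\bar ye_i$ near $x$), $$D^+_{x,t}u(x,t)=\Big\{(\pi,q)\in\mathbb R^2:\limsup_{y\to x,\,\theta\to t}\frac{u(y,\theta)-u(x,t)-\pi(\theta-t)-q(\bar y-\bar x)}{|\bar y-\bar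 x|+|\theta-t|}\le0\Big\}.$$ Differentiability of $u$ at $(x,t)$ means differentiability of $(r,\theta)\mapsto u(re_i,\theta)$ at $(\bar x,t)$. *)

theory Defs
  imports "HOL-Probability.Probability"
begin

section \<open>The junction\<close>

text \<open>The ambient space is \<^typ>\<open>real^'n\<close> with \<open>N = CARD('n)\<close>; edges are indexed by \<^typ>\<open>'n\<close>.\<close>

definition edge :: "'n::finite \<Rightarrow> (real^'n) set" where
  "edge i = {r *\<^sub>R axis i 1 |r. r \<ge> 0}"

definition junction :: "(real^'n::finite) set" where
  "junction = (\<Union>i. edge i)"

definition junction_dist :: "real^'n::finite \<Rightarrow> real^'n \<Rightarrow> real" where
  "junction_dist x y = (if \<exists>i. x \<in> edge i \<and> y \<in> edge i then norm (x - y) else norm x + norm y)"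


section \<open>Measures\<close>

text \<open>
  On the junction, \<^const>\<open>junction_dist\<close> lies between the Euclidean distance and twice the
  Euclidean distance. Topological and Borel notions are therefore taken from the Euclidean
  subspace structure; \<^const>\<open>junction_dist\<close> itself only enters the Kantorovich-Rubinstein distance.
\<close>

abbreviation junction_borel :: "(real^'n::finite) measure" where
  "junction_borel \<equiv> restrict_space borel junction"

definition borel_probs :: "'a measure \<Rightarrow> 'a measure set" where
  "borel_probs B = {M. sets M = sets B \<and> prob_space M}"

definition P1 :: "(real^'n::finite) measure set" where
  "P1 = {m \<in> borel_probs junction_borel. integrable m norm}"

definition kr_dist :: "(real^'n::finite) measure \<Rightarrow> (real^'n) measure \<Rightarrow> real" where
  "kr_dist m1 m2 =
     (SUP \<phi> \<in> {\<phi> :: real^'n \<Rightarrow> real.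
                 \<forall>x\<in>junction. \<forall>y\<in>junction. \<bar>\<phi> x - \<phi> y\<bar> \<le> junction_dist x y}.
        integral\<^sup>L m1 \<phi> - integral\<^sup>L m2 \<phi>)"

text \<open>The neighbourhood filter of \<open>m\<close> in the metric space \<open>(P1, kr_dist)\<close>.\<close>

definition P1_nhds :: "(real^'n::finite) measure \<Rightarrow> (real^'n) measure filter" where
  "P1_nhds m = (INF \<epsilon>\<in>{0<..}. principal {m' \<in> P1. kr_dist m m' < \<epsilon>})"

definition borel_sigma :: "'a topology \<Rightarrow> 'a measure" where
  "borel_sigma X = sigma (topspace X) {U. openin X U}"

definition supp :: "'a topology \<Rightarrow> 'a measure \<Rightarrow> 'a set" where
  "supp X M = {x \<in> topspace X. \<forall>U. openin X U \<and> x \<in> U \<longrightarrow> emeasure M U > 0}"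


section \<open>Trajectories\<close>

definition in_Lp :: "real \<Rightarrow> real \<Rightarrow> real \<Rightarrow> (real \<Rightarrow> 'a::euclidean_space) \<Rightarrow> bool" where
  "in_Lp p a b f \<longleftrightarrow> f \<in> borel_measurable (lebesgue_on {a<..<b}) \<and>
     integrable (lebesgue_on {a<..<b}) (\<lambda>s. norm (f s) powr p)"

definition Lp_norm :: "real \<Rightarrow> real \<Rightarrow> real \<Rightarrow> (real \<Rightarrow> 'a::euclidean_space) \<Rightarrow> real" where
  "Lp_norm p a b f = (LINT s|lebesgue_on {a<..<b}. norm (f s) powr p) powr (1 / p)"

definition locally_integrable :: "real \<Rightarrow> real \<Rightarrow> (real \<Rightarrow> 'a::euclidean_space) \<Rightarrow> bool" where
  "locally_integrable a b f \<longleftrightarrow>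
     (\<forall>K. compact K \<and> K \<subseteq> {a<..<b} \<longrightarrow> integrable (lebesgue_on K) f)"

definition test_functions :: "real \<Rightarrow> real \<Rightarrow> (real \<Rightarrow> real) set" where
  "test_functions a b = {\<phi>. \<phi> C1_differentiable_on UNIV \<and>
     (\<exists>K. compact K \<and> K \<subseteq> {a<..<b} \<and> (\<forall>s. s \<notin> K \<longrightarrow> \<phi> s = 0))}"

definition has_weak_deriv ::
    "real \<Rightarrow> real \<Rightarrow> (real \<Rightarrow> 'a::euclidean_space) \<Rightarrow> (real \<Rightarrow> 'a) \<Rightarrow> bool" where
  "has_weak_deriv a b y v \<longleftrightarrow> locally_integrable a b y \<and> locally_integrable a b v \<and>
     (\<forall>\<phi> \<in> test_functions a b.
        (LINT s|lebesgue_on {a<..<b}. deriv \<phi> s *\<^sub>R y s) = - (LINT s|lebesgue_on {a<..<b}. \<phi> s *\<^sub>R v s))"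

text \<open>A representative of the weak derivative, which is unique almost everywhere.\<close>

definition weak_deriv :: "real \<Rightarrow> real \<Rightarrow> (real \<Rightarrow> 'a::euclidean_space) \<Rightarrow> real \<Rightarrow> 'a" where
  "weak_deriv a b y = (SOME v. has_weak_deriv a b y v)"

definition in_W1p :: "real \<Rightarrow> real \<Rightarrow> real \<Rightarrow> (real \<Rightarrow> 'a::euclidean_space) \<Rightarrow> bool" where
  "in_W1p p a b y \<longleftrightarrow> in_Lp p a b y \<and> (\<exists>v. has_weak_deriv a b y v \<and> in_Lp p a b v)"

text \<open>A trajectory on \<open>[t,T]\<close> is \<^const>\<open>undefined\<close> off that interval, so that it is determined by its
  restriction.\<close>

definition trajs :: "real \<Rightarrow> real \<Rightarrow> real \<Rightarrow> real^'n::finite \<Rightarrow> (real \<Rightarrow> real^'n) set" where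
  "trajs p T t x = {y \<in> extensional {t..T}. continuous_on {t..T} y \<and> y ` {t..T} \<subseteq> junction \<and>
     in_W1p p t T y \<and> y t = x}"

definition trajs_bdd_at :: "real \<Rightarrow> real \<Rightarrow> real \<Rightarrow> real^'n::finite \<Rightarrow> (real \<Rightarrow> real^'n) set" where
  "trajs_bdd_at p T C x = {y \<in> trajs p T 0 x.
     (AE s in lebesgue_on {0<..<T}. norm (y s) \<le> C) \<and> Lp_norm p 0 T (weak_deriv 0 T y) \<le> C}"

definition trajs_bdd :: "real \<Rightarrow> real \<Rightarrow> real \<Rightarrow> (real \<Rightarrow> real^'n::finite) set" where
  "trajs_bdd p T C = (\<Union>x\<in>junction. trajs_bdd_at p T C x)"

text \<open>\<^const>\<open>cfunspace\<close> is the space of continuous functions with the uniform distance.\<close>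

definition trajs_topology :: "real \<Rightarrow> real \<Rightarrow> real \<Rightarrow> (real \<Rightarrow> real^'n::finite) topology" where
  "trajs_topology p T C =
     subtopology (mtopology_of (cfunspace (top_of_set {0..T}) euclidean_metric)) (trajs_bdd p T C)"

definition marginal :: "(real \<Rightarrow> real^'n::finite) measure \<Rightarrow> real \<Rightarrow> (real^'n) measure" where
  "marginal \<mu> t = distr \<mu> junction_borel (\<lambda>y. y t)"

definition traj_probs ::
    "real \<Rightarrow> real \<Rightarrow> real \<Rightarrow> (real^'n::finite) measure \<Rightarrow> (real \<Rightarrow> real^'n) measure set" where
  "traj_probs p T C m0 =
     {\<mu> \<in> borel_probs (borel_sigma (trajs_topology p T C)). marginal \<mu> 0 = m0}"


section \<open>Costs\<close>

text \<open>
  Functions on \<open>[0,\<infinity>) \<times> \<real>\<close> and on \<open>[0,\<infinity>)\<close> are total functions whose values at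
  negative positions are irrelevant. Accordingly, the derivative in the position is taken
  within \<open>[0,\<infinity>)\<close>, i.e. it is one-sided at \<open>0\<close>.
\<close>

definition dx :: "(real \<Rightarrow> real \<Rightarrow> real) \<Rightarrow> real \<Rightarrow> real \<Rightarrow> real" where
  "dx f x a = vector_derivative (\<lambda>s. f s a) (at x within {0..})"

definition da :: "(real \<Rightarrow> real \<Rightarrow> real) \<Rightarrow> real \<Rightarrow> real \<Rightarrow> real" where
  "da f x a = vector_derivative (\<lambda>b. f x b) (at a)"

definition C1_halfplane :: "(real \<Rightarrow> real \<Rightarrow> real) \<Rightarrow> bool" where
  "C1_halfplane f \<longleftrightarrow>
     (\<forall>x\<ge>0. \<forall>a. (\<lambda>s. f s a) differentiable (at x within {0..}) \<and> (\<lambda>b. f x b) differentiable (at a)) \<and>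
     continuous_on ({0..} \<times> UNIV) (\<lambda>(x, a). f x a) \<and>
     continuous_on ({0..} \<times> UNIV) (\<lambda>(x, a). dx f x a) \<and>
     continuous_on ({0..} \<times> UNIV) (\<lambda>(x, a). da f x a)"

definition C1_halfline :: "(real \<Rightarrow> real) \<Rightarrow> bool" where
  "C1_halfline g \<longleftrightarrow>
     (\<exists>g'. (\<forall>x\<ge>0. (g has_real_derivative g' x) (at x within {0..})) \<and> continuous_on {0..} g')"

text \<open>Continuity of a map from \<^const>\<open>P1\<close> to \<open>C\<^sup>1([0,\<infinity>) \<times> \<real>)\<close>, for \<open>C\<^sup>1\<close> convergence on compact
  sets.\<close>

definition continuous_into_C1 ::
    "((real^'n::finite) measure \<Rightarrow> real \<Rightarrow> real \<Rightarrow> real) \<Rightarrow> bool" where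
  "continuous_into_C1 F \<longleftrightarrow> (\<forall>m\<in>P1. C1_halfplane (F m) \<and>
     (\<forall>K. compact K \<and> K \<subseteq> {0..} \<times> UNIV \<longrightarrow>
        uniform_limit K (\<lambda>m' (x, a). F m' x a) (\<lambda>(x, a). F m x a) (P1_nhds m) \<and>
        uniform_limit K (\<lambda>m' (x, a). dx (F m') x a) (\<lambda>(x, a). dx (F m) x a) (P1_nhds m) \<and>
        uniform_limit K (\<lambda>m' (x, a). da (F m') x a) (\<lambda>(x, a). da (F m) x a) (P1_nhds m)))"

text \<open>Membership in \<open>C\<^sub>b(P1; C\<^sub>b([0,\<infinity>)))\<close> and in \<open>C\<^sub>b(P1; \<real>)\<close>.\<close>

definition Cb_into_Cb :: "((real^'n::finite) measure \<Rightarrow> real \<Rightarrow> real) \<Rightarrow> bool" where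
  "Cb_into_Cb F \<longleftrightarrow>
     (\<forall>m\<in>P1. continuous_on {0..} (F m) \<and> uniform_limit {0..} F (F m) (P1_nhds m)) \<and>
     (\<exists>B. \<forall>m\<in>P1. \<forall>x\<ge>0. \<bar>F m x\<bar> \<le> B)"

definition Cb_into_real :: "((real^'n::finite) measure \<Rightarrow> real) \<Rightarrow> bool" where
  "Cb_into_real F \<longleftrightarrow>
     (\<forall>m\<in>P1. (F \<longlongrightarrow> F m) (P1_nhds m)) \<and> (\<exists>B. \<forall>m\<in>P1. \<bar>F m\<bar> \<le> B)"

definition modulus :: "(real \<Rightarrow> real) \<Rightarrow> bool" where
  "modulus \<omega> \<longleftrightarrow> \<omega> 0 = 0 \<and> mono_on {0..} \<omega> \<and> (\<omega> \<longlongrightarrow> 0) (at_right 0)"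

definition costs ::
    "('n::finite \<Rightarrow> (real^'n) measure \<Rightarrow> real \<Rightarrow> real \<Rightarrow> real) \<Rightarrow> ((real^'n) measure \<Rightarrow> real) \<Rightarrow>
     ('n \<Rightarrow> (real^'n) measure \<Rightarrow> real \<Rightarrow> real) \<Rightarrow> ((real^'n) measure \<Rightarrow> real) \<Rightarrow> bool" where
  "costs L Ls G Gs \<longleftrightarrow>
     (\<forall>i. continuous_into_C1 (L i)) \<and> Cb_into_real Ls \<and>
     (\<forall>i. Cb_into_Cb (G i)) \<and> Cb_into_real Gs"

definition coercive ::
    "real \<Rightarrow> ('n::finite \<Rightarrow> (real^'n) measure \<Rightarrow> real \<Rightarrow> real \<Rightarrow> real) \<Rightarrow>
     ((real^'n) measure \<Rightarrow> real) \<Rightarrow> bool" where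
  "coercive p L Ls \<longleftrightarrow>
     (\<exists>C0>0. \<forall>m\<in>P1. (\<forall>i. \<forall>x\<ge>0. \<forall>a. L i m x a \<ge> C0 * (\<bar>a\<bar> powr p - 1)) \<and> Ls m \<ge> - C0)"

definition measure_modulus ::
    "real \<Rightarrow> ('n::finite \<Rightarrow> (real^'n) measure \<Rightarrow> real \<Rightarrow> real \<Rightarrow> real) \<Rightarrow> bool" where
  "measure_modulus p L \<longleftrightarrow>
     (\<forall>r>0. \<exists>\<omega>. modulus \<omega> \<and> (\<forall>i. \<forall>m1\<in>P1. \<forall>m2\<in>P1. \<forall>x\<in>{0..r}. \<forall>a.
        \<bar>L i m1 x a - L i m2 x a\<bar> \<le> (1 + \<bar>a\<bar> powr p) * \<omega> (kr_dist m1 m2)))"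

definition deriv_growth ::
    "real \<Rightarrow> ('n::finite \<Rightarrow> (real^'n) measure \<Rightarrow> real \<Rightarrow> real \<Rightarrow> real) \<Rightarrow> bool" where
  "deriv_growth p L \<longleftrightarrow>
     (\<forall>r>0. \<exists>c\<ge>0. \<forall>i. \<forall>m\<in>P1. \<forall>x\<in>{0..r}. \<forall>a.
        \<bar>dx (L i m) x a\<bar> \<le> c * (\<bar>a\<bar> powr p + 1) \<and>
        \<bar>da (L i m) x a\<bar> \<le> c * (\<bar>a\<bar> powr (p - 1) + 1))"

definition strictly_convex :: "(real \<Rightarrow> real) \<Rightarrow> bool" where
  "strictly_convex f \<longleftrightarrow>
     (\<forall>a b s. a \<noteq> b \<and> 0 < s \<and> s < 1 \<longrightarrow> f ((1 - s) * a + s * b) < (1 - s) * f a + s * f b)"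

definition velocity_convex ::
    "('n::finite \<Rightarrow> (real^'n) measure \<Rightarrow> real \<Rightarrow> real \<Rightarrow> real) \<Rightarrow> bool" where
  "velocity_convex L \<longleftrightarrow> (\<forall>i. \<forall>m\<in>P1. \<forall>x\<ge>0. strictly_convex (L i m x))"

definition running_cost ::
    "('n::finite \<Rightarrow> (real^'n) measure \<Rightarrow> real \<Rightarrow> real \<Rightarrow> real) \<Rightarrow> ((real^'n) measure \<Rightarrow> real) \<Rightarrow>
     (real^'n) measure \<Rightarrow> real^'n \<Rightarrow> real \<Rightarrow> real" where
  "running_cost L Ls m x a =
     (\<Sum>i\<in>UNIV. L i m (norm x) a * indicator (edge i - {0}) x) +
     min (Ls m) (MIN i. L i m 0 0) * indicator {0} x"

definition final_cost ::
    "('n::finite \<Rightarrow> (real^'n) measure \<Rightarrow> real \<Rightarrow> real) \<Rightarrow> ((real^'n) measure \<Rightarrow> real) \<Rightarrow>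
     (real^'n) measure \<Rightarrow> real^'n \<Rightarrow> real" where
  "final_cost G Gs m x =
     (\<Sum>i\<in>UNIV. G i m (norm x) * indicator (edge i - {0}) x) +
     min (Gs m) (MIN i. G i m 0) * indicator {0} x"

text \<open>The velocity entering the running cost is the derivative of \<open>\<tau> \<mapsto> \<bar>y(\<tau>)\<bar>\<close>.\<close>

definition cost ::
    "real \<Rightarrow> ('n::finite \<Rightarrow> (real^'n) measure \<Rightarrow> real \<Rightarrow> real \<Rightarrow> real) \<Rightarrow> ((real^'n) measure \<Rightarrow> real) \<Rightarrow>
     ('n \<Rightarrow> (real^'n) measure \<Rightarrow> real \<Rightarrow> real) \<Rightarrow> ((real^'n) measure \<Rightarrow> real) \<Rightarrow>
     (real \<Rightarrow> real^'n) measure \<Rightarrow> real \<Rightarrow> (real \<Rightarrow> real^'n) \<Rightarrow> real" where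
  "cost T L Ls G Gs \<mu> t y =
     (LINT \<tau>|lebesgue_on {t<..<T}.
        running_cost L Ls (marginal \<mu> \<tau>) (y \<tau>) (weak_deriv t T (\<lambda>s. norm (y s)) \<tau>)) +
     final_cost G Gs (marginal \<mu> T) (y T)"


section \<open>Equilibria and the value function\<close>

definition relaxed_equilibrium ::
    "real \<Rightarrow> real \<Rightarrow> real \<Rightarrow>
     ('n::finite \<Rightarrow> (real^'n) measure \<Rightarrow> real \<Rightarrow> real \<Rightarrow> real) \<Rightarrow> ((real^'n) measure \<Rightarrow> real) \<Rightarrow>
     ('n \<Rightarrow> (real^'n) measure \<Rightarrow> real \<Rightarrow> real) \<Rightarrow> ((real^'n) measure \<Rightarrow> real) \<Rightarrow>
     (real^'n) measure \<Rightarrow> (real \<Rightarrow> real^'n) measure \<Rightarrow> bool" where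
  "relaxed_equilibrium p T C L Ls G Gs m0 \<mu> \<longleftrightarrow>
     \<mu> \<in> traj_probs p T C m0 \<and>
     (\<forall>y \<in> supp (trajs_topology p T C) \<mu>. \<exists>x \<in> supp (top_of_set junction) m0.
        y \<in> trajs_bdd_at p T C x \<and>
        (\<forall>z \<in> trajs p T 0 x. cost T L Ls G Gs \<mu> 0 y \<le> cost T L Ls G Gs \<mu> 0 z))"

definition mild_solution ::
    "real \<Rightarrow> real \<Rightarrow>
     ('n::finite \<Rightarrow> (real^'n) measure \<Rightarrow> real \<Rightarrow> real \<Rightarrow> real) \<Rightarrow> ((real^'n) measure \<Rightarrow> real) \<Rightarrow>
     ('n \<Rightarrow> (real^'n) measure \<Rightarrow> real \<Rightarrow> real) \<Rightarrow> ((real^'n) measure \<Rightarrow> real) \<Rightarrow>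
     (real \<Rightarrow> real^'n) measure \<Rightarrow> (real^'n \<Rightarrow> real \<Rightarrow> real) \<Rightarrow> (real \<Rightarrow> (real^'n) measure) \<Rightarrow> bool" where
  "mild_solution p T L Ls G Gs \<mu> u m \<longleftrightarrow>
     (\<forall>t\<in>{0..T}. m t = marginal \<mu> t) \<and>
     (\<forall>x\<in>junction. \<forall>t\<in>{0..T}. u x t = (INF y\<in>trajs p T t x. cost T L Ls G Gs \<mu> t y))"

definition hamiltonian ::
    "('n::finite \<Rightarrow> (real^'n) measure \<Rightarrow> real \<Rightarrow> real \<Rightarrow> real) \<Rightarrow> (real \<Rightarrow> (real^'n) measure) \<Rightarrow>
     'n \<Rightarrow> real \<Rightarrow> real \<Rightarrow> real \<Rightarrow> real" where
  "hamiltonian L m i x q t = (SUP \<zeta>. - q * \<zeta> - L i (m t) x \<zeta>)"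

definition Q_set :: "real \<Rightarrow> (real \<Rightarrow> (real^'n::finite) measure) \<Rightarrow> ((real^'n) \<times> real) set" where
  "Q_set T m = {(x, t). x \<in> junction - {0} \<and> 0 < t \<and> t < T \<and> x \<in> supp (top_of_set junction) (m t)}"

text \<open>Used only at \<open>x \<noteq> 0\<close>, where points of the junction near \<open>x\<close> lie on the edge of \<open>x\<close>.\<close>

definition superdiff ::
    "real \<Rightarrow> (real^'n::finite \<Rightarrow> real \<Rightarrow> real) \<Rightarrow> real^'n \<Rightarrow> real \<Rightarrow> (real \<times> real) set" where
  "superdiff T u x t = {(\<pi>, q).
     Limsup (at (x, t) within junction \<times> {0<..<T})
       (\<lambda>(y, \<theta>). ereal ((u y \<theta> - u x t - \<pi> * (\<theta> - t) - q * (norm y - norm x)) /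
                        (\<bar>norm y - norm x\<bar> + \<bar>\<theta> - t\<bar>))) \<le> 0}"

definition differentiable_on_edge ::
    "(real^'n::finite \<Rightarrow> real \<Rightarrow> real) \<Rightarrow> 'n \<Rightarrow> real^'n \<Rightarrow> real \<Rightarrow> bool" where
  "differentiable_on_edge u i x t \<longleftrightarrow>
     (\<lambda>(r, \<theta>). u (r *\<^sub>R axis i 1) \<theta>) differentiable (at (norm x, t))"

end

theory Submission
  imports Defs
begin

text \<open>
  A point \<open>(x, t)\<close> of \<open>Q\<^sub>m\<close> is a limit of points \<open>(y t, t)\<close> on trajectories \<open>y \<in> supp \<mu>\<close>, each of which
  minimises the cost from its starting point. The Euler-Lagrange equation, which needs no regularity
  of the Lagrangian in time, shows that near \<open>t\<close> the velocities of these \<open>y\<close> are bounded and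
  equicontinuous off null sets, uniformly in \<open>y\<close>. So along a subsequence they have a common
  approximate value \<open>a\<close> at time \<open>t\<close>, and no limit trajectory through \<open>(x, t)\<close> is needed.

  Joining a nearby point \<open>(x', t')\<close> by segments to \<open>y (t - h)\<close> and to \<open>y (t + h)\<close> bounds \<open>u (x', t')\<close>
  from below and from above by the costs of these segments. If \<open>h\<close> is a large multiple of the
  distance from \<open>(x', t')\<close> to \<open>(x, t)\<close>, both bounds have the same linearisation, with slope
  \<open>q = - \<partial>\<^sub>a L (x, a)\<close> in space and \<open>a \<partial>\<^sub>a L (x, a) - L (x, a) = H (x, q)\<close> in time. Hence \<open>u\<close> is
  differentiable at \<open>(x, t)\<close>, and its superdifferential consists of this one pair.
\<close>

section \<open>Weak derivatives on an interval\<close>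

text \<open>Optimality is known only from time 0 and only for trajectories that pass near (x, t).
  The lower bound therefore tests \<open>y\<close> against the path that follows \<open>y\<close> to
  time t - h, runs along the segment to (x', t') and continues with an arbitrary competitor; for the
  upper bound, the segment to \<open>y (t + h)\<close> is followed by \<open>y\<close>. The cost of
  \<open>y\<close> after time t occurs in both bounds and cancels in differences of values, so that
  \<open>y\<close> may be replaced by a closer trajectory at each scale h. This is why the
  oscillation of the velocity near t must be controlled independently of \<open>y\<close>. With the
  Lagrangian frozen at (x, t) as \<Lambda>, a segment costs \<open>q * \<Lambda> (z / q)\<close>.
  Freezing makes an error \<epsilon> h. Linearising at the velocity a makes an error that is a small
  multiple of the distance e to (x, t), provided that h = M e with M large. Hence \<epsilon> has to
  be chosen after M. The vertex does not interfere: as x is not 0, equicontinuity keeps all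
  trajectories passing near (x, t) on one edge during a common time interval, where the problem is
  one-dimensional in |y|.\<close>

text \<open>Lebesgue differentiation: almost every value is the limit of the averages over
  [s, s + h], and these all vanish. The extension by zero makes the differentiation theorem on the
  whole line applicable.\<close>

lemma negligible_support_if_integrals_zero:
  fixes f :: "real \<Rightarrow> 'b::euclidean_space"
  assumes f: "f absolutely_integrable_on {a..b}"
    and zero: "\<And>c d. a \<le> c \<Longrightarrow> c \<le> d \<Longrightarrow> d \<le> b \<Longrightarrow> integral {c..d} f = 0"
  shows "\<exists>N. negligible N \<and> (\<forall>s\<in>{a..b} - N. f s = 0)"
proof -
  define g where "g = (\<lambda>s. if s \<in> {a..b} then f s else 0)"
  have ab: "f integrable_on {a..b}"
    using f by (simp add: absolutely_integrable_on_def)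
  have gint: "g integrable_on cbox c d" for c d
  proof -
    have "g integrable_on UNIV"
      unfolding g_def using ab by (subst integrable_restrict_UNIV)
    then show ?thesis by (rule integrable_on_subcbox) simp
  qed
  have gz: "integral (cbox c d) g = 0" for c d
  proof -
    have "integral (cbox c d) g = integral ({a..b} \<inter> {c..d}) f"
      unfolding g_def using integral_restrict_Int[of "{c..d}" "{a..b}" f] by simp
    also have "{a..b} \<inter> {c..d} = {max a c..min b d}" by auto
    also have "integral {max a c..min b d} f = 0"
      using zero[of "max a c" "min b d"] by (cases "max a c \<le> min b d") auto
    finally show ?thesis .
  qed
  obtain N where "negligible N" and N: "\<And>x e. \<lbrakk>x \<notin> N; 0 < e\<rbrakk> \<Longrightarrow>
      \<exists>d>0. \<forall>h. 0 < h \<and> h < d \<longrightarrow> norm (integral (cbox x (x + h *\<^sub>R One)) g /\<^sub>R h ^ DIM(real) - g x) < e"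
    using integrable_ccontinuous_explicit[of g] gint by blast
  have "f s = 0" if s: "s \<in> {a..b} - N" for s
  proof (rule ccontr)
    assume "f s \<noteq> 0"
    then have pos: "0 < norm (f s)" by simp
    have "s \<notin> N" using s by simp
    from N[OF this pos] obtain d where "d > 0"
      and d: "\<forall>h. 0 < h \<and> h < d \<longrightarrow> norm (integral (cbox s (s + h *\<^sub>R One)) g /\<^sub>R h ^ DIM(real) - g s) < norm (f s)"
      by (elim exE conjE)
    \<comment> \<open>As the averages vanish, the estimate with tolerance \<open>norm (f s)\<close>
      bounds \<open>g s\<close>, which is \<open>f s\<close> itself.\<close>
    have "norm (g s) < norm (f s)"
      using d[rule_format, of "d/2"] \<open>d > 0\<close> unfolding gz by simp
    then show False using s by (auto simp: g_def)
  qed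
  with \<open>negligible N\<close> show ?thesis by blast
qed

text \<open>Summed over a fine partition, the increments of E are at most the largest oscillation of
  A times the total increase of B, and the first factor tends to 0. This is the device by which a
  second-order defect is discarded without differentiating anything.\<close>

lemma increments_zero_imp_constant:
  fixes E :: "real \<Rightarrow> 'b::real_normed_vector" and A B :: "real \<Rightarrow> real"
  assumes "a \<le> b" and A: "continuous_on {a..b} A"
    and E: "\<And>s s'. a \<le> s \<Longrightarrow> s \<le> s' \<Longrightarrow> s' \<le> b \<Longrightarrow> norm (E s' - E s) \<le> \<bar>A s' - A s\<bar> * (B s' - B s)"
    and B: "\<And>s s'. a \<le> s \<Longrightarrow> s \<le> s' \<Longrightarrow> s' \<le> b \<Longrightarrow> B s \<le> B s'"
  shows "E b = E a"
proof -
  have "norm (E b - E a) \<le> e * (B b - B a)" if "e > 0" for e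
  proof -
    obtain d where "d > 0" and d: "\<And>s s'. s \<in> {a..b} \<Longrightarrow> s' \<in> {a..b} \<Longrightarrow> dist s' s < d \<Longrightarrow> dist (A s') (A s) < e"
      using compact_uniformly_continuous[OF A] \<open>e > 0\<close> unfolding uniformly_continuous_on_def by (metis compact_Icc)
    obtain n :: nat where n: "real n > (b - a) / d" using reals_Archimedean2 by blast
    have "n > 0" using n \<open>d > 0\<close> \<open>a \<le> b\<close>
      by (metis divide_nonneg_pos diff_ge_0_iff_ge gr0I of_nat_0 not_less)
    define q where "q = (\<lambda>k::nat. a + real k * ((b - a) / real n))"
    have step: "(b - a) / real n \<ge> 0" "(b - a) / real n < d"
      using n \<open>d > 0\<close> \<open>n > 0\<close> \<open>a \<le> b\<close> by (auto simp: field_simps)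
    have q0: "q 0 = a" and qn: "q n = b" using \<open>n > 0\<close> by (auto simp: q_def)
    have qmono: "q j \<le> q k" if "j \<le> k" for j k
      unfolding q_def using step(1) that by (intro add_left_mono mult_right_mono) auto
    have qin: "a \<le> q k" "k \<le> n \<Longrightarrow> q k \<le> b" for k
      using qmono[of 0 k] qmono[of k n] q0 qn by auto
    have inc: "norm (E (q (Suc k)) - E (q k)) \<le> e * (B (q (Suc k)) - B (q k))" if "k < n" for k
    proof -
      have "q (Suc k) - q k = (b - a) / real n" by (simp add: q_def algebra_simps add_divide_distrib diff_divide_distrib)
      then have "dist (q (Suc k)) (q k) < d" using step by (simp add: dist_real_def)
      then have "dist (A (q (Suc k))) (A (q k)) < e" using qin that by (intro d) auto
      then have "\<bar>A (q (Suc k)) - A (q k)\<bar> \<le> e" by (simp add: dist_real_def)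
      moreover have "B (q k) \<le> B (q (Suc k))" using that qin qmono by (intro B) auto
      ultimately have "\<bar>A (q (Suc k)) - A (q k)\<bar> * (B (q (Suc k)) - B (q k)) \<le> e * (B (q (Suc k)) - B (q k))"
        by (intro mult_right_mono) auto
      moreover have "norm (E (q (Suc k)) - E (q k)) \<le> \<bar>A (q (Suc k)) - A (q k)\<bar> * (B (q (Suc k)) - B (q k))"
        using that qin qmono by (intro E) auto
      ultimately show ?thesis by linarith
    qed
    have "E b - E a = (\<Sum>k<n. E (q (Suc k)) - E (q k))"
      using sum_lessThan_telescope[of "\<lambda>k. E (q k)" n] q0 qn by simp
    also have "norm \<dots> \<le> (\<Sum>k<n. e * (B (q (Suc k)) - B (q k)))"
      by (rule sum_norm_le) (use inc in auto)
    also have "\<dots> = e * (B b - B a)"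
      using sum_lessThan_telescope[of "\<lambda>k. B (q k)" n] q0 qn by (simp add: sum_distrib_left[symmetric])
    finally show ?thesis .
  qed
  note key = this
  have BB: "B b - B a \<ge> 0" using B[of a b] \<open>a \<le> b\<close> by simp
  have "norm (E b - E a) \<le> 0 + e" if "e > 0" for e
  proof -
    \<comment> \<open>The summand 1 keeps the quotient meaningful when B is constant.\<close>
    have "norm (E b - E a) \<le> e / (B b - B a + 1) * (B b - B a)"
      using key[of "e / (B b - B a + 1)"] BB \<open>e > 0\<close> by simp
    also have "\<dots> \<le> e" using BB \<open>e > 0\<close> by (simp add: field_simps)
    finally show ?thesis by simp
  qed
  then have "norm (E b - E a) \<le> 0" using field_le_epsilon by blast
  then show ?thesis by simp
qed

section \<open>Integration by parts for integrable factors\<close>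

lemma absint_sub:
  fixes f :: "real \<Rightarrow> 'b::euclidean_space"
  assumes "f absolutely_integrable_on {a..b}" "a \<le> c" "d \<le> b"
  shows "f absolutely_integrable_on {c..d}"
  using assms by (auto intro: absolutely_integrable_on_subinterval)

lemma absint_imp_int:
  fixes f :: "'a::euclidean_space \<Rightarrow> 'b::euclidean_space"
  shows "f absolutely_integrable_on S \<Longrightarrow> f integrable_on S"
  by (simp add: absolutely_integrable_on_def)

lemma absint_norm_int:
  fixes f :: "'a::euclidean_space \<Rightarrow> 'b::euclidean_space"
  shows "f absolutely_integrable_on S \<Longrightarrow> (\<lambda>s. norm (f s)) integrable_on S"
  by (simp add: absolutely_integrable_on_def)

lemma integral_diff_subinterval:
  fixes f :: "real \<Rightarrow> 'b::banach"
  assumes "f integrable_on {a..b}" "a \<le> s" "s \<le> s'" "s' \<le> b"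
  shows "integral {a..s'} f - integral {a..s} f = integral {s..s'} f"
proof -
  have "f integrable_on {a..s'}"
    using assms by (intro integrable_on_subinterval[OF assms(1)]) auto
  then show ?thesis
    using Henstock_Kurzweil_Integration.integral_combine[of a s s' f] assms by (simp add: algebra_simps)
qed

lemma absint_scaleR_continuous:
  fixes g :: "real \<Rightarrow> 'b::euclidean_space"
  assumes "continuous_on {a..b} F" "g absolutely_integrable_on {a..b}"
  shows "(\<lambda>s. F s *\<^sub>R g s) absolutely_integrable_on {a..b}"
proof (rule absolutely_integrable_bounded_measurable_product[where h="(*\<^sub>R)"])
  show "bilinear ((*\<^sub>R) :: real \<Rightarrow> 'b \<Rightarrow> 'b)"
    by (simp add: bilinear_conv_bounded_bilinear bounded_bilinear_scaleR)
  show "F \<in> borel_measurable (lebesgue_on {a..b})"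
    using assms(1) by (simp add: continuous_imp_measurable_on_sets_lebesgue)
  show "bounded (F ` {a..b})"
    using assms(1) compact_Icc compact_continuous_image compact_imp_bounded by blast
qed (use assms in auto)

lemma absint_scaleR_continuous':
  fixes G :: "real \<Rightarrow> 'b::euclidean_space"
  assumes "continuous_on {a..b} G" "f absolutely_integrable_on {a..b}"
  shows "(\<lambda>s. f s *\<^sub>R G s) absolutely_integrable_on {a..b}"
proof (rule absolutely_integrable_bounded_measurable_product[where h="(\<lambda>x y. y *\<^sub>R x)"])
  show "bilinear ((\<lambda>x y. y *\<^sub>R x) :: 'b \<Rightarrow> real \<Rightarrow> 'b)"
    by (simp add: bilinear_conv_bounded_bilinear bounded_bilinear.flip bounded_bilinear_scaleR)
  show "G \<in> borel_measurable (lebesgue_on {a..b})"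
    using assms(1) by (simp add: continuous_imp_measurable_on_sets_lebesgue)
  show "bounded (G ` {a..b})"
    using assms(1) compact_Icc compact_continuous_image compact_imp_bounded by blast
qed (use assms in auto)

text \<open>Since \<open>f\<close> and \<open>g\<close> are only integrable, the product rule is not available. But over \<open>[s, s']\<close> its
  defect is at most a constant times \<open>(\<integral>\<bar>f\<bar>) (\<integral>\<bar>g\<bar>)\<close>, of second order.\<close>

lemma integral_by_parts_indefinite:
  fixes f :: "real \<Rightarrow> real" and g :: "real \<Rightarrow> 'b::euclidean_space"
  assumes f: "f absolutely_integrable_on {a..b}" and g: "g absolutely_integrable_on {a..b}"
    and "a \<le> b"
  shows "integral {a..b} (\<lambda>s. integral {a..s} f *\<^sub>R g s + f s *\<^sub>R integral {a..s} g)
       = integral {a..b} f *\<^sub>R integral {a..b} g"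
proof -
  define F where "F = (\<lambda>s. integral {a..s} f)"
  define G where "G = (\<lambda>s. integral {a..s} g)"
  \<comment> \<open>The factor 3 accounts for the three second-order terms in an increment of E: the
    product of the two increments and the two integrals with frozen values subtracted.\<close>
  define A where "A = (\<lambda>s. 3 * integral {a..s} (\<lambda>r. norm (f r)))"
  define B where "B = (\<lambda>s. integral {a..s} (\<lambda>r. norm (g r)))"
  define k where "k = (\<lambda>s. F s *\<^sub>R g s + f s *\<^sub>R G s)"
  have contF: "continuous_on {a..b} F" and contG: "continuous_on {a..b} G"
    unfolding F_def G_def
    using indefinite_integral_continuous_1 absint_imp_int f g by blast+
  have contA: "continuous_on {a..b} A"
    unfolding A_def by (intro continuous_intros indefinite_integral_continuous_1 absint_norm_int f)
  have k: "k absolutely_integrable_on {a..b}"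
    unfolding k_def by (intro set_integral_add absint_scaleR_continuous absint_scaleR_continuous' contF contG f g)
  define E where "E = (\<lambda>s. F s *\<^sub>R G s - integral {a..s} k)"
  have "E b = E a"
  proof (rule increments_zero_imp_constant[OF \<open>a \<le> b\<close> contA])
    fix s s' assume s: "a \<le> s" "s \<le> s'" "s' \<le> b"
    have sub: "h absolutely_integrable_on {s..s'}" if "h absolutely_integrable_on {a..b}"
      for h :: "real \<Rightarrow> 'c::euclidean_space"
      using that s by (intro absint_sub[OF that]) auto
    have Bd: "B s' - B s = integral {s..s'} (\<lambda>r. norm (g r))"
      unfolding B_def using s g by (intro integral_diff_subinterval absint_norm_int) auto
    have Ad: "A s' - A s = 3 * integral {s..s'} (\<lambda>r. norm (f r))"
      unfolding A_def using s integral_diff_subinterval[OF absint_norm_int[OF f], of s s']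
      by (simp add: algebra_simps)
    show "B s \<le> B s'"
    proof -
      have "0 \<le> integral {s..s'} (\<lambda>r. norm (g r))"
        by (intro Henstock_Kurzweil_Integration.integral_nonneg absint_norm_int sub g) simp
      then show ?thesis using Bd by simp
    qed
    have inF: "norm (F r - F s) \<le> integral {s..s'} (\<lambda>r. norm (f r))" if "r \<in> {s..s'}" for r
    proof -
      have "F r - F s = integral {s..r} f"
        unfolding F_def using s that f by (intro integral_diff_subinterval absint_imp_int) auto
      also have "norm \<dots> \<le> integral {s..r} (\<lambda>r. norm (f r))"
        using that by (intro integral_norm_bound_integral absint_imp_int absint_norm_int absint_sub[OF sub[OF f]]) auto
      also have "\<dots> \<le> integral {s..s'} (\<lambda>r. norm (f r))"
        using that by (intro integral_subset_le absint_norm_int absint_sub[OF sub[OF f]]) auto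
      finally show ?thesis .
    qed
    have inG: "norm (G r - G s) \<le> integral {s..s'} (\<lambda>r. norm (g r))" if "r \<in> {s..s'}" for r
    proof -
      have "G r - G s = integral {s..r} g"
        unfolding G_def using s that g by (intro integral_diff_subinterval absint_imp_int) auto
      also have "norm \<dots> \<le> integral {s..r} (\<lambda>r. norm (g r))"
        using that by (intro integral_norm_bound_integral absint_imp_int absint_norm_int absint_sub[OF sub[OF g]]) auto
      also have "\<dots> \<le> integral {s..s'} (\<lambda>r. norm (g r))"
        using that by (intro integral_subset_le absint_norm_int absint_sub[OF sub[OF g]]) auto
      finally show ?thesis .
    qed
    define \<alpha> where "\<alpha> = integral {s..s'} (\<lambda>r. norm (f r))"
    define \<beta> where "\<beta> = integral {s..s'} (\<lambda>r. norm (g r))"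
    have cF: "continuous_on {s..s'} F" and cG: "continuous_on {s..s'} G"
      using contF contG s by (auto intro: continuous_on_subset)
    have i1: "(\<lambda>r. (F r - F s) *\<^sub>R g r) absolutely_integrable_on {s..s'}"
      by (intro absint_scaleR_continuous continuous_intros cF sub g)
    have i2: "(\<lambda>r. f r *\<^sub>R (G r - G s)) absolutely_integrable_on {s..s'}"
      by (intro absint_scaleR_continuous' continuous_intros cG sub f)
    have i3: "(\<lambda>r. F s *\<^sub>R g r) absolutely_integrable_on {s..s'}"
      by (intro absint_scaleR_continuous continuous_intros sub g)
    have i4: "(\<lambda>r. f r *\<^sub>R G s) absolutely_integrable_on {s..s'}"
      by (intro absint_scaleR_continuous' continuous_intros sub f)
    \<comment> \<open>The values of F and G at s are split off. The part with these frozen values is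
      computed exactly and cancels the first-order part of the increment of F G.\<close>
    have "integral {s..s'} k = integral {s..s'} (\<lambda>r. ((F r - F s) *\<^sub>R g r + f r *\<^sub>R (G r - G s)) + (F s *\<^sub>R g r + f r *\<^sub>R G s))"
      unfolding k_def by (intro Henstock_Kurzweil_Integration.integral_cong) (simp add: algebra_simps)
    also have "\<dots> = integral {s..s'} (\<lambda>r. (F r - F s) *\<^sub>R g r) + integral {s..s'} (\<lambda>r. f r *\<^sub>R (G r - G s))
        + (integral {s..s'} (\<lambda>r. F s *\<^sub>R g r) + integral {s..s'} (\<lambda>r. f r *\<^sub>R G s))"
      using i1 i2 i3 i4 by (simp add: Henstock_Kurzweil_Integration.integral_add absint_imp_int integrable_add)
    also have "integral {s..s'} (\<lambda>r. F s *\<^sub>R g r) = F s *\<^sub>R (G s' - G s)"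
      unfolding G_def using s g by (subst integral_diff_subinterval) (auto intro: absint_imp_int)
    also have "integral {s..s'} (\<lambda>r. f r *\<^sub>R G s) = (F s' - F s) *\<^sub>R G s"
    proof -
      have "integral {s..s'} (\<lambda>r. f r *\<^sub>R G s) = integral {s..s'} f *\<^sub>R G s"
        using integral_linear[OF absint_imp_int[OF sub[OF f]] bounded_linear_scaleR_left[of "G s"]]
        by (simp add: o_def)
      also have "integral {s..s'} f = F s' - F s"
        unfolding F_def using s f by (subst integral_diff_subinterval) (auto intro: absint_imp_int)
      finally show ?thesis .
    qed
    finally have kk: "integral {s..s'} k = integral {s..s'} (\<lambda>r. (F r - F s) *\<^sub>R g r)
      + integral {s..s'} (\<lambda>r. f r *\<^sub>R (G r - G s)) + (F s *\<^sub>R (G s' - G s) + (F s' - F s) *\<^sub>R G s)" .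
    have "integral {a..s'} k - integral {a..s} k = integral {s..s'} k"
      using s k by (intro integral_diff_subinterval absint_imp_int) auto
    then have "E s' - E s = (F s' - F s) *\<^sub>R (G s' - G s)
        - integral {s..s'} (\<lambda>r. (F r - F s) *\<^sub>R g r) - integral {s..s'} (\<lambda>r. f r *\<^sub>R (G r - G s))"
      unfolding E_def using kk by (simp add: algebra_simps)
    moreover have "norm (p - x - y) \<le> norm p + norm x + norm y" for p x y :: 'b
      using norm_triangle_ineq4[of "p - x" y] norm_triangle_ineq4[of p x] by linarith
    ultimately have "norm (E s' - E s) \<le> norm ((F s' - F s) *\<^sub>R (G s' - G s))
        + norm (integral {s..s'} (\<lambda>r. (F r - F s) *\<^sub>R g r)) + norm (integral {s..s'} (\<lambda>r. f r *\<^sub>R (G r - G s)))"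
      by presburger
    also have "norm ((F s' - F s) *\<^sub>R (G s' - G s)) \<le> \<alpha> * \<beta>"
      unfolding norm_scaleR \<alpha>_def \<beta>_def using inF[of s'] inG[of s'] s
      by (intro mult_mono) (auto intro: order_trans[OF abs_ge_zero])
    also have "norm (integral {s..s'} (\<lambda>r. (F r - F s) *\<^sub>R g r)) \<le> integral {s..s'} (\<lambda>r. \<alpha> * norm (g r))"
      using inF by (intro integral_norm_bound_integral absint_imp_int i1 integrable_on_mult_right absint_norm_int sub g)
        (auto simp: \<alpha>_def intro: mult_right_mono)
    also have "\<dots> = \<alpha> * \<beta>" by (simp add: \<beta>_def)
    also have "norm (integral {s..s'} (\<lambda>r. f r *\<^sub>R (G r - G s))) \<le> integral {s..s'} (\<lambda>r. norm (f r) * \<beta>)"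
      using inG by (intro integral_norm_bound_integral absint_imp_int i2 integrable_on_mult_left absint_norm_int sub f)
        (auto simp: \<beta>_def intro: mult_left_mono)
    also have "\<dots> = \<alpha> * \<beta>" by (simp add: \<alpha>_def)
    finally have "norm (E s' - E s) \<le> 3 * \<alpha> * \<beta>" by simp
    also have "\<dots> \<le> \<bar>A s' - A s\<bar> * (B s' - B s)"
      unfolding Ad Bd \<alpha>_def[symmetric] \<beta>_def[symmetric]
      using \<open>B s \<le> B s'\<close> Bd by (intro mult_right_mono) (auto simp: \<beta>_def)
    finally show "norm (E s' - E s) \<le> \<bar>A s' - A s\<bar> * (B s' - B s)" .
  qed
  moreover have "E a = 0" by (simp add: E_def F_def)
  ultimately have "integral {a..b} k = F b *\<^sub>R G b" unfolding E_def by (metis eq_iff_diff_eq_0)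
  then show ?thesis by (simp add: k_def F_def G_def)
qed

section \<open>Weak derivatives and absolutely continuous functions\<close>

lemma integrable_lebesgue_on_iff:
  fixes f :: "'a::euclidean_space \<Rightarrow> 'b::euclidean_space"
  assumes "S \<in> sets lebesgue"
  shows "integrable (lebesgue_on S) f \<longleftrightarrow> f absolutely_integrable_on S"
  using assms by (simp add: integrable_restrict_space set_integrable_def)

text \<open>The compact support is enlarged to a compact interval inside (a, b), so that integrals
  against test functions become integrals over intervals.\<close>

lemma test_functionsE:
  assumes "\<phi> \<in> test_functions a b" "a < b"
  obtains c d where "a < c" "c \<le> d" "d < b"
    "\<forall>s. s \<notin> {c..d} \<longrightarrow> \<phi> s = 0" "\<forall>s. s \<notin> {c..d} \<longrightarrow> deriv \<phi> s = 0"
    "\<And>s. (\<phi> has_real_derivative deriv \<phi> s) (at s)"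
    "continuous_on UNIV (deriv \<phi>)" "continuous_on UNIV \<phi>"
proof -
  obtain K where C1: "\<phi> C1_differentiable_on UNIV" and K: "compact K" "K \<subseteq> {a<..<b}"
    and zero: "\<And>s. s \<notin> K \<Longrightarrow> \<phi> s = 0"
    using assms by (auto simp: test_functions_def)
  obtain D where D: "\<And>s. (\<phi> has_vector_derivative D s) (at s)" and contD: "continuous_on UNIV D"
    using C1 by (auto simp: C1_differentiable_on_def)
  have DR: "(\<phi> has_real_derivative D s) (at s)" for s
    using D by (simp add: has_real_derivative_iff_has_vector_derivative)
  have deriv: "deriv \<phi> = D"
    using DR by (auto intro: DERIV_imp_deriv)
  \<comment> \<open>An empty support has no infimum; the midpoint then serves as a degenerate
    interval.\<close>
  define c where "c = (if K = {} then (a + b) / 2 else Inf K)"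
  define d where "d = (if K = {} then (a + b) / 2 else Sup K)"
  have bb: "bdd_below K" "bdd_above K"
    using compact_imp_bounded[OF K(1)] by (auto intro: bounded_imp_bdd_below bounded_imp_bdd_above)
  have mem: "Inf K \<in> K" "Sup K \<in> K" if "K \<noteq> {}"
    using that K(1) bb closed_contains_Inf closed_contains_Sup compact_imp_closed by blast+
  have "a < c" "d < b"
    using mem K(2) \<open>a < b\<close> by (cases "K = {}"; force simp: c_def d_def)+
  have "c \<le> d"
    using mem bb cInf_lower[of "Sup K" K] by (auto simp: c_def d_def)
  have sub: "K \<subseteq> {c..d}"
    using bb by (auto simp: c_def d_def intro: cInf_lower cSup_upper)
  have z: "\<phi> s = 0" if "s \<notin> {c..d}" for s
    using that sub zero by blast
  have "D s = 0" if s: "s \<notin> {c..d}" for s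
  proof -
    have "((\<lambda>_. 0) has_real_derivative D s) (at s)"
    proof (rule has_field_derivative_transform_within_open[OF DR])
      show "open (- {c..d})" by auto
    qed (use s z in auto)
    then show ?thesis using DERIV_const DERIV_unique by blast
  qed
  moreover have "continuous_on UNIV \<phi>"
    using DR DERIV_continuous_on by blast
  ultimately show thesis
    using that[of c d] \<open>a < c\<close> \<open>c \<le> d\<close> \<open>d < b\<close> z DR contD deriv by blast
qed

lemma integral_outside_zero:
  fixes h :: "real \<Rightarrow> 'b::euclidean_space"
  assumes "h absolutely_integrable_on {c..d}" "{c..d} \<subseteq> S" "\<And>s. s \<notin> {c..d} \<Longrightarrow> h s = 0"
  shows "h absolutely_integrable_on S" "integral S h = integral {c..d} h"
proof -
  have 1: "{s \<in> {c..d} - S. h s \<noteq> 0} = {}" and 2: "{s \<in> S - {c..d}. h s \<noteq> 0} = {}"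
    using assms by auto
  show "h absolutely_integrable_on S" "integral S h = integral {c..d} h"
    using absolutely_integrable_spike_set_eq[of "{c..d}" S h] assms(1) integral_spike_set[of S "{c..d}" h]
    unfolding 1 2 by simp_all
qed

text \<open>The bridge between the Lebesgue integrals in the definition of weak derivatives and the
  gauge integral, in which the calculus is carried out.\<close>

lemma test_product_integral:
  fixes y :: "real \<Rightarrow> 'b::euclidean_space"
  assumes y: "locally_integrable a b y" and cd: "a < c" "d < b" and g: "continuous_on UNIV g"
    and zero: "\<forall>s. s \<notin> {c..d} \<longrightarrow> g s = 0"
  shows "(\<lambda>s. g s *\<^sub>R y s) absolutely_integrable_on {c..d}"
    "(LINT s|lebesgue_on {a<..<b}. g s *\<^sub>R y s) = integral {c..d} (\<lambda>s. g s *\<^sub>R y s)"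
proof -
  have "compact {c..d}" "{c..d} \<subseteq> {a<..<b}" using cd by auto
  then have "integrable (lebesgue_on {c..d}) y"
    using y unfolding locally_integrable_def by blast
  then have "y absolutely_integrable_on {c..d}"
    by (subst (asm) integrable_lebesgue_on_iff) auto
  then show *: "(\<lambda>s. g s *\<^sub>R y s) absolutely_integrable_on {c..d}"
    by (intro absint_scaleR_continuous continuous_on_subset[OF g]) auto
  have sub: "{c..d} \<subseteq> {a<..<b}" using cd by auto
  note ** = integral_outside_zero[OF * sub]
  have "integrable (lebesgue_on {a<..<b}) (\<lambda>s. g s *\<^sub>R y s)"
    using **(1) zero by (subst integrable_lebesgue_on_iff) auto
  then show "(LINT s|lebesgue_on {a<..<b}. g s *\<^sub>R y s) = integral {c..d} (\<lambda>s. g s *\<^sub>R y s)"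
    using **(2) zero by (subst lebesgue_integral_eq_integral) auto
qed

lemma absint_imp_locally_integrable:
  fixes y :: "real \<Rightarrow> 'b::euclidean_space"
  assumes "y absolutely_integrable_on {a..b}"
  shows "locally_integrable a b y"
  unfolding locally_integrable_def
proof (intro allI impI)
  fix K assume K: "compact K \<and> K \<subseteq> {a<..<b}"
  then have "K \<in> sets lebesgue" by (simp add: compact_imp_closed)
  moreover have "y absolutely_integrable_on K"
  proof (rule set_integrable_subset[OF assms])
    show "K \<subseteq> {a..b}" using K by force
  qed (use \<open>K \<in> sets lebesgue\<close> in auto)
  ultimately show "integrable (lebesgue_on K) y"
    by (simp add: integrable_lebesgue_on_iff)
qed

text \<open>Integration by parts for \<open>deriv \<phi>\<close> and v, with \<phi> recovered as the
  primitive of its derivative. The boundary terms vanish with \<phi>, and the constant k pairs with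
  \<open>deriv \<phi>\<close> to 0.\<close>

lemma has_weak_deriv_indefinite_integral:
  fixes y :: "real \<Rightarrow> 'b::euclidean_space"
  assumes v: "v absolutely_integrable_on {a..b}" and "a < b"
    and y: "\<And>s. s \<in> {a..b} \<Longrightarrow> y s = k + integral {a..s} v"
  shows "has_weak_deriv a b y v"
proof -
  have "continuous_on {a..b} (\<lambda>s. k + integral {a..s} v)"
    by (intro continuous_intros indefinite_integral_continuous_1 absint_imp_int v)
  then have cont: "continuous_on {a..b} y"
    using y by (simp cong: continuous_on_cong_simp)
  have ly: "locally_integrable a b y"
    by (intro absint_imp_locally_integrable absolutely_integrable_continuous_real cont)
  have lv: "locally_integrable a b v"
    by (intro absint_imp_locally_integrable v)
  have "(LINT s|lebesgue_on {a<..<b}. deriv \<phi> s *\<^sub>R y s) = - (LINT s|lebesgue_on {a<..<b}. \<phi> s *\<^sub>R v s)"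
    if \<phi>: "\<phi> \<in> test_functions a b" for \<phi>
  proof -
    obtain c d where cd: "a < c" "c \<le> d" "d < b" "\<forall>s. s \<notin> {c..d} \<longrightarrow> \<phi> s = 0" "\<forall>s. s \<notin> {c..d} \<longrightarrow> deriv \<phi> s = 0"
       "continuous_on UNIV (deriv \<phi>)" "continuous_on UNIV \<phi>"
       and der: "\<And>s. (\<phi> has_real_derivative deriv \<phi> s) (at s)"
      using test_functionsE[OF \<phi> \<open>a < b\<close>] by metis
    note t1 = test_product_integral[OF ly cd(1,3,6,5)]
    note t2 = test_product_integral[OF lv cd(1,3,7,4)]
    have ends: "\<phi> a = 0" "\<phi> b = 0" using cd by auto
    have FTC: "(deriv \<phi> has_integral \<phi> s - \<phi> a) {a..s}" if "a \<le> s" for s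
      using that der by (intro fundamental_theorem_of_calculus)
        (auto simp: has_real_derivative_iff_has_vector_derivative[symmetric] intro: has_field_derivative_at_within)
    have prim: "integral {a..s} (deriv \<phi>) = \<phi> s" if "a \<le> s" for s
      using integral_unique[OF FTC[OF that]] ends by simp
    have ad: "deriv \<phi> absolutely_integrable_on {a..b}"
      by (intro absolutely_integrable_continuous_real continuous_on_subset[OF cd(6)]) auto
    have sub: "{c..d} \<subseteq> {a..b}" using cd by auto
    have i1: "(\<lambda>s. deriv \<phi> s *\<^sub>R y s) absolutely_integrable_on {a..b}"
      by (rule integral_outside_zero[OF t1(1) sub]) (use cd in auto)
    have i2: "(\<lambda>s. \<phi> s *\<^sub>R v s) absolutely_integrable_on {a..b}"
      by (rule integral_outside_zero[OF t2(1) sub]) (use cd in auto)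
    have e1: "integral {a..b} (\<lambda>s. deriv \<phi> s *\<^sub>R y s) = integral {c..d} (\<lambda>s. deriv \<phi> s *\<^sub>R y s)"
      by (rule integral_outside_zero[OF t1(1) sub]) (use cd in auto)
    have e2: "integral {a..b} (\<lambda>s. \<phi> s *\<^sub>R v s) = integral {c..d} (\<lambda>s. \<phi> s *\<^sub>R v s)"
      by (rule integral_outside_zero[OF t2(1) sub]) (use cd in auto)
    have i0: "(\<lambda>s. deriv \<phi> s *\<^sub>R k) absolutely_integrable_on {a..b}"
      by (intro absint_scaleR_continuous' ad continuous_intros)
    have "integral {a..b} (\<lambda>s. deriv \<phi> s *\<^sub>R k) = 0"
      using integral_linear[OF absint_imp_int[OF ad] bounded_linear_scaleR_left[of k]] prim[of b] ends \<open>a < b\<close>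
      by (simp add: o_def)
    moreover have "integral {a..b} (\<lambda>s. integral {a..s} (deriv \<phi>) *\<^sub>R v s + deriv \<phi> s *\<^sub>R integral {a..s} v) = 0"
      using integral_by_parts_indefinite[OF ad v] prim[of b] ends \<open>a < b\<close> by simp
    moreover have "integral {a..b} (\<lambda>s. integral {a..s} (deriv \<phi>) *\<^sub>R v s + deriv \<phi> s *\<^sub>R integral {a..s} v)
       = integral {a..b} (\<lambda>s. (\<phi> s *\<^sub>R v s + deriv \<phi> s *\<^sub>R y s) - deriv \<phi> s *\<^sub>R k)"
      using prim y by (intro Henstock_Kurzweil_Integration.integral_cong) (simp add: algebra_simps)
    moreover have "\<dots> = integral {a..b} (\<lambda>s. \<phi> s *\<^sub>R v s) + integral {a..b} (\<lambda>s. deriv \<phi> s *\<^sub>R y s)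
       - integral {a..b} (\<lambda>s. deriv \<phi> s *\<^sub>R k)"
      using i0 i1 i2 by (simp add: Henstock_Kurzweil_Integration.integral_add Henstock_Kurzweil_Integration.integral_diff absint_imp_int integrable_add)
    ultimately show ?thesis
      unfolding t1(2) t2(2) e1[symmetric] e2[symmetric] by (simp add: eq_neg_iff_add_eq_0 add.commute)
  qed
  with ly lv show ?thesis by (simp add: has_weak_deriv_def)
qed

text \<open>The test function has derivative \<open>\<eta> (z - k)\<close>, where \<open>\<eta>\<close> is a cutoff and \<open>k\<close> the \<open>\<eta>\<close>-weighted
  mean of \<open>z\<close>; testing with it gives \<open>\<integral> \<eta> (z - k)\<^sup>2 = 0\<close>.\<close>

lemma du_bois_reymond:
  fixes z :: "real \<Rightarrow> real"
  assumes "a < b" and z: "continuous_on {a..b} z"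
    and zero: "\<And>\<phi>. \<phi> \<in> test_functions a b \<Longrightarrow> integral {a..b} (\<lambda>s. deriv \<phi> s * z s) = 0"
    and "s \<in> {a..b}"
  shows "z s = z a"
proof -
  \<comment> \<open>A test function has to vanish near a and b, so constancy is first shown inside
    compact subintervals; continuity of z carries it to the ends.\<close>
  have inner: "\<exists>k. \<forall>s\<in>{c<..<d}. z s = k" if cd: "a < c" "c < d" "d < b" for c d
  proof -
    \<comment> \<open>Continues z by its boundary values, so that every function built from it is
      continuous on the whole line.\<close>
    define zc where "zc = (\<lambda>s. z (max c (min d s)))"
    have zc: "continuous_on UNIV zc"
      unfolding zc_def by (rule continuous_on_compose2[OF z]) (use cd in \<open>auto intro!: continuous_intros\<close>)
    have zc_eq: "zc s = z s" if "s \<in> {c..d}" for s using that by (simp add: zc_def)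
    define \<eta> where "\<eta> = (\<lambda>s::real. if s \<in> {c..d} then (s - c) * (d - s) else 0)"
    have "\<eta> = (\<lambda>s. max 0 ((s - c) * (d - s)))"
    proof
      fix s
      show "\<eta> s = max 0 ((s - c) * (d - s))"
        using cd by (cases "s < c"; cases "d < s")
          (auto simp: \<eta>_def max_absorb1 max_absorb2 mult_nonneg_nonpos mult_nonpos_nonneg)
    qed
    then have \<eta>: "continuous_on UNIV \<eta>" by (auto intro!: continuous_intros)
    have \<eta>0: "\<eta> s \<ge> 0" for s by (auto simp: \<eta>_def)
    have \<eta>pos: "\<eta> s > 0" if "s \<in> {c<..<d}" for s using that by (auto simp: \<eta>_def)
    have cint: "g integrable_on {r..r'}" if "continuous_on UNIV g" for g :: "real \<Rightarrow> real" and r r'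
      using that by (intro integrable_continuous_real) (auto intro: continuous_on_subset)
    have "integral {c..d} \<eta> \<noteq> 0"
    proof
      assume "integral {c..d} \<eta> = 0"
      then have "\<forall>s\<in>{c..d}. \<eta> s = 0"
        using \<eta> \<eta>0 cd by (subst (asm) integral_eq_0_iff) (auto intro: continuous_on_subset)
      then show False using \<eta>pos[of "(c + d) / 2"] cd by auto
    qed
    define k where "k = integral {c..d} (\<lambda>s. \<eta> s * zc s) / integral {c..d} \<eta>"
    define \<psi> where "\<psi> = (\<lambda>s. \<eta> s * (zc s - k))"
    have \<psi>: "continuous_on UNIV \<psi>" unfolding \<psi>_def by (intro continuous_intros \<eta> zc)
    have \<psi>0: "\<psi> s = 0" if "s \<notin> {c..d}" for s using that by (auto simp: \<psi>_def \<eta>_def)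
    have "integral {c..d} \<psi> = integral {c..d} (\<lambda>s. \<eta> s * zc s - k * \<eta> s)"
      by (simp add: \<psi>_def algebra_simps)
    also have "\<dots> = integral {c..d} (\<lambda>s. \<eta> s * zc s) - k * integral {c..d} \<eta>"
      by (subst Henstock_Kurzweil_Integration.integral_diff) (auto intro!: cint continuous_intros \<eta> zc)
    also have "\<dots> = 0" using \<open>integral {c..d} \<eta> \<noteq> 0\<close> by (simp add: k_def)
    finally have int0: "integral {c..d} \<psi> = 0" .
    define \<phi> where "\<phi> = (\<lambda>s. integral {c..s} \<psi>)"
    \<comment> \<open>For s below c the integral from c is 0 by convention. Since \<psi> vanishes
      there, the lower limit may be moved to any m below c and s, and s becomes interior to the
      domain of the primitive.\<close>
    have prim: "\<phi> s = integral {m..s} \<psi>" if "m \<le> c" "m \<le> s" for m s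
    proof (cases "s \<le> c")
      case True
      have "integral {m..s} \<psi> = integral {m..s} (\<lambda>_. 0)"
      proof (rule integral_spike[of "{c}"])
        show "(0::real) = \<psi> r" if "r \<in> {m..s} - {c}" for r using that True \<psi>0[of r] by auto
      qed auto
      moreover have "\<phi> s = 0" using True by (cases "s = c") (auto simp: \<phi>_def)
      ultimately show ?thesis by simp
    next
      case False
      have "integral {m..c} \<psi> + integral {c..s} \<psi> = integral {m..s} \<psi>"
        using that False by (intro Henstock_Kurzweil_Integration.integral_combine cint \<psi>) auto
      moreover have "integral {m..c} \<psi> = integral {m..c} (\<lambda>_. 0)"
        using \<psi>0 by (intro integral_spike[of "{c}"]) auto
      ultimately show ?thesis by (simp add: \<phi>_def)
    qed
    have der: "(\<phi> has_vector_derivative \<psi> s) (at s)" for s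
    proof -
      define m where "m = min c s - 1"
      have "((\<lambda>r. integral {m..r} \<psi>) has_vector_derivative \<psi> s) (at s within {m..s+1})"
        by (rule integral_has_vector_derivative) (auto intro: continuous_on_subset[OF \<psi>] simp: m_def)
      then have "((\<lambda>r. integral {m..r} \<psi>) has_vector_derivative \<psi> s) (at s)"
        by (subst (asm) at_within_interior) (auto simp: m_def)
      then show ?thesis
      proof (rule has_vector_derivative_transform_within_open[where S="{m<..}"])
        show "integral {m..r} \<psi> = \<phi> r" if "r \<in> {m<..}" for r
          using prim[of m r] that by (simp add: m_def)
      qed (auto simp: m_def)
    qed
    have d\<phi>: "deriv \<phi> = \<psi>"
      using der by (auto intro!: DERIV_imp_deriv simp: has_real_derivative_iff_has_vector_derivative)
    have "\<phi> s = 0" if "s \<notin> {c..d}" for s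
    proof (cases "s < c")
      case True then show ?thesis by (simp add: \<phi>_def)
    next
      case False
      then have "s > d" using that by auto
      then have "integral {c..d} \<psi> + integral {d..s} \<psi> = integral {c..s} \<psi>"
        using cd by (intro Henstock_Kurzweil_Integration.integral_combine cint \<psi>) auto
      moreover have "integral {d..s} \<psi> = integral {d..s} (\<lambda>_. 0)"
        using \<psi>0 by (intro integral_spike[of "{d}"]) auto
      ultimately show ?thesis using int0 by (simp add: \<phi>_def)
    qed
    then have "\<phi> \<in> test_functions a b"
      unfolding test_functions_def C1_differentiable_on_def using der \<psi> cd
      by (intro CollectI conjI exI[of _ \<psi>] exI[of _ "{c..d}"]) auto
    from zero[OF this] have "integral {a..b} (\<lambda>s. \<psi> s * z s) = 0" by (simp add: d\<phi>)
    moreover have "integral {a..b} (\<lambda>s. \<psi> s * z s) = integral {c..d} (\<lambda>s. \<psi> s * zc s)"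
    proof -
      have "\<psi> s * z s = \<psi> s * zc s" for s
        using \<psi>0[of s] zc_eq[of s] by (cases "s \<in> {c..d}") auto
      then have eq: "(\<lambda>s. \<psi> s * z s) = (\<lambda>s. \<psi> s * zc s)" by (rule ext)
      show ?thesis unfolding eq
      proof (rule integral_outside_zero)
        show "(\<lambda>s. \<psi> s * zc s) absolutely_integrable_on {c..d}"
          by (intro absolutely_integrable_continuous_real continuous_intros
              continuous_on_subset[OF \<psi>] continuous_on_subset[OF zc]) auto
      qed (use cd \<psi>0 in auto)
    qed
    ultimately have z1: "integral {c..d} (\<lambda>s. \<psi> s * zc s) = 0" by simp
    have "integral {c..d} (\<lambda>s. \<eta> s * (zc s - k)^2) = integral {c..d} (\<lambda>s. \<psi> s * zc s - k * \<psi> s)"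
      by (simp add: \<psi>_def algebra_simps power2_eq_square)
    also have "\<dots> = 0"
      using z1 int0 by (subst Henstock_Kurzweil_Integration.integral_diff) (auto intro!: cint continuous_intros \<psi> zc)
    finally have "\<forall>s\<in>{c..d}. \<eta> s * (zc s - k)^2 = 0"
      using \<eta>0 cd by (subst (asm) integral_eq_0_iff)
        (auto intro!: continuous_intros continuous_on_subset[OF \<eta>] continuous_on_subset[OF zc])
    note zero_sq = this
    have "zc s = k" if "s \<in> {c<..<d}" for s
    proof -
      have "\<eta> s * (zc s - k)^2 = 0" using zero_sq that by simp
      then show ?thesis using \<eta>pos[OF that] by simp
    qed
    then show ?thesis using zc_eq by (intro exI[of _ k]) auto
  qed
  have eq: "z s = z s'" if "s \<in> {a<..<b}" "s' \<in> {a<..<b}" for s s'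
  proof -
    define c d where "c = (a + min s s') / 2" and "d = (b + max s s') / 2"
    have "a < c" "c < d" "d < b" "s \<in> {c<..<d}" "s' \<in> {c<..<d}"
      using that by (auto simp: c_def d_def min_def max_def field_simps split: if_splits)
    then show ?thesis using inner[of c d] by metis
  qed
  define k where "k = z ((a + b) / 2)"
  have "z s = k" if "s \<in> {a<..<b}" for s
    unfolding k_def using that \<open>a < b\<close> by (intro eq) auto
  moreover have "closure {a<..<b} = {a..b}" using \<open>a < b\<close> by simp
  ultimately have "z r = k" if "r \<in> {a..b}" for r
    using continuous_constant_on_closure[of "{a<..<b}" z k r] z that by auto
  then show ?thesis using \<open>s \<in> {a..b}\<close> \<open>a < b\<close> by auto
qed

text \<open>The primitive of v has the same weak derivative as y, so each component of the
  difference is orthogonal to the derivatives of all test functions and is constant by du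
  Bois-Reymond. This turns Sobolev trajectories into absolutely continuous ones.\<close>

lemma weak_ftc:
  fixes y :: "real \<Rightarrow> 'b::euclidean_space"
  assumes "a < b" and y: "continuous_on {a..b} y" and v: "v absolutely_integrable_on {a..b}"
    and weak: "has_weak_deriv a b y v" and "s \<in> {a..b}"
  shows "y s = y a + integral {a..s} v"
proof -
  define V where "V = (\<lambda>s. integral {a..s} v)"
  have V: "has_weak_deriv a b V v"
    by (rule has_weak_deriv_indefinite_integral[OF v \<open>a < b\<close>, where k=0]) (simp add: V_def)
  have contV: "continuous_on {a..b} V"
    unfolding V_def by (intro indefinite_integral_continuous_1 absint_imp_int v)
  have "(y s - V s) \<bullet> e = (y a - V a) \<bullet> e" for e
  proof (rule du_bois_reymond[OF \<open>a < b\<close>, where z="\<lambda>s. (y s - V s) \<bullet> e"])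
    show "continuous_on {a..b} (\<lambda>s. (y s - V s) \<bullet> e)"
      by (intro continuous_intros y contV)
    fix \<phi> assume \<phi>: "\<phi> \<in> test_functions a b"
    obtain c d where cd: "a < c" "c \<le> d" "d < b" "\<forall>s. s \<notin> {c..d} \<longrightarrow> deriv \<phi> s = 0"
       "continuous_on UNIV (deriv \<phi>)"
      using test_functionsE[OF \<phi> \<open>a < b\<close>] by metis
    have ly: "locally_integrable a b y" and lV: "locally_integrable a b V"
      using weak V by (auto simp: has_weak_deriv_def)
    note t1 = test_product_integral[OF ly cd(1,3,5,4)]
    note t2 = test_product_integral[OF lV cd(1,3,5,4)]
    have "(LINT s|lebesgue_on {a<..<b}. deriv \<phi> s *\<^sub>R y s) = (LINT s|lebesgue_on {a<..<b}. deriv \<phi> s *\<^sub>R V s)"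
      using weak V \<phi> by (simp add: has_weak_deriv_def)
    then have "integral {c..d} (\<lambda>s. deriv \<phi> s *\<^sub>R y s - deriv \<phi> s *\<^sub>R V s) = 0"
      unfolding t1(2) t2(2)
      by (subst Henstock_Kurzweil_Integration.integral_diff) (auto intro: absint_imp_int t1(1) t2(1))
    moreover have *: "(\<lambda>s. deriv \<phi> s *\<^sub>R y s - deriv \<phi> s *\<^sub>R V s) absolutely_integrable_on {c..d}"
      by (intro set_integral_diff t1(1) t2(1))
    moreover have "integral {c..d} (\<lambda>s. deriv \<phi> s * ((y s - V s) \<bullet> e))
       = integral {c..d} (\<lambda>s. deriv \<phi> s *\<^sub>R y s - deriv \<phi> s *\<^sub>R V s) \<bullet> e"
      using integral_linear[OF absint_imp_int[OF *] bounded_linear_inner_left[of e]]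
      by (simp add: o_def algebra_simps inner_diff_left)
    ultimately have z: "integral {c..d} (\<lambda>s. deriv \<phi> s * ((y s - V s) \<bullet> e)) = 0" by simp
    have "integral {a..b} (\<lambda>s. deriv \<phi> s * ((y s - V s) \<bullet> e)) = integral {c..d} (\<lambda>s. deriv \<phi> s * ((y s - V s) \<bullet> e))"
    proof (rule integral_outside_zero)
      show "(\<lambda>s. deriv \<phi> s * ((y s - V s) \<bullet> e)) absolutely_integrable_on {c..d}"
        using cd by (intro absolutely_integrable_continuous_real continuous_intros
            continuous_on_subset[OF cd(5)] continuous_on_subset[OF y] continuous_on_subset[OF contV]) auto
    qed (use cd in auto)
    then show "integral {a..b} (\<lambda>s. deriv \<phi> s * ((y s - V s) \<bullet> e)) = 0" using z by simp
  next
    show "s \<in> {a..b}" by fact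
  qed
  then have "y s - V s = y a - V a" by (simp only: euclidean_eqI)
  then show ?thesis by (simp add: V_def algebra_simps)
qed

text \<open>On a compact subinterval the difference of the two weak derivatives is an integrable
  weak derivative of 0, so all its integrals vanish. As \<open>weak_deriv\<close> selects an
  arbitrary representative, this is what allows costs and norms to be computed with any other
  one.\<close>

lemma weak_deriv_unique:
  fixes y :: "real \<Rightarrow> 'b::euclidean_space"
  assumes v1: "has_weak_deriv a b y v1" and v2: "has_weak_deriv a b y v2" and "a < b"
  shows "\<exists>N. negligible N \<and> (\<forall>s\<in>{a<..<b} - N. v1 s = v2 s)"
proof -
  have inner: "\<exists>N. negligible N \<and> (\<forall>s\<in>{c..d} - N. v1 s = v2 s)" if cd: "a < c" "c < d" "d < b" for c d
  proof -
    have "compact {c..d}" "{c..d} \<subseteq> {a<..<b}" using cd by auto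
    then have "integrable (lebesgue_on {c..d}) v1" "integrable (lebesgue_on {c..d}) v2"
      using v1 v2 unfolding has_weak_deriv_def locally_integrable_def by blast+
    then have ai: "v1 absolutely_integrable_on {c..d}" "v2 absolutely_integrable_on {c..d}"
      by (simp_all add: integrable_lebesgue_on_iff)
    define w where "w = (\<lambda>s. v1 s - v2 s)"
    have w: "w absolutely_integrable_on {c..d}" unfolding w_def by (intro set_integral_diff ai)
    have lv: "locally_integrable a b v1" "locally_integrable a b v2"
      using v1 v2 by (auto simp: has_weak_deriv_def)
    have "has_weak_deriv c d (\<lambda>_. 0) w"
      unfolding has_weak_deriv_def
    proof (intro conjI ballI)
      show "locally_integrable c d (\<lambda>_. 0 :: 'b)" by (simp add: locally_integrable_def)
      show lw: "locally_integrable c d w" by (rule absint_imp_locally_integrable[OF w])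
      fix \<phi> assume \<phi>: "\<phi> \<in> test_functions c d"
      have \<phi>': "\<phi> \<in> test_functions a b"
      proof -
        obtain K where "\<phi> C1_differentiable_on UNIV" "compact K" "K \<subseteq> {c<..<d}" "\<forall>s. s \<notin> K \<longrightarrow> \<phi> s = 0"
          using \<phi> by (auto simp: test_functions_def)
        moreover have "{c<..<d} \<subseteq> {a<..<b}" using cd by auto
        ultimately show ?thesis unfolding test_functions_def by blast
      qed
      obtain c' d' where cd': "c < c'" "c' \<le> d'" "d' < d" "\<forall>s. s \<notin> {c'..d'} \<longrightarrow> \<phi> s = 0"
         "continuous_on UNIV \<phi>"
        using test_functionsE[OF \<phi> cd(2)] by metis
      have cd'': "a < c'" "d' < b" using cd cd' by auto
      note t0 = test_product_integral[OF lw cd'(1,3,5,4)]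
      note t1 = test_product_integral[OF lv(1) cd'' cd'(5,4)]
      note t2 = test_product_integral[OF lv(2) cd'' cd'(5,4)]
      have "(LINT s|lebesgue_on {a<..<b}. \<phi> s *\<^sub>R v1 s) = (LINT s|lebesgue_on {a<..<b}. \<phi> s *\<^sub>R v2 s)"
        using v1 v2 \<phi>' by (simp add: has_weak_deriv_def)
      then have "integral {c'..d'} (\<lambda>s. \<phi> s *\<^sub>R v1 s - \<phi> s *\<^sub>R v2 s) = 0"
        unfolding t1(2) t2(2)
        by (subst Henstock_Kurzweil_Integration.integral_diff) (auto intro: absint_imp_int t1(1) t2(1))
      then show "(LINT s|lebesgue_on {c<..<d}. deriv \<phi> s *\<^sub>R (0::'b)) = - (LINT s|lebesgue_on {c<..<d}. \<phi> s *\<^sub>R w s)"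
        unfolding t0(2) by (simp add: w_def algebra_simps)
    qed
    from weak_ftc[OF cd(2) _ w this] have z: "integral {c..s} w = 0" if "s \<in> {c..d}" for s
      using that by simp
    have "integral {r..s} w = 0" if "c \<le> r" "r \<le> s" "s \<le> d" for r s
      using integral_diff_subinterval[OF absint_imp_int[OF w] that] z[of r] z[of s] that by simp
    from negligible_support_if_integrals_zero[OF w this] show ?thesis by (simp add: w_def)
  qed
  \<comment> \<open>Weak derivatives are integrable only on compact subsets, so the open interval is
    exhausted by compact ones. The summand 3 gives c n < d n already for n = 0.\<close>
  define c where "c = (\<lambda>n::nat. a + (b - a) / (real n + 3))"
  define d where "d = (\<lambda>n::nat. b - (b - a) / (real n + 3))"
  have cd: "a < c n" "c n < d n" "d n < b" for n
  proof -
    define e where "e = (b - a) / (real n + 3)"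
    have "(real n + 3) * e = b - a" by (simp add: e_def)
    moreover have "e > 0" using \<open>a < b\<close> by (simp add: e_def)
    moreover have "real n * e \<ge> 0" using \<open>e > 0\<close> by simp
    ultimately have "e > 0" "3 * e \<le> b - a" by (auto simp: algebra_simps)
    then show "a < c n" "c n < d n" "d n < b" by (auto simp: c_def d_def e_def[symmetric])
  qed
  have "\<forall>n. \<exists>N. negligible N \<and> (\<forall>s\<in>{c n..d n} - N. v1 s = v2 s)"
    using inner[OF cd] by blast
  then obtain N where N: "\<And>n. negligible (N n)" "\<And>n. \<forall>s\<in>{c n..d n} - N n. v1 s = v2 s"
    by (subst (asm) choice_iff) blast
  have "negligible (\<Union>n. N n)" using N(1) by (rule negligible_Union_nat)
  moreover have "v1 s = v2 s" if s: "s \<in> {a<..<b} - (\<Union>n. N n)" for s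
  proof -
    define e where "e = min (s - a) (b - s)"
    have "e > 0" using s by (auto simp: e_def)
    obtain n :: nat where n: "real n > (b - a) / e" using reals_Archimedean2 by blast
    have "(b - a) / (real n + 3) < e" using n \<open>e > 0\<close> \<open>a < b\<close> by (simp add: field_simps)
    then have "s \<in> {c n..d n}" by (auto simp: e_def c_def d_def min_def split: if_splits)
    then show ?thesis using N(2)[of n] s by blast
  qed
  ultimately show ?thesis by blast
qed

lemma norm_le_one_plus_powr:
  fixes r :: real assumes "r \<ge> 0" "p > 1" shows "r \<le> 1 + r powr p"
proof (cases "r \<le> 1")
  case False
  then have "r powr 1 \<le> r powr p" using assms by (intro powr_mono) auto
  then show ?thesis using False by simp
qed (simp add: add_increasing2)

text \<open>On a bounded interval p-integrability implies integrability, since r is at most 1 + r^p;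
  the endpoints form a null set.\<close>

lemma in_Lp_iff:
  fixes v :: "real \<Rightarrow> 'b::euclidean_space"
  assumes "p > 1"
  shows "in_Lp p a b v \<longleftrightarrow> v absolutely_integrable_on {a..b} \<and> (\<lambda>s. norm (v s) powr p) absolutely_integrable_on {a..b}"
proof -
  have "in_Lp p a b v \<longleftrightarrow> v absolutely_integrable_on {a<..<b} \<and> (\<lambda>s. norm (v s) powr p) absolutely_integrable_on {a<..<b}"
  proof
    assume *: "in_Lp p a b v"
    then have P: "(\<lambda>s. norm (v s) powr p) absolutely_integrable_on {a<..<b}" and m: "v \<in> borel_measurable (lebesgue_on {a<..<b})"
      by (auto simp: in_Lp_def integrable_lebesgue_on_iff)
    have "v absolutely_integrable_on {a<..<b}"
    proof (rule measurable_bounded_by_integrable_imp_absolutely_integrable[OF m])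
      have "(\<lambda>s. 1::real) absolutely_integrable_on {a<..<b}"
        unfolding absolutely_integrable_on_Icc_iff_Ioo[symmetric] by (intro absolutely_integrable_continuous_real continuous_intros)
      then show "(\<lambda>s. 1 + norm (v s) powr p) integrable_on {a<..<b}"
        by (intro integrable_add absint_imp_int P)
      show "norm (v s) \<le> 1 + norm (v s) powr p" for s
        using assms by (intro norm_le_one_plus_powr) auto
    qed simp
    with P show "v absolutely_integrable_on {a<..<b} \<and> (\<lambda>s. norm (v s) powr p) absolutely_integrable_on {a<..<b}" by simp
  next
    assume *: "v absolutely_integrable_on {a<..<b} \<and> (\<lambda>s. norm (v s) powr p) absolutely_integrable_on {a<..<b}"
    then show "in_Lp p a b v"
      by (auto simp: in_Lp_def integrable_lebesgue_on_iff intro: absolutely_integrable_imp_borel_measurable)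
  qed
  then show ?thesis by (simp add: absolutely_integrable_on_Icc_iff_Ioo)
qed

section \<open>Absolutely continuous trajectories on the junction\<close>

text \<open>The velocity is carried along as an explicit witness, and values outside [a, b] are
  free. Such pairs can be restricted, glued and altered on null sets, which is awkward for members
  of \<open>trajs\<close>.\<close>

definition ac_path :: "real \<Rightarrow> real \<Rightarrow> real \<Rightarrow> (real \<Rightarrow> real^'n::finite) \<Rightarrow> (real \<Rightarrow> real^'n) \<Rightarrow> bool" where
  "ac_path p a b y v \<longleftrightarrow> v absolutely_integrable_on {a..b} \<and>
     (\<lambda>s. norm (v s) powr p) absolutely_integrable_on {a..b} \<and>
     (\<forall>s\<in>{a..b}. y s = y a + integral {a..s} v \<and> y s \<in> junction)"

lemma ac_path_eq: "ac_path p a b y v \<Longrightarrow> s \<in> {a..b} \<Longrightarrow> y s = y a + integral {a..s} v"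
  unfolding ac_path_def by blast

lemma ac_path_in_junction: "ac_path p a b y v \<Longrightarrow> s \<in> {a..b} \<Longrightarrow> y s \<in> junction"
  unfolding ac_path_def by blast

lemma ac_path_absint:
  "ac_path p a b y v \<Longrightarrow> v absolutely_integrable_on {a..b}"
  "ac_path p a b y v \<Longrightarrow> (\<lambda>s. norm (v s) powr p) absolutely_integrable_on {a..b}"
  unfolding ac_path_def by blast+

lemma ac_pathI:
  assumes "v absolutely_integrable_on {a..b}" "(\<lambda>s. norm (v s) powr p) absolutely_integrable_on {a..b}"
    "\<And>s. s \<in> {a..b} \<Longrightarrow> y s = y a + integral {a..s} v" "\<And>s. s \<in> {a..b} \<Longrightarrow> y s \<in> junction"
  shows "ac_path p a b y v"
  unfolding ac_path_def using assms by blast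

lemma ac_path_continuous: "ac_path p a b y v \<Longrightarrow> continuous_on {a..b} y"
proof -
  assume *: "ac_path p a b y v"
  have "continuous_on {a..b} (\<lambda>s. y a + integral {a..s} v)"
    using * by (intro continuous_intros indefinite_integral_continuous_1 absint_imp_int ac_path_absint)
  then show ?thesis
    by (rule continuous_on_eq) (rule ac_path_eq[OF *, symmetric])
qed

lemma trajs_iff_ac_path:
  assumes "t < T" "p > 1"
  shows "y \<in> trajs p T t x \<longleftrightarrow> y \<in> extensional {t..T} \<and> y t = x \<and> (\<exists>v. ac_path p t T y v)"
proof
  assume y: "y \<in> trajs p T t x"
  then obtain v where weak: "has_weak_deriv t T y v" and "in_Lp p t T v"
    by (auto simp: trajs_def in_W1p_def)
  then have v: "v absolutely_integrable_on {t..T}" "(\<lambda>s. norm (v s) powr p) absolutely_integrable_on {t..T}"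
    using assms by (auto simp: in_Lp_iff)
  have "continuous_on {t..T} y" using y by (simp add: trajs_def)
  from weak_ftc[OF \<open>t < T\<close> this v(1) weak]
  have "ac_path p t T y v"
    using y by (intro ac_pathI v) (auto simp only: trajs_def)
  then show "y \<in> extensional {t..T} \<and> y t = x \<and> (\<exists>v. ac_path p t T y v)"
    using y by (auto simp: trajs_def)
next
  assume "y \<in> extensional {t..T} \<and> y t = x \<and> (\<exists>v. ac_path p t T y v)"
  then obtain v where y: "y \<in> extensional {t..T}" "y t = x" and v: "ac_path p t T y v" by blast
  have cont: "continuous_on {t..T} y" using v by (rule ac_path_continuous)
  have "in_Lp p t T y"
    unfolding in_Lp_iff[OF \<open>p > 1\<close>] using assms
    by (intro conjI absolutely_integrable_continuous_real cont continuous_on_powr' continuous_intros) auto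
  moreover have "in_Lp p t T v" using v assms by (simp add: in_Lp_iff ac_path_absint)
  moreover have "has_weak_deriv t T y v"
    using assms by (intro has_weak_deriv_indefinite_integral[where k="y t"] ac_path_absint[OF v] ac_path_eq[OF v])
  moreover have "y ` {t..T} \<subseteq> junction" using ac_path_in_junction[OF v] by blast
  ultimately show "y \<in> trajs p T t x"
    using y cont unfolding trajs_def in_W1p_def by blast
qed

lemma junctionE:
  assumes "x \<in> junction" obtains i r where "x = r *\<^sub>R axis i 1" "r \<ge> 0"
  using assms by (auto simp: junction_def edge_def)

text \<open>At most one coordinate is nonzero, and it is nonnegative. So the norm is the restriction
  of a linear form to the junction, and along a trajectory it is absolutely continuous even through
  the vertex, with no chain rule for the norm.\<close>

lemma junction_norm: "x \<in> junction \<Longrightarrow> norm x = (\<Sum>i\<in>UNIV. x $ i)"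
proof (elim junctionE)
  fix i r assume x: "x = r *\<^sub>R axis i 1" "r \<ge> 0"
  have "(\<Sum>j\<in>UNIV. x $ j) = (\<Sum>j\<in>UNIV. if j = i then r else 0)"
    using x by (intro sum.cong) (auto simp: axis_def)
  then show ?thesis using x by (simp add: norm_axis_1)
qed

lemma edge_eq_norm: "x \<in> edge i \<Longrightarrow> x = norm x *\<^sub>R axis i 1"
  by (auto simp: edge_def norm_axis_1)

lemma ac_path_weak_deriv:
  assumes "ac_path p t T y v" "t < T"
  shows "\<exists>N. negligible N \<and> (\<forall>s\<in>{t<..<T} - N. weak_deriv t T y s = v s)"
proof -
  have v: "has_weak_deriv t T y v"
    using assms(2) by (intro has_weak_deriv_indefinite_integral[where k="y t"] ac_path_absint[OF assms(1)] ac_path_eq[OF assms(1)])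
  then have "has_weak_deriv t T y (weak_deriv t T y)"
    unfolding weak_deriv_def by (rule someI[where P="has_weak_deriv t T y"])
  from weak_deriv_unique[OF this v \<open>t < T\<close>] show ?thesis .
qed

text \<open>The linear form that restricts to the norm on the junction, applied to the velocity. It
  is the signed radial velocity, the derivative of |y|, and may be negative.\<close>

definition speed :: "(real \<Rightarrow> real^'n::finite) \<Rightarrow> real \<Rightarrow> real" where
  "speed v s = (\<Sum>i\<in>UNIV. v s $ i)"

lemma bounded_linear_sum_components: "bounded_linear (\<lambda>x::real^'n::finite. \<Sum>i\<in>UNIV. x $ i)"
  by (intro bounded_linear_sum bounded_linear_vec_nth)

lemma speed_absint:
  assumes "v absolutely_integrable_on S"
  shows "speed v absolutely_integrable_on S"
  using absolutely_integrable_linear[OF assms bounded_linear_sum_components]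
  by (simp add: o_def speed_def[abs_def])

lemma speed_le: "\<bar>speed (v :: real \<Rightarrow> real^'n::finite) s\<bar> \<le> real CARD('n) * norm (v s)"
proof -
  have "\<bar>speed v s\<bar> \<le> (\<Sum>i\<in>(UNIV::'n set). \<bar>v s $ i\<bar>)" unfolding speed_def by (rule sum_abs)
  also have "\<dots> \<le> (\<Sum>i\<in>(UNIV::'n set). norm (v s))" by (intro sum_mono component_le_norm_cart)
  finally show ?thesis by simp
qed

lemma ac_path_norm:
  assumes "ac_path p a b y v" "s \<in> {a..b}"
  shows "norm (y s) = norm (y a) + integral {a..s} (speed v)"
proof -
  have v: "v integrable_on {a..s}"
    using assms(2) by (intro absint_imp_int absint_sub[OF ac_path_absint(1)[OF assms(1)]]) auto
  have "norm (y s) = (\<Sum>i\<in>UNIV. y s $ i)"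
    using assms by (intro junction_norm ac_path_in_junction)
  also have "\<dots> = (\<Sum>i\<in>UNIV. (y a + integral {a..s} v) $ i)"
    unfolding ac_path_eq[OF assms] ..
  also have "\<dots> = (\<Sum>i\<in>UNIV. y a $ i) + (\<Sum>i\<in>UNIV. integral {a..s} v $ i)"
    by (simp add: sum.distrib)
  also have "(\<Sum>i\<in>UNIV. integral {a..s} v $ i) = integral {a..s} (speed v)"
    using integral_linear[OF v bounded_linear_sum_components] by (simp add: o_def speed_def[abs_def])
  also have "(\<Sum>i\<in>UNIV. y a $ i) = norm (y a)"
    using assms by (intro junction_norm[symmetric] ac_path_in_junction[OF assms(1)]) auto
  finally show ?thesis .
qed

lemma ac_path_weak_deriv_norm:
  assumes v: "ac_path p t T y v" and "t < T"
  shows "\<exists>N. negligible N \<and> (\<forall>s\<in>{t<..<T} - N. weak_deriv t T (\<lambda>s. norm (y s)) s = speed v s)"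
proof -
  have v: "has_weak_deriv t T (\<lambda>s. norm (y s)) (speed v)"
    using assms(2) by (intro has_weak_deriv_indefinite_integral[where k="norm (y t)"] ac_path_norm[OF assms(1)]
        speed_absint ac_path_absint[OF assms(1)])
  then have "has_weak_deriv t T (\<lambda>s. norm (y s)) (weak_deriv t T (\<lambda>s. norm (y s)))"
    unfolding weak_deriv_def by (rule someI[where P="has_weak_deriv t T (\<lambda>s. norm (y s))"])
  from weak_deriv_unique[OF this v \<open>t < T\<close>] show ?thesis .
qed

lemma ac_path_sub:
  assumes y: "ac_path p a b y v" and "a \<le> c" "c \<le> d" "d \<le> b"
  shows "ac_path p c d y v"
proof (rule ac_pathI)
  note v = ac_path_absint[OF y]
  show "v absolutely_integrable_on {c..d}" "(\<lambda>s. norm (v s) powr p) absolutely_integrable_on {c..d}"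
    using assms by (auto intro: absint_sub[OF v(1)] absint_sub[OF v(2)])
  fix s assume s: "s \<in> {c..d}"
  have "y s = y a + integral {a..s} v" "y c = y a + integral {a..c} v"
    using assms s by (auto intro!: ac_path_eq[OF y])
  moreover have "integral {a..s} v - integral {a..c} v = integral {c..s} v"
    using assms s by (intro integral_diff_subinterval[OF absint_imp_int[OF v(1)]]) auto
  ultimately show "y s = y c + integral {c..s} v" by (simp add: algebra_simps)
  show "y s \<in> junction" using assms s by (intro ac_path_in_junction[OF y]) auto
qed

lemma ac_path_cong:
  assumes y: "ac_path p a b y v" and "a \<le> b" and y': "\<And>s. s \<in> {a..b} \<Longrightarrow> y' s = y s"
    and N: "negligible N" and v': "\<And>s. s \<in> {a..b} - N \<Longrightarrow> v' s = v s"
  shows "ac_path p a b y' v'"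
proof (rule ac_pathI)
  show "v' absolutely_integrable_on {a..b}"
    using ac_path_absint(1)[OF y] v' by (rule absolutely_integrable_spike[OF _ N])
  show "(\<lambda>s. norm (v' s) powr p) absolutely_integrable_on {a..b}"
    using ac_path_absint(2)[OF y] by (rule absolutely_integrable_spike[OF _ N]) (simp add: v')
  fix s assume s: "s \<in> {a..b}"
  have "integral {a..s} v' = integral {a..s} v"
    using s v' by (intro integral_spike[OF N]) auto
  then show "y' s = y' a + integral {a..s} v'"
    using ac_path_eq[OF y s] y'[OF s] y'[of a] \<open>a \<le> b\<close> by simp
  show "y' s \<in> junction" using ac_path_in_junction[OF y s] y'[OF s] by simp
qed

lemma ac_path_join:
  assumes L: "ac_path p a b y v" and R: "ac_path p b c z w" and "y b = z b" "a \<le> b" "b \<le> c"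
  shows "ac_path p a c (\<lambda>s. if s \<le> b then y s else z s) (\<lambda>s. if s \<le> b then v s else w s)"
    (is "ac_path p a c ?y ?v")
proof -
  have L': "ac_path p a b ?y ?v"
    by (rule ac_path_cong[OF L \<open>a \<le> b\<close>, where N="{}"]) auto
  have R': "ac_path p b c ?y ?v"
    by (rule ac_path_cong[OF R \<open>b \<le> c\<close>, where N="{b}"]) (use \<open>y b = z b\<close> in auto)
  show ?thesis
  proof (rule ac_pathI)
    show v: "?v absolutely_integrable_on {a..c}"
      by (rule absolutely_integrable_on_combine[OF ac_path_absint(1)[OF L'] ac_path_absint(1)[OF R']]) fact+
    show "(\<lambda>s. norm (?v s) powr p) absolutely_integrable_on {a..c}"
      by (rule absolutely_integrable_on_combine[OF ac_path_absint(2)[OF L'] ac_path_absint(2)[OF R']]) fact+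
    fix s assume s: "s \<in> {a..c}"
    show "?y s \<in> junction"
      using s ac_path_in_junction[OF L, of s] ac_path_in_junction[OF R, of s] by auto
    show "?y s = ?y a + integral {a..s} ?v"
    proof (cases "s \<le> b")
      case True
      then show ?thesis using ac_path_eq[OF L', of s] s by simp
    next
      case False
      then have "?y s = ?y b + integral {b..s} ?v"
        using ac_path_eq[OF R', of s] s by simp
      moreover have "?y b = ?y a + integral {a..b} ?v"
        using ac_path_eq[OF L', of b] \<open>a \<le> b\<close> by simp
      moreover have "integral {a..s} ?v - integral {a..b} ?v = integral {b..s} ?v"
        using s False \<open>a \<le> b\<close> by (intro integral_diff_subinterval[OF absint_imp_int[OF v]]) auto
      ultimately show ?thesis by (simp only: algebra_simps)
    qed
  qed
qed

lemma edge_line: "r \<ge> 0 \<Longrightarrow> r *\<^sub>R axis i 1 \<in> junction"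
  by (auto simp: junction_def edge_def)

lemma ac_path_line:
  fixes i :: "'n::finite"
  assumes "a \<le> b" "r \<ge> 0" "r + c * (b - a) \<ge> 0"
  shows "ac_path p a b (\<lambda>s. (r + c * (s - a)) *\<^sub>R axis i 1 :: real^'n) (\<lambda>_. c *\<^sub>R axis i 1)"
proof -
  have "(r + c * (s - a)) *\<^sub>R (axis i 1 :: real^'n) \<in> junction" if "s \<in> {a..b}" for s
  proof (rule edge_line)
    show "0 \<le> r + c * (s - a)"
    proof (cases "c \<ge> 0")
      case False
      then have "c * (b - a) \<le> c * (s - a)" using that by (intro mult_left_mono_neg) auto
      then show ?thesis using assms by linarith
    qed (use assms that in auto)
  qed
  moreover have "(\<lambda>s::real. k) absolutely_integrable_on {a..b}" for k :: "'c::euclidean_space"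
    by (intro absolutely_integrable_continuous_real continuous_intros)
  ultimately show ?thesis
    by (intro ac_pathI) (auto simp: algebra_simps)
qed

section \<open>Costs along trajectories\<close>

text \<open>A change of s is controlled by uniform convergence on a compact neighbourhood of z, a
  change of z by continuity for fixed s. It serves to read the locally uniform continuity of the
  costs in the measure as joint continuity in time, position and velocity.\<close>

lemma jointly_continuous_on:
  fixes g :: "'s::metric_space \<Rightarrow> 'z::euclidean_space \<Rightarrow> real"
  assumes "closed B" and cont: "\<And>s. s \<in> A \<Longrightarrow> continuous_on B (g s)"
    and unif: "\<And>s K. s \<in> A \<Longrightarrow> compact K \<Longrightarrow> K \<subseteq> B \<Longrightarrow> uniform_limit K g (g s) (at s within A)"
  shows "continuous_on (A \<times> B) (\<lambda>q. g (fst q) (snd q))"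
  unfolding continuous_on_iff
proof (intro ballI allI impI)
  fix q and e :: real assume q: "q \<in> A \<times> B" and "e > 0"
  obtain s z where sz: "q = (s, z)" "s \<in> A" "z \<in> B" using q by auto
  define K where "K = cball z 1 \<inter> B"
  have K: "compact K" "K \<subseteq> B"
    unfolding K_def using \<open>closed B\<close> by (auto intro: compact_Int_closed)
  have "\<forall>\<^sub>F s' in at s within A. \<forall>z'\<in>K. dist (g s' z') (g s z') < e / 2"
    using unif[OF sz(2) K, unfolded uniform_limit_iff, rule_format, of "e / 2"] \<open>e > 0\<close> by simp
  then obtain d1 where "d1 > 0" and d1: "\<And>s' z'. s' \<in> A \<Longrightarrow> s' \<noteq> s \<Longrightarrow> dist s' s < d1 \<Longrightarrow> z' \<in> K \<Longrightarrow> dist (g s' z') (g s z') < e / 2"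
    unfolding eventually_at by blast
  obtain d2 where "d2 > 0" and d2: "\<And>z'. z' \<in> B \<Longrightarrow> dist z' z < d2 \<Longrightarrow> dist (g s z') (g s z) < e / 2"
    using cont[OF sz(2)] sz(3) \<open>e > 0\<close> unfolding continuous_on_iff by (meson half_gt_zero)
  show "\<exists>d>0. \<forall>q'\<in>A \<times> B. dist q' q < d \<longrightarrow> dist (g (fst q') (snd q')) (g (fst q) (snd q)) < e"
  proof (intro exI[of _ "min (min d1 d2) 1"] conjI ballI impI)
    show "min (min d1 d2) 1 > 0" using \<open>d1 > 0\<close> \<open>d2 > 0\<close> by simp
    fix q' assume q': "q' \<in> A \<times> B" and dist: "dist q' q < min (min d1 d2) 1"
    obtain s' z' where sz': "q' = (s', z')" "s' \<in> A" "z' \<in> B" using q' by auto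
    have "dist s' s \<le> dist q' q" "dist z' z \<le> dist q' q"
      using dist_fst_le[of q' q] dist_snd_le[of q' q] sz sz' by auto
    then have near: "dist s' s < d1" "dist z' z < d2" "dist z' z \<le> 1" using dist by auto
    then have "z' \<in> K" using sz' by (simp add: K_def dist_commute)
    have "dist (g s' z') (g s z') < e / 2"
      using d1[OF sz'(2) _ near(1) \<open>z' \<in> K\<close>] \<open>e > 0\<close> by (cases "s' = s") auto
    moreover have "dist (g s z') (g s z) < e / 2" using d2 sz' near by simp
    ultimately have "dist (g s' z') (g s z) < e" using dist_triangle[of "g s' z'" "g s z" "g s z'"] by simp
    then show "dist (g (fst q') (snd q')) (g (fst q) (snd q)) < e" using sz sz' by simp
  qed
qed

lemma convex_deriv_above_tangent:
  fixes f :: "real \<Rightarrow> real"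
  assumes f: "strictly_convex f" and d: "(f has_real_derivative D) (at a)"
  shows "f b \<ge> f a + D * (b - a)"
proof (cases "a = b")
  case False
  have "((\<lambda>s. (f (a + s * (b - a)) - f a) / s) \<longlongrightarrow> D * (b - a)) (at_right 0)"
  proof -
    have "((\<lambda>s. f (a + s * (b - a))) has_real_derivative D * (b - a)) (at 0)"
      by (rule DERIV_cong[OF DERIV_chain2[where g="\<lambda>s. a + s * (b - a)"]]) (use d in \<open>auto intro!: derivative_eq_intros\<close>)
    then have "((\<lambda>s. (f (a + s * (b - a)) - f a) / s) \<longlongrightarrow> D * (b - a)) (at 0)"
      unfolding has_field_derivative_iff by simp
    then show ?thesis by (rule filterlim_mono) (auto intro: at_le)
  qed
  moreover have "\<forall>\<^sub>F s in at_right 0. (f (a + s * (b - a)) - f a) / s \<le> f b - f a"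
  proof -
    have "(f (a + s * (b - a)) - f a) / s \<le> f b - f a" if s: "0 < s" "s < 1" for s
    proof -
      have "f ((1 - s) * a + s * b) < (1 - s) * f a + s * f b"
        using f False s unfolding strictly_convex_def by blast
      moreover have "(1 - s) * a + s * b = a + s * (b - a)" by (simp add: algebra_simps)
      ultimately show ?thesis using s by (simp add: field_simps)
    qed
    moreover have "\<forall>\<^sub>F s in at_right (0::real). s < 1" "\<forall>\<^sub>F s in at_right (0::real). 0 < s"
      by (auto simp: eventually_at_right_less intro: eventually_at_right_real[of 0 1, THEN eventually_mono])
    ultimately show ?thesis by (auto elim: eventually_elim2)
  qed
  ultimately have "D * (b - a) \<le> f b - f a"
    by (intro tendsto_upperbound) auto
  then show ?thesis by simp
qed simp

text \<open>At the midpoint both tangents lie below the graph and the graph lies strictly below the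
  chord; adding the two tangent inequalities compares the slopes.\<close>

lemma strictly_convex_deriv_less:
  fixes f :: "real \<Rightarrow> real"
  assumes f: "strictly_convex f" and a: "(f has_real_derivative A) (at a)" and b: "(f has_real_derivative B) (at b)" and "a < b"
  shows "A < B"
proof -
  have "f ((1 - 1/2) * a + 1/2 * b) < (1 - 1/2) * f a + 1/2 * f b"
    using f[unfolded strictly_convex_def, rule_format, of a b "1/2"] \<open>a < b\<close> by simp
  then have mid: "2 * f ((a + b) / 2) < f a + f b" by (simp add: field_simps)
  have "f ((a + b) / 2) \<ge> f a + A * ((a + b) / 2 - a)" by (rule convex_deriv_above_tangent[OF f a])
  moreover have "f ((a + b) / 2) \<ge> f b + B * ((a + b) / 2 - b)" by (rule convex_deriv_above_tangent[OF f b])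
  ultimately have "A * ((b - a) / 2) < B * ((b - a) / 2)" using mid by (simp add: field_simps)
  then show ?thesis using \<open>a < b\<close> by (simp add: mult_less_cancel_right)
qed

lemma running_cost_edge:
  assumes "r > 0" shows "running_cost L Ls m (r *\<^sub>R axis i 1) a = L i m r a"
proof -
  have "r *\<^sub>R axis i 1 \<in> edge j - {0} \<longleftrightarrow> j = i" for j
  proof
    assume "r *\<^sub>R axis i (1::real) \<in> edge j - {0}"
    then obtain q where q: "r *\<^sub>R axis i (1::real) = q *\<^sub>R axis j 1" by (auto simp: edge_def)
    then have "(r *\<^sub>R axis i (1::real)) $ i = (q *\<^sub>R axis j 1) $ i" by simp
    then show "j = i" using assms by (auto simp: axis_def split: if_splits)
  next
    assume "j = i" then show "r *\<^sub>R axis i (1::real) \<in> edge j - {0}"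
      using assms by (auto simp: edge_def axis_eq_0_iff intro: exI[of _ r])
  qed
  note mem = this
  have "indicat_real (edge j - {0}) (r *\<^sub>R axis i 1) = (if j = i then 1 else 0)" for j
    using mem[of j] by (cases "j = i") (simp_all only: indicator_simps if_True if_False simp_thms)
  note ind = this
  have "(\<Sum>j\<in>UNIV. L j m r a * (if j = i then 1 else 0)) = (\<Sum>j\<in>UNIV. if j = i then L i m r a else 0)"
    by (intro sum.cong) auto
  then show ?thesis
    unfolding running_cost_def ind using assms by (simp add: norm_axis_1 axis_eq_0_iff)
qed

lemma running_cost_0: "running_cost L Ls m 0 a = min (Ls m) (MIN i. L i m 0 0)"
  by (simp add: running_cost_def)

lemma final_cost_edge:
  assumes "r > 0" shows "final_cost G Gs m (r *\<^sub>R axis i 1) = G i m r"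
  using running_cost_edge[OF assms, of "\<lambda>i m r a. G i m r" Gs m i 0] assms
  by (simp add: final_cost_def running_cost_def axis_eq_0_iff)

lemma final_cost_0: "final_cost G Gs m 0 = min (Gs m) (MIN i. G i m 0)"
  by (simp add: final_cost_def)

text \<open>The equilibrium is frozen here: the costs depend on time through a given continuous
  curve of measures, and what remains is an optimal control problem for a single agent.\<close>

locale mfg_costs =
  fixes T p :: real
    and L :: "'n::finite \<Rightarrow> (real^'n) measure \<Rightarrow> real \<Rightarrow> real \<Rightarrow> real"
    and Ls :: "(real^'n) measure \<Rightarrow> real"
    and G :: "'n \<Rightarrow> (real^'n) measure \<Rightarrow> real \<Rightarrow> real"
    and Gs :: "(real^'n) measure \<Rightarrow> real"
    and m :: "real \<Rightarrow> (real^'n) measure"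
  assumes T: "T > 0" and p: "p > 1"
    and costs: "costs L Ls G Gs" and coercive: "coercive p L Ls"
    and deriv_growth: "deriv_growth p L" and velocity_convex: "velocity_convex L"
    and m_P1: "\<And>s. s \<in> {0..T} \<Longrightarrow> m s \<in> P1"
    and m_cont: "\<And>s. s \<in> {0..T} \<Longrightarrow> filterlim m (P1_nhds (m s)) (at s within {0..T})"
begin

abbreviation Lx :: "'n \<Rightarrow> real \<Rightarrow> real \<Rightarrow> real \<Rightarrow> real" where
  "Lx i s \<equiv> dx (L i (m s))"

abbreviation La :: "'n \<Rightarrow> real \<Rightarrow> real \<Rightarrow> real \<Rightarrow> real" where
  "La i s \<equiv> da (L i (m s))"

lemma C1_L: "s \<in> {0..T} \<Longrightarrow> C1_halfplane (L i (m s))"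
  using costs m_P1 by (simp add: costs_def continuous_into_C1_def)

lemma L_jointly_continuous:
  assumes "\<And>s K. s \<in> {0..T} \<Longrightarrow> compact K \<Longrightarrow> K \<subseteq> {0..} \<times> UNIV \<Longrightarrow> uniform_limit K (\<lambda>m' (x :: real, a :: real). F m' x a :: real) (\<lambda>(x :: real, a :: real). F (m s) x a :: real) (P1_nhds (m s))"
    and "\<And>s. s \<in> {0..T} \<Longrightarrow> continuous_on ({0..} \<times> UNIV) (\<lambda>(x, a). F (m s) x a)"
  shows "continuous_on ({0..T} \<times> {0..} \<times> UNIV) (\<lambda>(s, x::real, a::real). F (m s) x a :: real)"
proof -
  have "continuous_on ({0..T} \<times> ({0..} \<times> UNIV)) (\<lambda>q. (\<lambda>s (x, a). F (m s) x a) (fst q) (snd q))"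
  proof (rule jointly_continuous_on)
    show "closed ({0..} \<times> (UNIV :: real set) :: (real \<times> real) set)" by (intro closed_Times) auto
    fix s and K :: "(real \<times> real) set" assume s: "s \<in> {0..T}" "compact K" "K \<subseteq> {0..} \<times> UNIV"
    show "uniform_limit K (\<lambda>s (x, a). F (m s) x a) (\<lambda>(x, a). F (m s) x a) (at s within {0..T})"
      using assms(1)[OF s] m_cont[OF s(1)] unfolding uniform_limit_iff
      by (auto elim!: eventually_compose_filterlim)
  qed (rule assms(2))
  then show ?thesis by (simp add: case_prod_unfold)
qed

lemma L_continuous: "continuous_on ({0..T} \<times> {0..} \<times> UNIV) (\<lambda>(s, x, a). L i (m s) x a)"
  using costs m_P1 C1_L by (intro L_jointly_continuous) (auto simp: costs_def continuous_into_C1_def C1_halfplane_def)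

lemma Lx_continuous: "continuous_on ({0..T} \<times> {0..} \<times> UNIV) (\<lambda>(s, x, a). Lx i s x a)"
  using costs m_P1 C1_L by (intro L_jointly_continuous[where F="\<lambda>m. dx (L i m)"]) (auto simp: costs_def continuous_into_C1_def C1_halfplane_def)

lemma La_continuous: "continuous_on ({0..T} \<times> {0..} \<times> UNIV) (\<lambda>(s, x, a). La i s x a)"
  using costs m_P1 C1_L by (intro L_jointly_continuous[where F="\<lambda>m. da (L i m)"]) (auto simp: costs_def continuous_into_C1_def C1_halfplane_def)

lemma La_deriv:
  assumes "s \<in> {0..T}" "x \<ge> 0" shows "((\<lambda>b. L i (m s) x b) has_real_derivative La i s x a) (at a)"
  using C1_L[OF assms(1), of i] assms(2)
  by (auto simp: C1_halfplane_def da_def vector_derivative_works has_real_derivative_iff_has_vector_derivative)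

lemma Lx_deriv:
  assumes "s \<in> {0..T}" "x > 0" shows "((\<lambda>r. L i (m s) r a) has_real_derivative Lx i s x a) (at x)"
proof -
  have "((\<lambda>r. L i (m s) r a) has_vector_derivative Lx i s x a) (at x within {0..})"
    using C1_L[OF assms(1), of i] assms(2) by (auto simp: C1_halfplane_def dx_def vector_derivative_works)
  moreover have "at x within {0..} = at x" using assms(2) by (intro at_within_interior) auto
  ultimately show ?thesis by (simp add: has_real_derivative_iff_has_vector_derivative)
qed

lemma L_strictly_convex: "s \<in> {0..T} \<Longrightarrow> x \<ge> 0 \<Longrightarrow> strictly_convex (L i (m s) x)"
  using velocity_convex m_P1 by (simp add: velocity_convex_def)

lemma La_strict_mono: "s \<in> {0..T} \<Longrightarrow> x \<ge> 0 \<Longrightarrow> a < b \<Longrightarrow> La i s x a < La i s x b"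
  by (rule strictly_convex_deriv_less[OF L_strictly_convex La_deriv La_deriv])

lemma L_tangent: "s \<in> {0..T} \<Longrightarrow> x \<ge> 0 \<Longrightarrow> L i (m s) x b \<ge> L i (m s) x a + La i s x a * (b - a)"
  by (rule convex_deriv_above_tangent[OF L_strictly_convex La_deriv])

lemma L_lower_bound:
  obtains C0 where "C0 > 0" "\<And>i s x a. s \<in> {0..T} \<Longrightarrow> x \<ge> 0 \<Longrightarrow> L i (m s) x a \<ge> C0 * (\<bar>a\<bar> powr p - 1)"
    "\<And>s. s \<in> {0..T} \<Longrightarrow> Ls (m s) \<ge> - C0"
  using coercive m_P1 unfolding coercive_def by metis

lemma deriv_bound:
  assumes "R > 0"
  obtains c where "c \<ge> 0" "\<And>i s x a. s \<in> {0..T} \<Longrightarrow> x \<in> {0..R} \<Longrightarrow> \<bar>Lx i s x a\<bar> \<le> c * (\<bar>a\<bar> powr p + 1)"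
    "\<And>i s x a. s \<in> {0..T} \<Longrightarrow> x \<in> {0..R} \<Longrightarrow> \<bar>La i s x a\<bar> \<le> c * (\<bar>a\<bar> powr (p - 1) + 1)"
proof -
  obtain c where "c \<ge> 0" "\<forall>i. \<forall>m\<in>P1. \<forall>x\<in>{0..R}. \<forall>a.
        \<bar>dx (L i m) x a\<bar> \<le> c * (\<bar>a\<bar> powr p + 1) \<and>
        \<bar>da (L i m) x a\<bar> \<le> c * (\<bar>a\<bar> powr (p - 1) + 1)"
    using deriv_growth assms unfolding deriv_growth_def by blast
  then show thesis using that[of c] m_P1 by blast
qed

lemma abs_powr_bounds:
  fixes a :: real
  shows "\<bar>a\<bar> powr (p - 1) * \<bar>a\<bar> = \<bar>a\<bar> powr p" "\<bar>a\<bar> \<le> 1 + \<bar>a\<bar> powr p" "\<bar>a\<bar> powr (p - 1) \<le> 1 + \<bar>a\<bar> powr p"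
proof -
  show 1: "\<bar>a\<bar> powr (p - 1) * \<bar>a\<bar> = \<bar>a\<bar> powr p"
    by (cases "a = 0") (auto simp: powr_diff p)
  show "\<bar>a\<bar> \<le> 1 + \<bar>a\<bar> powr p" using norm_le_one_plus_powr[of "\<bar>a\<bar>" p] p by simp
  show "\<bar>a\<bar> powr (p - 1) \<le> 1 + \<bar>a\<bar> powr p"
  proof (cases "\<bar>a\<bar> \<le> 1")
    case True
    then have "\<bar>a\<bar> powr (p - 1) \<le> 1" using powr_le1[of "p - 1" "\<bar>a\<bar>"] p by simp
    then show ?thesis by (simp add: add_increasing2)
  next
    case False
    then have "\<bar>a\<bar> powr (p - 1) \<le> \<bar>a\<bar> powr p" by (intro powr_mono) auto
    then show ?thesis by simp
  qed
qed

text \<open>At velocity 0 the Lagrangian is bounded on compact sets by continuity. The growth of its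
  velocity derivative, integrated from 0 to a, adds terms in |a|^p and |a|.\<close>

lemma L_upper_bound:
  assumes "R > 0"
  obtains B where "B \<ge> 0" "\<And>i s x a. s \<in> {0..T} \<Longrightarrow> x \<in> {0..R} \<Longrightarrow> \<bar>L i (m s) x a\<bar> \<le> B * (\<bar>a\<bar> powr p + 1)"
proof -
  obtain c where c: "c \<ge> 0" "\<And>i s x a. s \<in> {0..T} \<Longrightarrow> x \<in> {0..R} \<Longrightarrow> \<bar>La i s x a\<bar> \<le> c * (\<bar>a\<bar> powr (p - 1) + 1)"
    using deriv_bound[OF assms] by metis
  have "\<exists>b. \<forall>s\<in>{0..T}. \<forall>x\<in>{0..R}. \<bar>L i (m s) x 0\<bar> \<le> b" for i
  proof -
    have "compact ({0..T} \<times> {0..R} \<times> {0::real})" by (intro compact_Times) auto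
    moreover have "continuous_on ({0..T} \<times> {0..R} \<times> {0::real}) (\<lambda>(s, x, a). L i (m s) x a)"
      by (rule continuous_on_subset[OF L_continuous]) auto
    ultimately have "bounded ((\<lambda>(s, x, a). L i (m s) x a) ` ({0..T} \<times> {0..R} \<times> {0::real}))"
      using compact_continuous_image compact_imp_bounded by blast
    then obtain b where "\<forall>q\<in>{0..T} \<times> {0..R} \<times> {0::real}. norm ((\<lambda>(s, x, a). L i (m s) x a) q) \<le> b"
      unfolding bounded_iff by blast
    then show ?thesis by auto
  qed
  then obtain b where b: "\<And>i s x. s \<in> {0..T} \<Longrightarrow> x \<in> {0..R} \<Longrightarrow> \<bar>L i (m s) x 0\<bar> \<le> b i"
    by metis
  define b' where "b' = Max (range b)"
  have b': "\<bar>L i (m s) x 0\<bar> \<le> b'" if "s \<in> {0..T}" "x \<in> {0..R}" for i s x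
    using b[OF that, of i] unfolding b'_def by (meson Max_ge finite finite_imageI order_trans rangeI)
  show thesis
  proof (rule that[of "\<bar>b'\<bar> + 2 * c"])
    fix i s x a assume s: "s \<in> {0..T}" and x: "x \<in> {0..R}"
    have "x \<ge> 0" using x by simp
    have der: "(L i (m s) x has_real_derivative La i s x r) (at r)" for r by (rule La_deriv[OF s \<open>x \<ge> 0\<close>])
    have "\<bar>L i (m s) x a - L i (m s) x 0\<bar> \<le> c * (\<bar>a\<bar> powr (p - 1) + 1) * \<bar>a\<bar>"
    proof -
      have "norm (L i (m s) x a - L i (m s) x 0) \<le> c * (\<bar>a\<bar> powr (p - 1) + 1) * norm (a - 0)"
      proof (rule field_differentiable_bound[where S="{- \<bar>a\<bar>..\<bar>a\<bar>}"])
        fix z assume "z \<in> {- \<bar>a\<bar>..\<bar>a\<bar>}"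
        then have "\<bar>z\<bar> powr (p - 1) \<le> \<bar>a\<bar> powr (p - 1)" using p by (intro powr_mono2) auto
        then have "c * (\<bar>z\<bar> powr (p - 1) + 1) \<le> c * (\<bar>a\<bar> powr (p - 1) + 1)"
          using c(1) by (intro mult_left_mono) auto
        then show "norm (La i s x z) \<le> c * (\<bar>a\<bar> powr (p - 1) + 1)" using c(2)[OF s x, of i z] by simp
      qed (auto intro: has_field_derivative_at_within[OF der])
      then show ?thesis by simp
    qed
    also have "\<dots> = c * (\<bar>a\<bar> powr p + \<bar>a\<bar>)" using abs_powr_bounds(1)[of a] by (simp add: algebra_simps)
    also have "\<dots> \<le> c * (2 * (\<bar>a\<bar> powr p + 1))" using abs_powr_bounds(2)[of a] c(1) by (intro mult_left_mono) auto
    finally have "\<bar>L i (m s) x a\<bar> \<le> 2 * c * (\<bar>a\<bar> powr p + 1) + \<bar>b'\<bar>" using b'[OF s x, of i] by linarith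
    moreover have "\<bar>b'\<bar> * 1 \<le> \<bar>b'\<bar> * (\<bar>a\<bar> powr p + 1)" by (intro mult_left_mono) auto
    ultimately have "\<bar>L i (m s) x a\<bar> \<le> 2 * c * (\<bar>a\<bar> powr p + 1) + \<bar>b'\<bar> * (\<bar>a\<bar> powr p + 1)" by linarith
    then show "\<bar>L i (m s) x a\<bar> \<le> (\<bar>b'\<bar> + 2 * c) * (\<bar>a\<bar> powr p + 1)" by (simp only: distrib_right add.commute)
  qed (use c in auto)
qed

lemma measurable_along:
  fixes F :: "real \<Rightarrow> real \<Rightarrow> real \<Rightarrow> real"
  assumes F: "continuous_on ({0..T} \<times> {0..} \<times> UNIV) (\<lambda>(s, x, a). F s x a)"
    and S: "S \<subseteq> {0..T}" "S \<in> sets lebesgue" and x: "x \<in> borel_measurable (lebesgue_on S)" "\<And>s. s \<in> S \<Longrightarrow> x s \<ge> 0"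
    and w: "w \<in> borel_measurable (lebesgue_on S)"
  shows "(\<lambda>s. F s (x s) (w s)) \<in> borel_measurable (lebesgue_on S)"
proof -
  let ?D = "{0..T} \<times> {0..} \<times> (UNIV :: real set)"
  have "(\<lambda>s. s) \<in> borel_measurable (lebesgue_on S)"
    by (rule continuous_imp_measurable_on_sets_lebesgue) (use S in auto)
  then have "(\<lambda>s. (s, x s, w s)) \<in> borel_measurable (lebesgue_on S)"
    using x w by (intro borel_measurable_Pair) auto
  then have "(\<lambda>s. (s, x s, w s)) \<in> measurable (lebesgue_on S) (restrict_space borel ?D)"
    using S x by (intro measurable_restrict_space2) (auto simp: space_restrict_space)
  from measurable_comp[OF this borel_measurable_continuous_on_restrict[OF F]]
  show ?thesis by (simp add: o_def)
qed

text \<open>The integrand of \<open>cost\<close>, with the given velocity in place of the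
  representative selected by \<open>weak_deriv\<close>; for a path and its velocity they agree off a
  null set.\<close>

definition lagr :: "(real \<Rightarrow> real^'n) \<Rightarrow> (real \<Rightarrow> real^'n) \<Rightarrow> real \<Rightarrow> real" where
  "lagr y v s = running_cost L Ls (m s) (y s) (speed v s)"

lemma lagr_edge: "norm (y s) > 0 \<Longrightarrow> y s \<in> edge i \<Longrightarrow> lagr y v s = L i (m s) (norm (y s)) (speed v s)"
proof -
  assume pos: "norm (y s) > 0" and "y s \<in> edge i"
  then obtain r where r: "y s = r *\<^sub>R axis i 1" "r \<ge> 0" by (auto simp: edge_def)
  then have "r > 0" "norm (y s) = r" using pos by (auto simp: norm_axis_1)
  then show ?thesis using r running_cost_edge[of r L Ls "m s" i "speed v s"] by (simp add: lagr_def)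
qed

lemma MIN_in: "(MIN i. f i) \<in> range (f :: 'n \<Rightarrow> real)"
  using Min_in[of "range f"] by simp

lemma Ls_bounded: obtains B where "B \<ge> 0" "\<And>s. s \<in> {0..T} \<Longrightarrow> \<bar>Ls (m s)\<bar> \<le> B"
proof -
  obtain B where "\<forall>m\<in>P1. \<bar>Ls m\<bar> \<le> B" using costs by (auto simp: costs_def Cb_into_real_def)
  then show thesis using that[of "max B 0"] m_P1 by (meson max.coboundedI1 max.cobounded2)
qed

lemma lagr_lower_bound:
  obtains C0 where "C0 > 0" "\<And>y v s. s \<in> {0..T} \<Longrightarrow> (y s :: real^'n) \<in> junction \<Longrightarrow> lagr y v s \<ge> - C0"
proof -
  obtain C0 where C0: "C0 > 0" "\<And>i s x a. s \<in> {0..T} \<Longrightarrow> x \<ge> 0 \<Longrightarrow> L i (m s) x a \<ge> C0 * (\<bar>a\<bar> powr p - 1)"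
    "\<And>s. s \<in> {0..T} \<Longrightarrow> Ls (m s) \<ge> - C0" using L_lower_bound by metis
  have low: "L i (m s) x a \<ge> - C0" if "s \<in> {0..T}" "x \<ge> 0" for i s x a
  proof -
    have "C0 * (-1) \<le> C0 * (\<bar>a\<bar> powr p - 1)" using C0(1) by (intro mult_left_mono) auto
    then show ?thesis using C0(2)[OF that, of a i] by simp
  qed
  show thesis
  proof (rule that[OF C0(1)])
    fix y v :: "real \<Rightarrow> real^'n" and s assume s: "s \<in> {0..T}" "y s \<in> junction"
    obtain i r where r: "y s = r *\<^sub>R axis i 1" "r \<ge> 0" using junctionE[OF s(2)] .
    show "lagr y v s \<ge> - C0"
    proof (cases "r = 0")
      case True
      have "- C0 \<le> L i (m s) 0 0" for i by (intro low s) simp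
      then have "- C0 \<le> (MIN i. L i (m s) 0 0)" using MIN_in[of "\<lambda>i. L i (m s) 0 0"] by force
      then show ?thesis using True r C0(3)[OF s(1)] by (simp add: lagr_def running_cost_0)
    next
      case False
      then show ?thesis using r low[OF s(1), of r] by (simp add: lagr_def running_cost_edge)
    qed
  qed
qed

lemma final_cost_bounded:
  obtains B where "\<And>x :: real^'n. x \<in> junction \<Longrightarrow> \<bar>final_cost G Gs (m T) x\<bar> \<le> B"
proof -
  have mT: "m T \<in> P1" using m_P1 T by simp
  have "\<forall>i. \<exists>B. \<forall>x\<ge>0. \<bar>G i (m T) x\<bar> \<le> B" using costs mT unfolding costs_def Cb_into_Cb_def by metis
  then obtain b where b: "\<And>i x. x \<ge> 0 \<Longrightarrow> \<bar>G i (m T) x\<bar> \<le> b i" by metis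
  define B where "B = Max (range b) + \<bar>Gs (m T)\<bar>"
  have B: "\<bar>G i (m T) x\<bar> \<le> Max (range b)" if "x \<ge> 0" for i x
    using b[OF that, of i] by (meson Max_ge finite finite_imageI order_trans rangeI)
  show thesis
  proof (rule that[of B])
    fix x :: "real^'n" assume "x \<in> junction"
    then obtain i r where r: "x = r *\<^sub>R axis i 1" "r \<ge> 0" using junctionE by blast
    show "\<bar>final_cost G Gs (m T) x\<bar> \<le> B"
    proof (cases "r = 0")
      case True
      have "\<bar>G i (m T) 0\<bar> \<le> Max (range b)" for i by (intro B) simp
      then have "\<bar>MIN i. G i (m T) 0\<bar> \<le> Max (range b)" using MIN_in[of "\<lambda>i. G i (m T) 0"] by force
      then show ?thesis using True r by (auto simp: final_cost_0 B_def)
    next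
      case False
      then show ?thesis using r B[of r i] by (simp add: final_cost_edge B_def)
    qed
  qed
qed

lemma closed_edge: "closed (edge (i::'n))"
proof -
  have "edge i = {x. x $ i \<ge> 0 \<and> (\<forall>j. j \<noteq> i \<longrightarrow> x $ j = 0)}" (is "_ = ?E")
  proof
    show "edge i \<subseteq> ?E" by (auto simp: edge_def axis_def)
    show "?E \<subseteq> edge i"
    proof
      fix x assume "x \<in> ?E"
      then have "x = (x $ i) *\<^sub>R axis i 1" "x $ i \<ge> 0" by (auto simp: vec_eq_iff axis_def)
      then show "x \<in> edge i" unfolding edge_def by blast
    qed
  qed
  also have "closed \<dots>"
    by (intro closed_Collect_conj closed_Collect_all closed_Collect_imp closed_Collect_le closed_Collect_eq open_Collect_const continuous_intros)
  finally show ?thesis .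
qed

text \<open>Measurability is checked summand by summand, the edges being closed sets. The dominating
  function comes from the upper bound on L, the radial velocity being at most N times the norm of
  the velocity.\<close>

lemma lagr_absint:
  assumes y: "ac_path p a b y v" and "0 \<le> a" "b \<le> T"
  shows "lagr y v absolutely_integrable_on {a..b}"
proof (cases "a \<le> b")
  case True
  let ?M = "lebesgue_on {a..b}"
  have sub: "{a..b} \<subseteq> {0..T}" using assms by auto
  note cont = ac_path_continuous[OF y]
  have ym: "y \<in> borel_measurable ?M" using cont by (simp add: continuous_imp_measurable_on_sets_lebesgue)
  have wm: "speed v \<in> borel_measurable ?M"
    by (intro absolutely_integrable_imp_borel_measurable speed_absint ac_path_absint[OF y]) auto
  have id: "(\<lambda>s. s) \<in> borel_measurable ?M" by (rule continuous_imp_measurable_on_sets_lebesgue) auto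
  have nm: "(\<lambda>s. norm (y s)) \<in> borel_measurable ?M" using ym by measurable
  have m1: "(\<lambda>s. L i (m s) (norm (y s)) (speed v s)) \<in> borel_measurable ?M" for i
    by (rule measurable_along[OF L_continuous sub _ nm _ wm]) auto
  have m0: "(\<lambda>s. L i (m s) 0 0) \<in> borel_measurable ?M" for i
    by (rule measurable_along[OF L_continuous sub]) auto
  have "continuous_on {0..T} (\<lambda>s. Ls (m s))"
    unfolding continuous_on_def
  proof
    fix s assume s: "s \<in> {0..T}"
    have "(Ls \<longlongrightarrow> Ls (m s)) (P1_nhds (m s))" using costs m_P1[OF s] by (simp add: costs_def Cb_into_real_def)
    from filterlim_compose[OF this m_cont[OF s]] show "((\<lambda>s. Ls (m s)) \<longlongrightarrow> Ls (m s)) (at s within {0..T})" .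
  qed
  then have m2: "(\<lambda>s. Ls (m s)) \<in> borel_measurable ?M"
    using sub by (intro continuous_imp_measurable_on_sets_lebesgue) (auto intro: continuous_on_subset)
  have me: "(\<lambda>s. indicat_real (edge i - {0}) (y s)) \<in> borel_measurable ?M" for i
  proof -
    have "edge i - {0} \<in> sets (borel :: (real^'n) measure)" using closed_edge[of i] by auto
    then have "indicat_real (edge i - {0}) \<in> borel_measurable borel" by simp
    from measurable_comp[OF ym this] show ?thesis by (simp add: o_def)
  qed
  have mz: "(\<lambda>s. indicat_real {0} (y s)) \<in> borel_measurable ?M"
  proof -
    have "indicat_real {0::real^'n} \<in> borel_measurable borel" by simp
    from measurable_comp[OF ym this] show ?thesis by (simp add: o_def)
  qed
  have "(\<lambda>s. MIN i. L i (m s) 0 0) \<in> borel_measurable ?M"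
    by (intro borel_measurable_Min m0) auto
  then have meas: "lagr y v \<in> borel_measurable ?M"
    unfolding lagr_def[abs_def] running_cost_def using m1 m2 me mz
    by (intro borel_measurable_add borel_measurable_sum borel_measurable_times borel_measurable_min) auto
  have "bounded (y ` {a..b})" using cont compact_Icc compact_continuous_image compact_imp_bounded by blast
  then obtain R where R: "R > 0" "\<And>s. s \<in> {a..b} \<Longrightarrow> norm (y s) \<le> R"
    unfolding bounded_pos by auto
  obtain B where B: "B \<ge> 0" "\<And>i s x a. s \<in> {0..T} \<Longrightarrow> x \<in> {0..R} \<Longrightarrow> \<bar>L i (m s) x a\<bar> \<le> B * (\<bar>a\<bar> powr p + 1)"
    using L_upper_bound[OF R(1)] by metis
  obtain B' where B': "B' \<ge> 0" "\<And>s. s \<in> {0..T} \<Longrightarrow> \<bar>Ls (m s)\<bar> \<le> B'" using Ls_bounded by metis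
  have "\<bar>lagr y v s\<bar> \<le> B * (real CARD('n) powr p * norm (v s) powr p + 1) + B'" if s: "s \<in> {a..b}" for s
  proof -
    obtain i r where r: "y s = r *\<^sub>R axis i 1" "r \<ge> 0" using junctionE[OF ac_path_in_junction[OF y s]] .
    have rR: "r \<in> {0..R}" using R(2)[OF s] r by (simp add: norm_axis_1)
    have sT: "s \<in> {0..T}" using s sub by auto
    have "\<bar>speed v s\<bar> powr p \<le> (real CARD('n) * norm (v s)) powr p"
      using p speed_le[of v s] by (intro powr_mono2) auto
    then have "\<bar>speed v s\<bar> powr p \<le> real CARD('n) powr p * norm (v s) powr p" by (simp add: powr_mult)
    then have big: "B * (\<bar>speed v s\<bar> powr p + 1) \<le> B * (real CARD('n) powr p * norm (v s) powr p + 1)"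
      using B(1) by (intro mult_left_mono) auto
    show ?thesis
    proof (cases "r = 0")
      case True
      have "\<bar>L i (m s) 0 0\<bar> \<le> B * (\<bar>0\<bar> powr p + 1)" for i using R(1) by (intro B(2) sT) auto
      then have "\<bar>MIN i. L i (m s) 0 0\<bar> \<le> B * (\<bar>0\<bar> powr p + 1)" using MIN_in[of "\<lambda>i. L i (m s) 0 0"] by force
      also have "\<dots> = B * 1" using p by simp
      also have "\<dots> \<le> B * (real CARD('n) powr p * norm (v s) powr p + 1)" using B(1) by (intro mult_left_mono) auto
      finally show ?thesis using True r B'(2)[OF sT] B'(1) by (auto simp: lagr_def running_cost_0)
    next
      case False
      then show ?thesis using r B(2)[OF sT rR, of i "speed v s"] big B'(1)
        by (simp add: lagr_def running_cost_edge)
    qed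
  qed
  moreover have "(\<lambda>s. B * (real CARD('n) powr p * norm (v s) powr p + 1) + B') integrable_on {a..b}"
  proof -
    have "(\<lambda>s. norm (v s) powr p) integrable_on {a..b}" by (intro absint_imp_int ac_path_absint[OF y])
    then show ?thesis
      by (intro integrable_add integrable_on_mult_right) auto
  qed
  ultimately show ?thesis
    by (intro measurable_bounded_by_integrable_imp_absolutely_integrable[OF meas]) auto
qed auto

lemma cost_eq:
  assumes \<mu>: "\<And>s. s \<in> {0..T} \<Longrightarrow> marginal \<mu> s = m s" and y: "ac_path p t T y v" and t: "0 \<le> t" "t < T"
  shows "cost T L Ls G Gs \<mu> t y = integral {t..T} (lagr y v) + final_cost G Gs (m T) (y T)"
proof -
  obtain N where N: "negligible N" "\<And>s. s \<in> {t<..<T} - N \<Longrightarrow> weak_deriv t T (\<lambda>s. norm (y s)) s = speed v s"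
    using ac_path_weak_deriv_norm[OF y t(2)] by blast
  let ?h = "\<lambda>s. running_cost L Ls (marginal \<mu> s) (y s) (weak_deriv t T (\<lambda>s. norm (y s)) s)"
  have eq: "?h s = lagr y v s" if "s \<in> {t<..<T} - N" for s
    using that N(2)[OF that] \<mu>[of s] t by (simp add: lagr_def)
  have "lagr y v absolutely_integrable_on {t<..<T}"
    using lagr_absint[OF y] t by (simp add: absolutely_integrable_on_Icc_iff_Ioo)
  then have "?h absolutely_integrable_on {t<..<T}"
    by (rule absolutely_integrable_spike[OF _ N(1)]) (rule eq)
  then have "(LINT s|lebesgue_on {t<..<T}. ?h s) = integral {t<..<T} ?h"
    by (intro lebesgue_integral_eq_integral) (auto simp: integrable_lebesgue_on_iff)
  also have "\<dots> = integral {t<..<T} (lagr y v)"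
    by (rule integral_spike[OF N(1)]) (simp add: eq)
  also have "\<dots> = integral {t..T} (lagr y v)" by (rule integral_open_interval_real[symmetric])
  finally show ?thesis using \<mu>[of T] T by (simp add: cost_def)
qed

end

section \<open>The Euler-Lagrange equation\<close>

lemma absint_const: "(\<lambda>_. k) absolutely_integrable_on {a..b::real}" for k :: "'b::euclidean_space"
  by (intro absolutely_integrable_continuous_real continuous_intros)

lemma integral_split3:
  fixes f :: "real \<Rightarrow> real"
  assumes f: "f integrable_on {a..d}" and "a \<le> b" "b \<le> c" "c \<le> d"
  shows "integral {a..d} f = integral {a..b} f + integral {b..c} f + integral {c..d} f"
proof -
  have "integral {a..b} f + integral {b..d} f = integral {a..d} f"
    using assms by (intro Henstock_Kurzweil_Integration.integral_combine) auto
  moreover have "integral {b..c} f + integral {c..d} f = integral {b..d} f"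
    using assms by (intro Henstock_Kurzweil_Integration.integral_combine integrable_on_subinterval[OF f]) auto
  ultimately show ?thesis by simp
qed

text \<open>The sum is at most twice the larger term, whose power is at most the sum of the
  powers.\<close>

lemma powr_add_le:
  fixes x k p :: real assumes "x \<ge> 0" "k \<ge> 0" "p > 0"
  shows "(x + k) powr p \<le> 2 powr p * (x powr p + k powr p)"
proof -
  have "(x + k) powr p \<le> (2 * max x k) powr p" using assms by (intro powr_mono2) auto
  also have "\<dots> = 2 powr p * (max x k) powr p" using assms by (simp add: powr_mult)
  also have "(max x k) powr p \<le> x powr p + k powr p" by (simp add: max_def)
  finally show ?thesis by (simp add: mult_left_mono)
qed

lemma negligible_support_if_integral_zero:
  fixes f :: "real \<Rightarrow> real"
  assumes f: "f absolutely_integrable_on {a..b}" and nonneg: "\<And>s. s \<in> {a..b} \<Longrightarrow> f s \<ge> 0"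
    and "integral {a..b} f = 0"
  shows "\<exists>N. negligible N \<and> (\<forall>s\<in>{a..b} - N. f s = 0)"
proof (rule negligible_support_if_integrals_zero[OF f])
  fix c d assume cd: "a \<le> c" "c \<le> d" "d \<le> b"
  have fcd: "f integrable_on {c..d}" using cd by (intro absint_imp_int absint_sub[OF f]) auto
  have "integral {c..d} f \<le> integral {a..b} f"
    using cd nonneg by (intro integral_subset_le fcd absint_imp_int f) auto
  moreover have "0 \<le> integral {c..d} f"
    using cd nonneg by (intro Henstock_Kurzweil_Integration.integral_nonneg fcd) auto
  ultimately show "integral {c..d} f = 0" using assms by simp
qed

text \<open>Testing \<open>W\<close> against its truncation minus the mean \<open>c\<close> of the truncation gives a nonnegative
  integrand \<open>(W - c) (trunc W - c)\<close>, which vanishes only where \<open>W = c\<close> once the truncation level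
  exceeds \<open>\<bar>c\<bar>\<close>.\<close>

lemma constant_if_orthogonal_to_mean_zero:
  fixes W :: "real \<Rightarrow> real"
  assumes "a < b" and W: "W absolutely_integrable_on {a..b}"
    and orth: "\<And>\<psi> M. \<psi> \<in> borel_measurable (lebesgue_on {a..b}) \<Longrightarrow> (\<And>s. s \<in> {a..b} \<Longrightarrow> \<bar>\<psi> s\<bar> \<le> M) \<Longrightarrow>
      integral {a..b} \<psi> = 0 \<Longrightarrow> integral {a..b} (\<lambda>s. W s * \<psi> s) = 0"
  shows "\<exists>c N. negligible N \<and> (\<forall>s\<in>{a..b} - N. W s = c)"
proof -
  \<comment> \<open>Truncation makes the test function bounded, as \<open>orth\<close> demands. The
    mean of the truncation is at most the mean of |W|, so with the summand 1 the level strictly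
    exceeds |c|.\<close>
  define n where "n = integral {a..b} (\<lambda>s. \<bar>W s\<bar>) / (b - a) + 1"
  define t where "t = (\<lambda>w::real. max (- n) (min n w))"
  have Wabs: "(\<lambda>s. \<bar>W s\<bar>) integrable_on {a..b}" using absint_norm_int[OF W] by simp
  have n1: "n \<ge> 1"
    unfolding n_def using \<open>a < b\<close> Henstock_Kurzweil_Integration.integral_nonneg[OF Wabs] by simp
  have Wm: "W \<in> borel_measurable (lebesgue_on {a..b})"
    by (rule absolutely_integrable_imp_borel_measurable[OF W]) auto
  have tm: "(\<lambda>s. t (W s)) \<in> borel_measurable (lebesgue_on {a..b})"
    unfolding t_def using Wm by measurable
  have tb: "\<bar>t w\<bar> \<le> n" "\<bar>t w\<bar> \<le> \<bar>w\<bar>" for w using n1 by (auto simp: t_def)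
  have ti: "(\<lambda>s. t (W s)) absolutely_integrable_on {a..b}"
    by (rule measurable_bounded_by_integrable_imp_absolutely_integrable[OF tm _ Wabs]) (auto simp: tb)
  define c where "c = integral {a..b} (\<lambda>s. t (W s)) / (b - a)"
  have "\<bar>integral {a..b} (\<lambda>s. t (W s))\<bar> \<le> integral {a..b} (\<lambda>s. \<bar>W s\<bar>)"
    using integral_norm_bound_integral[OF absint_imp_int[OF ti] Wabs] tb by simp
  then have "\<bar>c\<bar> \<le> n - 1"
    unfolding c_def n_def using \<open>a < b\<close> by (simp add: abs_divide divide_right_mono)
  then have cn: "\<bar>c\<bar> < n" by simp
  define \<psi> where "\<psi> = (\<lambda>s. t (W s) - c)"
  have \<psi>m: "\<psi> \<in> borel_measurable (lebesgue_on {a..b})" unfolding \<psi>_def using tm by measurable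
  have \<psi>i: "\<psi> absolutely_integrable_on {a..b}"
    unfolding \<psi>_def by (intro set_integral_diff ti absint_const)
  have \<psi>b: "\<bar>\<psi> s\<bar> \<le> n + \<bar>c\<bar>" for s using tb[of "W s"] unfolding \<psi>_def by linarith
  have \<psi>0: "integral {a..b} \<psi> = 0"
    unfolding \<psi>_def using \<open>a < b\<close>
    by (subst Henstock_Kurzweil_Integration.integral_diff) (auto intro: absint_imp_int ti simp: c_def)
  have W\<psi>: "(\<lambda>s. W s * \<psi> s) absolutely_integrable_on {a..b}"
  proof -
    have "bounded (\<psi> ` {a..b})" unfolding bounded_iff using \<psi>b by auto
    from absolutely_integrable_bounded_measurable_product_real[OF \<psi>m _ this W] show ?thesis by (simp add: mult.commute)
  qed
  define f where "f = (\<lambda>s. (W s - c) * \<psi> s)"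
  have f_alt: "f = (\<lambda>s. W s * \<psi> s - c * \<psi> s)" by (simp add: f_def algebra_simps)
  have fi: "f absolutely_integrable_on {a..b}"
    unfolding f_alt using \<psi>i by (intro set_integral_diff W\<psi> set_integrable_mult_right) auto
  have "integral {a..b} f = 0"
    unfolding f_alt using orth[OF \<psi>m \<psi>b \<psi>0] \<psi>0
    by (subst Henstock_Kurzweil_Integration.integral_diff) (auto intro!: absint_imp_int W\<psi> \<psi>i integrable_on_mult_right)
  moreover have "f s \<ge> 0" for s
  proof (cases "W s \<ge> c")
    case True
    then have "t (W s) \<ge> c" using cn by (auto simp: t_def)
    then show ?thesis using True by (auto simp: f_def \<psi>_def)
  next
    case False
    then have "t (W s) \<le> c" using cn by (auto simp: t_def)
    then show ?thesis using False by (auto simp: f_def \<psi>_def intro: mult_nonpos_nonpos)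
  qed
  ultimately obtain N where N: "negligible N" "\<And>s. s \<in> {a..b} - N \<Longrightarrow> f s = 0"
    using negligible_support_if_integral_zero[OF fi] by blast
  have "W s = c" if "s \<in> {a..b} - N" for s
  proof (rule ccontr)
    assume "W s \<noteq> c"
    \<comment> \<open>Truncated values have modulus n, which c has not; so a truncation equal to c
      would mean W s = c.\<close>
    moreover from this have "t (W s) \<noteq> c" using cn by (auto simp: t_def max_def min_def split: if_splits)
    ultimately show False using N(2)[OF that] by (simp add: f_def \<psi>_def)
  qed
  with N(1) show ?thesis by blast
qed

section \<open>First variation of the action on an edge\<close>

context mfg_costs
begin

text \<open>Position and velocity are perturbed together, while the hypotheses speak of partial
  derivatives. Continuity of the velocity derivative makes them a total derivative; the open
  half-plane is used because the position derivative at 0 is one-sided.\<close>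

lemma L_directional_derivative:
  assumes s: "s \<in> {0..T}" and "x > 0"
  shows "((\<lambda>e. L i (m s) (x + e * \<phi>) (a + e * \<psi>)) has_real_derivative Lx i s x a * \<phi> + La i s x a * \<psi>) (at 0)"
proof -
  define F where "F = (\<lambda>(r, b). L i (m s) r b)"
  have tot: "((\<lambda>(r, b). L i (m s) r b) has_derivative (\<lambda>(tr, tb). Lx i s x a * tr + blinfun_apply (blinfun_mult_right (La i s x a)) tb)) (at (x, a) within {0<..} \<times> UNIV)"
  proof (rule has_derivative_partialsI[where fy="\<lambda>r b. blinfun_mult_right (La i s r b)"])
    show "((\<lambda>r. L i (m s) r a) has_derivative (*) (Lx i s x a)) (at x within {0<..})"
      using Lx_deriv[OF s \<open>x > 0\<close>, of i a] by (simp add: has_field_derivative_def has_derivative_at_withinI)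
    show "((\<lambda>y. L i (m s) r y) has_derivative blinfun_apply (blinfun_mult_right (La i s r b))) (at b within UNIV)"
      if "r \<in> {0<..}" for r b
      using La_deriv[OF s, of r i b] that by (simp add: has_field_derivative_def)
    have "continuous_on ({0..} \<times> UNIV) (\<lambda>(r, b). La i s r b)"
      using C1_L[OF s, of i] by (simp add: C1_halfplane_def)
    then have "continuous_on ({0<..} \<times> UNIV) (\<lambda>(r, b). La i s r b)"
      by (rule continuous_on_subset) auto
    then have "continuous_on ({0<..} \<times> UNIV) (\<lambda>q. blinfun_mult_right ((\<lambda>(r, b). La i s r b) q))"
      by (rule bounded_linear.continuous_on[OF bounded_linear_blinfun_mult_right])
    then show "continuous (at (x, a) within {0<..} \<times> UNIV) (\<lambda>(r, b). blinfun_mult_right (La i s r b))"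
      using \<open>x > 0\<close> by (simp add: continuous_on_eq_continuous_within case_prod_unfold)
  qed auto
  have "open ({0<..} \<times> (UNIV :: real set) :: (real \<times> real) set)" by (intro open_Times) auto
  then have tot': "(F has_derivative (\<lambda>(tr, tb). Lx i s x a * tr + La i s x a * tb)) (at (x, a))"
    using tot \<open>x > 0\<close> unfolding F_def by (subst (asm) at_within_open) auto
  have lin: "((\<lambda>e. (x + e * \<phi>, a + e * \<psi>)) has_derivative (\<lambda>e. (e * \<phi>, e * \<psi>))) (at 0)"
    by (auto intro!: derivative_eq_intros)
  have "((\<lambda>e. F (x + e * \<phi>, a + e * \<psi>)) has_derivative (\<lambda>e. (\<lambda>(tr, tb). Lx i s x a * tr + La i s x a * tb) (e * \<phi>, e * \<psi>))) (at 0)"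
    by (rule has_derivative_compose[OF lin]) (use tot' in simp)
  moreover have "(\<lambda>e. (\<lambda>(tr, tb). Lx i s x a * tr + La i s x a * tb) (e * \<phi>, e * \<psi>)) = (*) (Lx i s x a * \<phi> + La i s x a * \<psi>)"
    by (auto simp: fun_eq_iff algebra_simps)
  ultimately show ?thesis
    by (simp add: F_def has_field_derivative_def)
qed

lemma abs_plus_one_powr: "(\<bar>a\<bar> + 1) powr p \<le> 2 powr p * (\<bar>a\<bar> powr p + 1)" for a :: real
  using powr_add_le[of "\<bar>a\<bar>" 1 p] p by simp

text \<open>Provides a dominating function for the difference quotients. The position is moved first
  and then the velocity, each by the mean value inequality. With q = (|a| + 1)^p the two steps
  contribute q + 1 and q + 2, the latter after |z|^(p - 1) is replaced by 1 + |z|^p.\<close>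

lemma L_difference_bound:
  assumes c: "c \<ge> 0" "\<And>i s x a. s \<in> {0..T} \<Longrightarrow> x \<in> {0..R} \<Longrightarrow> \<bar>Lx i s x a\<bar> \<le> c * (\<bar>a\<bar> powr p + 1)"
    "\<And>i s x a. s \<in> {0..T} \<Longrightarrow> x \<in> {0..R} \<Longrightarrow> \<bar>La i s x a\<bar> \<le> c * (\<bar>a\<bar> powr (p - 1) + 1)"
    and s: "s \<in> {0..T}" and x: "x \<in> {0<..R}" "x' \<in> {0<..R}" and a: "\<bar>a' - a\<bar> \<le> 1"
    and d: "\<bar>x' - x\<bar> \<le> d" "\<bar>a' - a\<bar> \<le> d"
  shows "\<bar>L i (m s) x' a' - L i (m s) x a\<bar> \<le> d * (c * (3 + 2 * (2 powr p * (\<bar>a\<bar> powr p + 1))))"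
proof -
  let ?q = "(\<bar>a\<bar> + 1) powr p"
  have d0: "d \<ge> 0" using d by linarith
  have "norm (L i (m s) x' a' - L i (m s) x a') \<le> c * (?q + 1) * norm (x' - x)"
  proof (rule field_differentiable_bound[where S="{0<..R}" and f'="\<lambda>r. Lx i s r a'"])
    show "((\<lambda>r. L i (m s) r a') has_field_derivative Lx i s z a') (at z within {0<..R})" if "z \<in> {0<..R}" for z
      using that by (intro has_field_derivative_at_within[OF Lx_deriv[OF s]]) auto
    fix z assume z: "z \<in> {0<..R}"
    have "\<bar>Lx i s z a'\<bar> \<le> c * (\<bar>a'\<bar> powr p + 1)" using z by (intro c s) auto
    also have "\<dots> \<le> c * (?q + 1)" using c(1) p a by (intro mult_left_mono add_right_mono powr_mono2) auto
    finally show "norm (Lx i s z a') \<le> c * (?q + 1)" by simp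
  qed (use x in auto)
  also have "\<dots> \<le> c * (?q + 1) * d" using c(1) d by (intro mult_left_mono) auto
  finally have 1: "\<bar>L i (m s) x' a' - L i (m s) x a'\<bar> \<le> c * (?q + 1) * d" by simp
  have "norm (L i (m s) x a' - L i (m s) x a) \<le> c * (?q + 2) * norm (a' - a)"
  proof (rule field_differentiable_bound[where S="{a - 1..a + 1}" and f'="\<lambda>b. La i s x b"])
    show "(L i (m s) x has_field_derivative La i s x z) (at z within {a - 1..a + 1})" for z
      using x by (intro has_field_derivative_at_within[OF La_deriv[OF s]]) auto
    fix z assume z: "z \<in> {a - 1..a + 1}"
    have "\<bar>La i s x z\<bar> \<le> c * (\<bar>z\<bar> powr (p - 1) + 1)" using x by (intro c s) auto
    also have "\<dots> \<le> c * (1 + \<bar>z\<bar> powr p + 1)" using c(1) abs_powr_bounds(3) by (intro mult_left_mono) auto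
    also have "\<dots> \<le> c * (?q + 2)"
    proof (intro mult_left_mono c(1))
      have "\<bar>z\<bar> powr p \<le> ?q" using p z by (intro powr_mono2) auto
      then show "1 + \<bar>z\<bar> powr p + 1 \<le> ?q + 2" by simp
    qed
    finally show "norm (La i s x z) \<le> c * (?q + 2)" by simp
  qed (use a in auto)
  also have "\<dots> \<le> c * (?q + 2) * d" using c(1) d by (intro mult_left_mono) auto
  finally have 2: "\<bar>L i (m s) x a' - L i (m s) x a\<bar> \<le> c * (?q + 2) * d" by simp
  have "\<bar>L i (m s) x' a' - L i (m s) x a\<bar> \<le> c * (?q + 1) * d + c * (?q + 2) * d" using 1 2 by linarith
  also have "\<dots> = d * (c * (3 + 2 * ?q))" by (simp add: algebra_simps)
  also have "\<dots> \<le> d * (c * (3 + 2 * (2 powr p * (\<bar>a\<bar> powr p + 1))))"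
    using d0 c(1) abs_plus_one_powr[of a] by (intro mult_left_mono) auto
  finally show ?thesis .
qed

text \<open>Dominated convergence of difference quotients along a positive sequence. Minimality is
  used only for steps that keep the perturbed position away from the vertex. The perturbations
  \<phi> and \<psi> are independent here; their relation enters through the minimality
  hypothesis.\<close>

lemma first_variation_nonneg:
  assumes ab: "0 \<le> \<alpha>" "\<beta> \<le> T" and \<rho>: "\<rho> > 0" and x: "continuous_on {\<alpha>..\<beta>} x" "\<And>s. s \<in> {\<alpha>..\<beta>} \<Longrightarrow> \<rho> \<le> x s"
    and a: "a absolutely_integrable_on {\<alpha>..\<beta>}" "(\<lambda>s. \<bar>a s\<bar> powr p) integrable_on {\<alpha>..\<beta>}"
    and \<phi>: "continuous_on {\<alpha>..\<beta>} \<phi>" and \<psi>: "\<psi> \<in> borel_measurable (lebesgue_on {\<alpha>..\<beta>})"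
    and M: "M > 0" "\<And>s. s \<in> {\<alpha>..\<beta>} \<Longrightarrow> \<bar>\<phi> s\<bar> \<le> M" "\<And>s. s \<in> {\<alpha>..\<beta>} \<Longrightarrow> \<bar>\<psi> s\<bar> \<le> M"
    and min: "\<And>e. 0 < e \<Longrightarrow> e * M \<le> \<rho> / 2 \<Longrightarrow> integral {\<alpha>..\<beta>} (\<lambda>s. L i (m s) (x s) (a s))
        \<le> integral {\<alpha>..\<beta>} (\<lambda>s. L i (m s) (x s + e * \<phi> s) (a s + e * \<psi> s))"
  shows "0 \<le> integral {\<alpha>..\<beta>} (\<lambda>s. Lx i s (x s) (a s) * \<phi> s + La i s (x s) (a s) * \<psi> s)"
proof -
  let ?I = "{\<alpha>..\<beta>}"
  have "bounded (x ` ?I)" using x(1) compact_Icc compact_continuous_image compact_imp_bounded by blast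
  then obtain R0 where R0: "R0 > 0" "\<And>s. s \<in> ?I \<Longrightarrow> \<bar>x s\<bar> \<le> R0"
    unfolding bounded_pos by auto
  define R where "R = R0 + \<rho>"
  have "R > 0" using R0 \<rho> by (simp add: R_def)
  obtain c where c: "c \<ge> 0" "\<And>i s x a. s \<in> {0..T} \<Longrightarrow> x \<in> {0..R} \<Longrightarrow> \<bar>Lx i s x a\<bar> \<le> c * (\<bar>a\<bar> powr p + 1)"
    "\<And>i s x a. s \<in> {0..T} \<Longrightarrow> x \<in> {0..R} \<Longrightarrow> \<bar>La i s x a\<bar> \<le> c * (\<bar>a\<bar> powr (p - 1) + 1)"
    using deriv_bound[OF \<open>R > 0\<close>] by metis
  obtain B where B: "B \<ge> 0" "\<And>i s x a. s \<in> {0..T} \<Longrightarrow> x \<in> {0..R} \<Longrightarrow> \<bar>L i (m s) x a\<bar> \<le> B * (\<bar>a\<bar> powr p + 1)"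
    using L_upper_bound[OF \<open>R > 0\<close>] by metis
  \<comment> \<open>Keeps the perturbed position above \<rho> / 2 and the change of velocity below
    1, the range in which the difference bound holds.\<close>
  define e0 where "e0 = min (\<rho> / 2) 1 / M"
  have e0: "e0 > 0" "e0 * M \<le> \<rho> / 2" "e0 * M \<le> 1" using \<rho> M by (auto simp: e0_def)
  define e where "e = (\<lambda>k::nat. e0 / real (Suc k))"
  have e: "e k > 0" "e k * M \<le> \<rho> / 2" "e k * M \<le> 1" for k
  proof -
    have "e k \<le> e0" using e0(1) by (simp add: e_def divide_le_eq)
    then have "e k * M \<le> e0 * M" using M by (intro mult_right_mono) auto
    from order_trans[OF this e0(2)] order_trans[OF this e0(3)] e0(1)
    show "e k > 0" "e k * M \<le> \<rho> / 2" "e k * M \<le> 1" by (simp_all add: e_def)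
  qed
  have elim: "e \<longlonglongrightarrow> 0" unfolding e_def by (rule LIMSEQ_Suc[OF lim_const_over_n])
  define Lk where "Lk = (\<lambda>e s. L i (m s) (x s + e * \<phi> s) (a s + e * \<psi> s))"
  define D where "D = (\<lambda>k s. (Lk (e k) s - Lk 0 s) / e k)"
  define h where "h = (\<lambda>s. M * (c * (3 + 2 * (2 powr p * (\<bar>a s\<bar> powr p + 1)))))"
  have small: "\<bar>e k * \<phi> s\<bar> \<le> e k * M" "\<bar>e k * \<psi> s\<bar> \<le> e k * M" if "s \<in> ?I" for s k
    using M(2,3)[OF that] e(1)[of k] by (auto simp: abs_mult)
  have xr: "x s \<in> {0<..R}" "x s + e k * \<phi> s \<in> {0<..R}" if "s \<in> ?I" for s k
    using small(1)[OF that, of k] e(2)[of k] x(2)[OF that] R0(2)[OF that] \<rho> by (auto simp: R_def)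
  have sT: "s \<in> {0..T}" if "s \<in> ?I" for s using that ab by auto
  have sub: "?I \<subseteq> {0..T}" using ab by auto
  have Dh: "norm (D k s) \<le> h s" if s: "s \<in> ?I" for k s
  proof -
    have "\<bar>Lk (e k) s - Lk 0 s\<bar> \<le> (e k * M) * (c * (3 + 2 * (2 powr p * (\<bar>a s\<bar> powr p + 1))))"
      unfolding Lk_def using small[OF s, of k] e(3)[of k]
      by (simp, intro L_difference_bound[OF c sT[OF s] xr[OF s]]) auto
    then show ?thesis using e(1)[of k] by (simp add: D_def h_def abs_divide divide_le_eq mult_ac)
  qed
  have hint: "h integrable_on ?I"
    unfolding h_def by (intro integrable_on_mult_right integrable_add a(2)) auto
  have am: "a \<in> borel_measurable (lebesgue_on ?I)"
    by (rule absolutely_integrable_imp_borel_measurable[OF a(1)]) auto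
  have Lkint: "Lk e' integrable_on ?I" if e': "\<And>s. s \<in> ?I \<Longrightarrow> x s + e' * \<phi> s \<in> {0<..R}" "\<And>s. s \<in> ?I \<Longrightarrow> \<bar>e' * \<psi> s\<bar> \<le> 1" for e'
  proof (rule measurable_bounded_by_integrable_imp_integrable)
    show "Lk e' \<in> borel_measurable (lebesgue_on ?I)"
      unfolding Lk_def
    proof (rule measurable_along[OF L_continuous sub])
      show "(\<lambda>s. x s + e' * \<phi> s) \<in> borel_measurable (lebesgue_on ?I)"
        by (intro continuous_imp_measurable_on_sets_lebesgue continuous_intros x \<phi>) auto
      show "(\<lambda>s. a s + e' * \<psi> s) \<in> borel_measurable (lebesgue_on ?I)"
        using am \<psi> by measurable
      show "0 \<le> x s + e' * \<phi> s" if "s \<in> ?I" for s using e'(1)[OF that] by simp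
    qed auto
    show "(\<lambda>s. B * (2 powr p * (\<bar>a s\<bar> powr p + 1) + 1)) integrable_on ?I"
      by (intro integrable_on_mult_right integrable_add a(2)) auto
    fix s assume s: "s \<in> ?I"
    have "\<bar>Lk e' s\<bar> \<le> B * (\<bar>a s + e' * \<psi> s\<bar> powr p + 1)"
      unfolding Lk_def using e'(1)[OF s] by (intro B sT s) auto
    also have "\<dots> \<le> B * (2 powr p * (\<bar>a s\<bar> powr p + 1) + 1)"
    proof (intro mult_left_mono add_right_mono B)
      have "\<bar>a s + e' * \<psi> s\<bar> powr p \<le> (\<bar>a s\<bar> + 1) powr p" using p e'(2)[OF s] by (intro powr_mono2) auto
      then show "\<bar>a s + e' * \<psi> s\<bar> powr p \<le> 2 powr p * (\<bar>a s\<bar> powr p + 1)" using abs_plus_one_powr[of "a s"] by linarith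
    qed
    finally show "norm (Lk e' s) \<le> B * (2 powr p * (\<bar>a s\<bar> powr p + 1) + 1)" by simp
  qed auto
  have Lk0: "Lk 0 integrable_on ?I" using xr by (intro Lkint) auto
  have Lke: "Lk (e k) integrable_on ?I" for k
  proof (rule Lkint)
    fix s assume s: "s \<in> ?I"
    show "x s + e k * \<phi> s \<in> {0<..R}" by (rule xr(2)[OF s])
    show "\<bar>e k * \<psi> s\<bar> \<le> 1" using small(2)[OF s, of k] e(3)[of k] by linarith
  qed
  have Dint: "D k integrable_on ?I" for k
    unfolding D_def using integrable_diff[OF Lke[of k] Lk0] by (rule integrable_on_divide)
  have Dlim: "(\<lambda>k. D k s) \<longlonglongrightarrow> Lx i s (x s) (a s) * \<phi> s + La i s (x s) (a s) * \<psi> s" if s: "s \<in> ?I" for s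
  proof -
    have "x s > 0" using x(2)[OF s] \<rho> by simp
    have "((\<lambda>e. (Lk (0 + e) s - Lk 0 s) / e) \<longlongrightarrow> Lx i s (x s) (a s) * \<phi> s + La i s (x s) (a s) * \<psi> s) (at 0)"
      using L_directional_derivative[OF sT[OF s] \<open>x s > 0\<close>, of i "\<phi> s" "a s" "\<psi> s"]
      unfolding DERIV_def Lk_def by simp
    moreover have "filterlim e (at 0) sequentially"
      using elim e(1) by (intro filterlim_atI) (auto simp: less_imp_neq[symmetric] intro!: always_eventually dest: less_imp_neq)
    ultimately show ?thesis unfolding D_def by (auto dest: filterlim_compose)
  qed
  have Dpos: "integral ?I (D k) \<ge> 0" for k
  proof -
    have "integral ?I (D k) = (integral ?I (Lk (e k)) - integral ?I (Lk 0)) / e k"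
      unfolding D_def by (simp add: Henstock_Kurzweil_Integration.integral_diff Lke Lk0)
    moreover have "integral ?I (Lk 0) \<le> integral ?I (Lk (e k))"
      using min[OF e(1,2)[of k]] by (simp add: Lk_def)
    ultimately show ?thesis using e(1)[of k] by simp
  qed
  have "(\<lambda>k. integral ?I (D k)) \<longlonglongrightarrow> integral ?I (\<lambda>s. Lx i s (x s) (a s) * \<phi> s + La i s (x s) (a s) * \<psi> s)"
    by (rule dominated_convergence(2)[OF Dint hint Dh Dlim])
  then show ?thesis using Dpos by (intro LIMSEQ_le_const) auto
qed

end

section \<open>Minimisers and their momentum\<close>

context mfg_costs
begin

definition total_cost :: "(real \<Rightarrow> real^'n) \<Rightarrow> (real \<Rightarrow> real^'n) \<Rightarrow> real" where
  "total_cost y v = integral {0..T} (lagr y v) + final_cost G Gs (m T) (y T)"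

text \<open>Optimality is from time 0, which is what the equilibrium condition grants. Later
  comparisons are obtained by gluing the competitor to an initial piece of y.\<close>

definition optimal :: "(real \<Rightarrow> real^'n) \<Rightarrow> (real \<Rightarrow> real^'n) \<Rightarrow> bool" where
  "optimal y v \<longleftrightarrow> ac_path p 0 T y v \<and>
     (\<forall>z w. ac_path p 0 T z w \<longrightarrow> z 0 = y 0 \<longrightarrow> total_cost y v \<le> total_cost z w)"

text \<open>Since \<psi> has integral 0, its primitive vanishes at both ends, so the perturbed path
  leaves y at \<alpha> and returns to it at \<beta>. Starting point, final cost and running cost
  elsewhere are unchanged, and global minimality becomes an inequality over
  [\<alpha>, \<beta>].\<close>

lemma optimal_variation:
  assumes opt: "optimal y v" and ab: "0 \<le> \<alpha>" "\<alpha> < \<beta>" "\<beta> \<le> T" and \<rho>: "\<rho> > 0"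
    and edge: "\<And>s. s \<in> {\<alpha>..\<beta>} \<Longrightarrow> y s \<in> edge i" "\<And>s. s \<in> {\<alpha>..\<beta>} \<Longrightarrow> \<rho> \<le> norm (y s)"
    and \<psi>: "\<psi> absolutely_integrable_on {\<alpha>..\<beta>}" "integral {\<alpha>..\<beta>} \<psi> = 0" "\<And>s. s \<in> {\<alpha>..\<beta>} \<Longrightarrow> \<bar>\<psi> s\<bar> \<le> M"
    and \<phi>: "\<And>s. s \<in> {\<alpha>..\<beta>} \<Longrightarrow> \<bar>e * integral {\<alpha>..s} \<psi>\<bar> \<le> \<rho> / 2"
  shows "integral {\<alpha>..\<beta>} (\<lambda>s. L i (m s) (norm (y s)) (speed v s))
    \<le> integral {\<alpha>..\<beta>} (\<lambda>s. L i (m s) (norm (y s) + e * integral {\<alpha>..s} \<psi>) (speed v s + e * \<psi> s))"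
proof -
  let ?I = "{\<alpha>..\<beta>}"
  have y: "ac_path p 0 T y v" using opt by (simp add: optimal_def)
  \<comment> \<open>Extended by zero, the variation has a primitive on all of [0, T] that vanishes
    outside [\<alpha>, \<beta>], and the competitor is given by one formula.\<close>
  define \<Psi> where "\<Psi> = (\<lambda>s. if s \<in> ?I then \<psi> s else 0)"
  have \<Psi>I: "\<Psi> absolutely_integrable_on ?I"
    by (rule absolutely_integrable_spike[OF \<psi>(1), of "{}"]) (auto simp: \<Psi>_def)
  have \<Psi>T: "\<Psi> absolutely_integrable_on {0..T}"
    by (rule integral_outside_zero(1)[OF \<Psi>I]) (use ab in \<open>auto simp: \<Psi>_def\<close>)
  define \<Phi> where "\<Phi> = (\<lambda>s. integral {0..s} \<Psi>)"
  have \<Phi>1: "\<Phi> s = 0" if "s \<in> {0..\<alpha>}" for s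
  proof -
    have "integral {0..s} \<Psi> = integral {0..s} (\<lambda>_. 0)"
      using that by (intro integral_spike[of "{\<alpha>}"]) (auto simp: \<Psi>_def)
    then show ?thesis by (simp add: \<Phi>_def)
  qed
  have \<Phi>2: "\<Phi> s = integral {\<alpha>..s} \<psi>" if "s \<in> ?I" for s
  proof -
    have "\<Phi> s - \<Phi> \<alpha> = integral {\<alpha>..s} \<Psi>"
      unfolding \<Phi>_def using that ab by (intro integral_diff_subinterval[OF absint_imp_int[OF \<Psi>T]]) auto
    moreover have "integral {\<alpha>..s} \<Psi> = integral {\<alpha>..s} \<psi>"
      using that by (intro Henstock_Kurzweil_Integration.integral_cong) (auto simp: \<Psi>_def)
    ultimately show ?thesis using \<Phi>1[of \<alpha>] ab by simp
  qed
  have \<Phi>3: "\<Phi> s = 0" if "s \<in> {\<beta>..T}" for s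
  proof -
    have "\<Phi> s - \<Phi> \<beta> = integral {\<beta>..s} \<Psi>"
      unfolding \<Phi>_def using that ab by (intro integral_diff_subinterval[OF absint_imp_int[OF \<Psi>T]]) auto
    moreover have "integral {\<beta>..s} \<Psi> = integral {\<beta>..s} (\<lambda>_. 0)"
      using that by (intro integral_spike[of "{\<beta>}"]) (auto simp: \<Psi>_def)
    ultimately show ?thesis using \<Phi>2[of \<beta>] \<psi>(2) ab by simp
  qed
  define z where "z = (\<lambda>s. y s + (e * \<Phi> s) *\<^sub>R axis i 1)"
  define w where "w = (\<lambda>s. v s + (e * \<Psi> s) *\<^sub>R axis i 1)"
  have ei: "(\<lambda>s. (e * \<Psi> s) *\<^sub>R (axis i 1 :: real^'n)) absolutely_integrable_on {0..T}"
    by (intro absint_scaleR_continuous' continuous_intros set_integrable_mult_right \<Psi>T)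
  have wi: "w absolutely_integrable_on {0..T}"
    unfolding w_def by (intro set_integral_add ac_path_absint[OF y] ei)
  have M0: "M \<ge> 0" using \<psi>(3)[of \<alpha>] ab by auto
  have nw: "norm (w s) \<le> norm (v s) + \<bar>e\<bar> * M" for s
  proof -
    have "norm ((e * \<Psi> s) *\<^sub>R (axis i 1 :: real^'n)) = \<bar>e\<bar> * \<bar>\<Psi> s\<bar>" by (simp add: norm_axis_1 abs_mult)
    also have "\<dots> \<le> \<bar>e\<bar> * M" using \<psi>(3)[of s] M0 by (intro mult_left_mono) (auto simp: \<Psi>_def)
    finally show ?thesis unfolding w_def using norm_triangle_ineq[of "v s" "(e * \<Psi> s) *\<^sub>R axis i 1"] by linarith
  qed
  have z: "ac_path p 0 T z w"
  proof (rule ac_pathI[OF wi])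
    have wm: "w \<in> borel_measurable (lebesgue_on {0..T})"
      by (rule absolutely_integrable_imp_borel_measurable[OF wi]) auto
    show "(\<lambda>s. norm (w s) powr p) absolutely_integrable_on {0..T}"
    proof (rule measurable_bounded_by_integrable_imp_absolutely_integrable)
      show "(\<lambda>s. norm (w s) powr p) \<in> borel_measurable (lebesgue_on {0..T})" using wm by measurable
      show "(\<lambda>s. 2 powr p * (norm (v s) powr p + (\<bar>e\<bar> * M) powr p)) integrable_on {0..T}"
        by (intro integrable_on_mult_right integrable_add absint_imp_int ac_path_absint[OF y] absint_const)
      fix s
      have "norm (w s) powr p \<le> (norm (v s) + \<bar>e\<bar> * M) powr p" using nw p by (intro powr_mono2) auto
      also have "\<dots> \<le> 2 powr p * (norm (v s) powr p + (\<bar>e\<bar> * M) powr p)" using p M0 by (intro powr_add_le) auto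
      finally show "norm (norm (w s) powr p) \<le> 2 powr p * (norm (v s) powr p + (\<bar>e\<bar> * M) powr p)" by simp
    qed simp
    fix s assume s: "s \<in> {0..T}"
    have "integral {0..s} w = integral {0..s} v + integral {0..s} (\<lambda>s. (e * \<Psi> s) *\<^sub>R axis i 1)"
      unfolding w_def using s
      by (intro Henstock_Kurzweil_Integration.integral_add absint_imp_int absint_sub[OF ac_path_absint(1)[OF y]] absint_sub[OF ei]) auto
    also have "integral {0..s} (\<lambda>s. (e * \<Psi> s) *\<^sub>R (axis i 1 :: real^'n)) = (e * \<Phi> s) *\<^sub>R axis i 1"
    proof -
      have "\<Psi> integrable_on {0..s}" using s by (intro absint_imp_int absint_sub[OF \<Psi>T]) auto
      from integral_linear[OF this bounded_linear_compose[OF bounded_linear_scaleR_left[of "axis i 1 :: real^'n"] bounded_linear_mult_right[of e]]]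
      show ?thesis by (simp add: o_def \<Phi>_def)
    qed
    moreover have "z 0 = y 0" using \<Phi>1[of 0] ab by (simp add: z_def)
    moreover have "z s = y 0 + integral {0..s} v + (e * \<Phi> s) *\<^sub>R axis i 1"
      unfolding z_def using ac_path_eq[OF y s] by simp
    ultimately show "z s = z 0 + integral {0..s} w" by (simp only: add.assoc)
    show "z s \<in> junction"
    proof (cases "s \<in> ?I")
      case True
      have "z s = (norm (y s) + e * \<Phi> s) *\<^sub>R axis i 1"
        unfolding z_def by (subst edge_eq_norm[OF edge(1)[OF True]]) (simp add: scaleR_add_left)
      moreover have "norm (y s) + e * \<Phi> s \<ge> 0"
        using edge(2)[OF True] \<phi>[OF True] \<rho> unfolding \<Phi>2[OF True] by linarith
      ultimately show ?thesis using edge_line by metis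
    next
      case False
      then have "z s = y s" unfolding z_def using \<Phi>1[of s] \<Phi>3[of s] s by auto
      then show ?thesis using ac_path_in_junction[OF y s] by simp
    qed
  qed
  have zT: "z 0 = y 0" "z T = y T" unfolding z_def using \<Phi>1[of 0] \<Phi>3[of T] ab by auto
  have le: "integral {0..T} (lagr y v) \<le> integral {0..T} (lagr z w)"
    using opt z zT unfolding optimal_def total_cost_def by force
  have ly: "lagr y v integrable_on {0..T}" and lz: "lagr z w integrable_on {0..T}"
    by (intro absint_imp_int lagr_absint[OF y] lagr_absint[OF z]; simp)+
  have speedw: "speed w s = speed v s + e * \<Psi> s" for s
  proof -
    have "(\<Sum>j\<in>UNIV. (axis i 1 :: real^'n) $ j) = 1" by (simp add: axis_def)
    then show ?thesis unfolding speed_def w_def by (simp add: sum.distrib sum_distrib_left[symmetric])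
  qed
  have out: "lagr z w s = lagr y v s" if "s \<in> {0..T}" "s \<notin> ?I" for s
    using that \<Phi>1[of s] \<Phi>3[of s] by (auto simp: lagr_def speedw \<Psi>_def z_def)
  have "integral {0..\<alpha>} (lagr z w) = integral {0..\<alpha>} (lagr y v)"
    using ab by (intro integral_spike[of "{\<alpha>}"]) (auto simp: out)
  moreover have "integral {\<beta>..T} (lagr z w) = integral {\<beta>..T} (lagr y v)"
    using ab by (intro integral_spike[of "{\<beta>}"]) (auto simp: out)
  ultimately have "integral ?I (lagr y v) \<le> integral ?I (lagr z w)"
    using le integral_split3[OF ly, of \<alpha> \<beta>] integral_split3[OF lz, of \<alpha> \<beta>] ab by simp
  moreover have "integral ?I (lagr y v) = integral ?I (\<lambda>s. L i (m s) (norm (y s)) (speed v s))"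
  proof (intro Henstock_Kurzweil_Integration.integral_cong)
    fix s assume s: "s \<in> ?I"
    then show "lagr y v s = L i (m s) (norm (y s)) (speed v s)"
      using edge[OF s] \<rho> by (intro lagr_edge) auto
  qed
  moreover have "integral ?I (lagr z w) = integral ?I (\<lambda>s. L i (m s) (norm (y s) + e * integral {\<alpha>..s} \<psi>) (speed v s + e * \<psi> s))"
  proof (intro Henstock_Kurzweil_Integration.integral_cong)
    fix s assume s: "s \<in> ?I"
    have "z s = (norm (y s) + e * \<Phi> s) *\<^sub>R axis i 1"
      unfolding z_def by (subst edge_eq_norm[OF edge(1)[OF s]]) (simp add: scaleR_add_left)
    moreover have "norm (y s) + e * \<Phi> s > 0"
      using edge(2)[OF s] \<phi>[OF s] \<rho> unfolding \<Phi>2[OF s] by linarith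
    ultimately show "lagr z w s = L i (m s) (norm (y s) + e * integral {\<alpha>..s} \<psi>) (speed v s + e * \<psi> s)"
      using s by (simp add: lagr_def running_cost_edge speedw \<Psi>_def \<Phi>2)
  qed
  ultimately show ?thesis by simp
qed

lemma speed_powr_absint:
  fixes v :: "real \<Rightarrow> real^'n"
  assumes y: "ac_path p a b y v"
  shows "(\<lambda>s. \<bar>speed v s\<bar> powr p) absolutely_integrable_on {a..b}"
proof (rule measurable_bounded_by_integrable_imp_absolutely_integrable)
  have "speed v \<in> borel_measurable (lebesgue_on {a..b})"
    by (intro absolutely_integrable_imp_borel_measurable speed_absint ac_path_absint[OF y]) auto
  then show "(\<lambda>s. \<bar>speed v s\<bar> powr p) \<in> borel_measurable (lebesgue_on {a..b})" by measurable
  show "(\<lambda>s. real CARD('n) powr p * norm (v s) powr p) integrable_on {a..b}"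
    by (intro integrable_on_mult_right absint_imp_int ac_path_absint[OF y])
  fix s
  have "\<bar>speed v s\<bar> powr p \<le> (real CARD('n) * norm (v s)) powr p" using p speed_le[of v s] by (intro powr_mono2) auto
  then show "norm (\<bar>speed v s\<bar> powr p) \<le> real CARD('n) powr p * norm (v s) powr p" by (simp add: powr_mult)
qed simp

text \<open>The equation is obtained in the integrated form of du Bois-Reymond: the momentum minus
  the primitive of the force is orthogonal to all bounded functions of mean 0, hence constant almost
  everywhere. Neither the momentum nor the Lagrangian is ever differentiated in time.\<close>

lemma euler_lagrange:
  assumes opt: "optimal y v" and ab: "0 \<le> \<alpha>" "\<alpha> < \<beta>" "\<beta> \<le> T" and \<rho>: "\<rho> > 0"
    and edge: "\<And>s. s \<in> {\<alpha>..\<beta>} \<Longrightarrow> y s \<in> edge i" "\<And>s. s \<in> {\<alpha>..\<beta>} \<Longrightarrow> \<rho> \<le> norm (y s)"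
  shows "(\<lambda>s. Lx i s (norm (y s)) (speed v s)) absolutely_integrable_on {\<alpha>..\<beta>}"
    and "\<exists>c N. negligible N \<and> (\<forall>s\<in>{\<alpha>..\<beta>} - N. La i s (norm (y s)) (speed v s)
           = c + integral {\<alpha>..s} (\<lambda>r. Lx i r (norm (y r)) (speed v r)))"
proof -
  let ?I = "{\<alpha>..\<beta>}"
  define A where "A = (\<lambda>s. Lx i s (norm (y s)) (speed v s))"
  define P where "P = (\<lambda>s. La i s (norm (y s)) (speed v s))"
  have y0: "ac_path p 0 T y v" using opt by (simp add: optimal_def)
  have y: "ac_path p \<alpha> \<beta> y v" using ab by (intro ac_path_sub[OF y0]) auto
  have sub: "?I \<subseteq> {0..T}" using ab by auto
  have ncont: "continuous_on ?I (\<lambda>s. norm (y s))" by (intro continuous_intros ac_path_continuous[OF y])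
  have nm: "(\<lambda>s. norm (y s)) \<in> borel_measurable (lebesgue_on ?I)"
    by (rule continuous_imp_measurable_on_sets_lebesgue[OF ncont]) auto
  have sp: "speed v absolutely_integrable_on ?I" by (rule speed_absint[OF ac_path_absint(1)[OF y]])
  have sm: "speed v \<in> borel_measurable (lebesgue_on ?I)"
    by (rule absolutely_integrable_imp_borel_measurable[OF sp]) auto
  note spp = speed_powr_absint[OF y]
  have "bounded ((\<lambda>s. norm (y s)) ` ?I)" using ncont compact_Icc compact_continuous_image compact_imp_bounded by blast
  then obtain R where R: "R > 0" "\<And>s. s \<in> ?I \<Longrightarrow> norm (y s) \<le> R"
    unfolding bounded_pos by auto
  obtain c where c: "c \<ge> 0" "\<And>i s x a. s \<in> {0..T} \<Longrightarrow> x \<in> {0..R} \<Longrightarrow> \<bar>Lx i s x a\<bar> \<le> c * (\<bar>a\<bar> powr p + 1)"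
    "\<And>i s x a. s \<in> {0..T} \<Longrightarrow> x \<in> {0..R} \<Longrightarrow> \<bar>La i s x a\<bar> \<le> c * (\<bar>a\<bar> powr (p - 1) + 1)"
    using deriv_bound[OF R(1)] by metis
  have in_rng: "s \<in> {0..T}" "norm (y s) \<in> {0..R}" if "s \<in> ?I" for s using that sub R(2) by auto
  show A: "A absolutely_integrable_on ?I"
  proof (rule measurable_bounded_by_integrable_imp_absolutely_integrable)
    show "A \<in> borel_measurable (lebesgue_on ?I)"
      unfolding A_def by (rule measurable_along[OF Lx_continuous sub _ nm _ sm]) auto
    show "(\<lambda>s. c * (\<bar>speed v s\<bar> powr p + 1)) integrable_on ?I"
      by (intro integrable_on_mult_right integrable_add absint_imp_int spp absint_const)
    show "norm (A s) \<le> c * (\<bar>speed v s\<bar> powr p + 1)" if "s \<in> ?I" for s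
      using c(2)[OF in_rng[OF that], of i "speed v s"] by (simp add: A_def)
  qed simp
  have P: "P absolutely_integrable_on ?I"
  proof (rule measurable_bounded_by_integrable_imp_absolutely_integrable)
    show "P \<in> borel_measurable (lebesgue_on ?I)"
      unfolding P_def by (rule measurable_along[OF La_continuous sub _ nm _ sm]) auto
    show "(\<lambda>s. c * (1 + \<bar>speed v s\<bar> powr p + 1)) integrable_on ?I"
      by (intro integrable_on_mult_right integrable_add absint_imp_int spp absint_const)
    fix s assume s: "s \<in> ?I"
    have "\<bar>P s\<bar> \<le> c * (\<bar>speed v s\<bar> powr (p - 1) + 1)" unfolding P_def by (intro c(3) in_rng s)
    also have "\<dots> \<le> c * (1 + \<bar>speed v s\<bar> powr p + 1)"
      using c(1) abs_powr_bounds(3) by (intro mult_left_mono) auto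
    finally show "norm (P s) \<le> c * (1 + \<bar>speed v s\<bar> powr p + 1)" by simp
  qed simp
  define Q where "Q = (\<lambda>s. integral {\<alpha>..s} A)"
  have Qc: "continuous_on ?I Q" unfolding Q_def by (rule indefinite_integral_continuous_1[OF absint_imp_int[OF A]])
  have pos: "0 \<le> integral ?I (\<lambda>s. A s * integral {\<alpha>..s} \<psi> + P s * \<psi> s)"
    if \<psi>: "\<psi> \<in> borel_measurable (lebesgue_on ?I)" "\<And>s. s \<in> ?I \<Longrightarrow> \<bar>\<psi> s\<bar> \<le> M" "integral ?I \<psi> = 0" for \<psi> and M :: real
  proof -
    have \<psi>i: "\<psi> absolutely_integrable_on ?I"
      using \<psi> by (intro measurable_bounded_by_integrable_imp_absolutely_integrable[OF \<psi>(1), of "\<lambda>_. M"]) auto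
    have M0: "M \<ge> 0" using \<psi>(2)[of \<alpha>] ab by auto
    \<comment> \<open>One constant has to dominate both \<psi> and its primitive; the summand 1
      makes it positive.\<close>
    define M' where "M' = M * (\<beta> - \<alpha>) + M + 1"
    have M': "M' > 0" "M \<le> M'" using M0 ab by (auto simp: M'_def add_nonneg_pos)
    have \<phi>b: "\<bar>integral {\<alpha>..s} \<psi>\<bar> \<le> M'" if s: "s \<in> ?I" for s
    proof -
      have "norm (integral {\<alpha>..s} \<psi>) \<le> integral {\<alpha>..s} (\<lambda>_. M)"
        using \<psi>(2) s by (intro integral_norm_bound_integral absint_imp_int absint_sub[OF \<psi>i] absint_const) auto
      also have "\<dots> = M * (s - \<alpha>)" using s by simp
      also have "\<dots> \<le> M * (\<beta> - \<alpha>)" using s M0 by (intro mult_left_mono) auto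
      finally show ?thesis using M0 by (simp add: M'_def)
    qed
    show ?thesis unfolding A_def P_def
    proof (rule first_variation_nonneg[OF ab(1,3) \<rho> ncont edge(2) sp absint_imp_int[OF spp] _ \<psi>(1) M'(1) \<phi>b])
      show "continuous_on ?I (\<lambda>s. integral {\<alpha>..s} \<psi>)" by (rule indefinite_integral_continuous_1[OF absint_imp_int[OF \<psi>i]])
      show "\<bar>\<psi> s\<bar> \<le> M'" if "s \<in> ?I" for s using \<psi>(2)[OF that] M' by simp
      fix e :: real assume e: "0 < e" "e * M' \<le> \<rho> / 2"
      show "integral ?I (\<lambda>s. L i (m s) (norm (y s)) (speed v s))
        \<le> integral ?I (\<lambda>s. L i (m s) (norm (y s) + e * integral {\<alpha>..s} \<psi>) (speed v s + e * \<psi> s))"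
      proof (rule optimal_variation[OF opt ab \<rho> edge \<psi>i \<psi>(3) \<psi>(2)])
        fix s assume s: "s \<in> ?I"
        have "\<bar>e * integral {\<alpha>..s} \<psi>\<bar> \<le> e * M'" using \<phi>b[OF s] e(1) by (simp add: abs_mult)
        then show "\<bar>e * integral {\<alpha>..s} \<psi>\<bar> \<le> \<rho> / 2" using e(2) by linarith
      qed
    qed
  qed
  have "\<exists>c N. negligible N \<and> (\<forall>s\<in>?I - N. P s - Q s = c)"
  proof (rule constant_if_orthogonal_to_mean_zero[OF ab(2)])
    show "(\<lambda>s. P s - Q s) absolutely_integrable_on ?I"
      by (intro set_integral_diff P absolutely_integrable_continuous_real Qc)
    fix \<psi> :: "real \<Rightarrow> real" and M :: real assume \<psi>: "\<psi> \<in> borel_measurable (lebesgue_on ?I)" "\<And>s. s \<in> ?I \<Longrightarrow> \<bar>\<psi> s\<bar> \<le> M" "integral ?I \<psi> = 0"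
    have \<psi>i: "\<psi> absolutely_integrable_on ?I"
      using \<psi> by (intro measurable_bounded_by_integrable_imp_absolutely_integrable[OF \<psi>(1), of "\<lambda>_. M"]) auto
    have bou: "bounded (\<psi> ` ?I)" unfolding bounded_iff using \<psi>(2) by (intro exI[of _ M]) auto
    define \<phi> where "\<phi> = (\<lambda>s. integral {\<alpha>..s} \<psi>)"
    have \<phi>c: "continuous_on ?I \<phi>" unfolding \<phi>_def by (rule indefinite_integral_continuous_1[OF absint_imp_int[OF \<psi>i]])
    have A\<phi>: "(\<lambda>s. A s * \<phi> s) absolutely_integrable_on ?I"
      using absint_scaleR_continuous[OF \<phi>c A] by (simp add: mult.commute)
    have P\<psi>: "(\<lambda>s. P s * \<psi> s) absolutely_integrable_on ?I"
      using absolutely_integrable_bounded_measurable_product_real[OF \<psi>(1) _ bou P] by (simp add: mult.commute)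
    have Q\<psi>: "(\<lambda>s. Q s * \<psi> s) absolutely_integrable_on ?I"
      using absint_scaleR_continuous[OF Qc \<psi>i] by simp
    have "0 \<le> integral ?I (\<lambda>s. A s * \<phi> s + P s * \<psi> s)" unfolding \<phi>_def by (rule pos[OF \<psi>])
    \<comment> \<open>The one-sided first variation, applied to -\<psi> as well, becomes an
      equality.\<close>
    moreover have "0 \<le> integral ?I (\<lambda>s. A s * integral {\<alpha>..s} (\<lambda>r. - \<psi> r) + P s * - \<psi> s)"
      using \<psi> by (intro pos[of _ M]) auto
    moreover have "(\<lambda>s. A s * integral {\<alpha>..s} (\<lambda>r. - \<psi> r) + P s * - \<psi> s) = (\<lambda>s. - (A s * \<phi> s + P s * \<psi> s))"
      by (simp add: \<phi>_def)
    moreover have "integral ?I (\<lambda>s. - (A s * \<phi> s + P s * \<psi> s)) = - integral ?I (\<lambda>s. A s * \<phi> s + P s * \<psi> s)"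
      by (rule Henstock_Kurzweil_Integration.integral_neg)
    ultimately have "integral ?I (\<lambda>s. A s * \<phi> s + P s * \<psi> s) = 0" by (simp only: order_antisym neg_0_le_iff_le)
    \<comment> \<open>The boundary term of the integration by parts vanishes as \<psi> has integral
      0; subtracting this trades A \<phi> for -Q \<psi>.\<close>
    moreover have "integral ?I (\<lambda>s. Q s * \<psi> s + A s * \<phi> s) = 0"
      using integral_by_parts_indefinite[OF A \<psi>i] ab \<psi>(3) by (simp add: Q_def \<phi>_def)
    moreover have "integral ?I (\<lambda>s. (P s - Q s) * \<psi> s) = integral ?I (\<lambda>s. (A s * \<phi> s + P s * \<psi> s) - (Q s * \<psi> s + A s * \<phi> s))"
      by (simp add: algebra_simps)
    moreover have "\<dots> = integral ?I (\<lambda>s. A s * \<phi> s + P s * \<psi> s) - integral ?I (\<lambda>s. Q s * \<psi> s + A s * \<phi> s)"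
      by (intro Henstock_Kurzweil_Integration.integral_diff integrable_add absint_imp_int A\<phi> P\<psi> Q\<psi>)
    ultimately show "integral ?I (\<lambda>s. (P s - Q s) * \<psi> s) = 0" by simp
  qed
  then obtain c N where "negligible N" "\<And>s. s \<in> ?I - N \<Longrightarrow> P s - Q s = c" by blast
  then have "\<forall>s\<in>?I - N. P s = c + Q s" by (metis diff_add_cancel)
  with \<open>negligible N\<close> show "\<exists>c N. negligible N \<and> (\<forall>s\<in>?I - N. La i s (norm (y s)) (speed v s)
           = c + integral {\<alpha>..s} (\<lambda>r. Lx i r (norm (y r)) (speed v r)))"
    unfolding P_def Q_def A_def by blast
qed

end

section \<open>Uniform regularity of optimal velocities\<close>

context mfg_costs
begin

text \<open>Bounds pass from the energy to the momentum and back to the velocity. B1 bounds the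
  primitive of the force by the energy; B2 bounds the constant of motion by averaging momentum and
  primitive over the interval; so B3 bounds the momentum. Convexity and coercivity then bound the
  velocity. Only B and the growth constants enter K, which makes it the same for all y.\<close>

lemma optimal_velocity_bound:
  assumes ab: "0 \<le> \<alpha>" "\<alpha> < \<beta>" "\<beta> \<le> T" and \<rho>: "0 < \<rho>" "\<rho> \<le> R" and B: "B \<ge> 0"
  shows "\<exists>K>0. \<forall>y v. optimal y v \<longrightarrow> (\<forall>s\<in>{\<alpha>..\<beta>}. y s \<in> edge i \<and> \<rho> \<le> norm (y s) \<and> norm (y s) \<le> R) \<longrightarrow>
      integral {\<alpha>..\<beta>} (\<lambda>s. \<bar>speed v s\<bar> powr p) \<le> B \<longrightarrow>
      (\<exists>c N. negligible N \<and> (\<forall>s\<in>{\<alpha>..\<beta>} - N. \<bar>speed v s\<bar> \<le> K \<and>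
        La i s (norm (y s)) (speed v s) = c + integral {\<alpha>..s} (\<lambda>r. Lx i r (norm (y r)) (speed v r))))"
proof -
  let ?I = "{\<alpha>..\<beta>}"
  have "R > 0" using \<rho> by simp
  obtain c0 where c0: "c0 \<ge> 0" "\<And>i s x a. s \<in> {0..T} \<Longrightarrow> x \<in> {0..R} \<Longrightarrow> \<bar>Lx i s x a\<bar> \<le> c0 * (\<bar>a\<bar> powr p + 1)"
    "\<And>i s x a. s \<in> {0..T} \<Longrightarrow> x \<in> {0..R} \<Longrightarrow> \<bar>La i s x a\<bar> \<le> c0 * (\<bar>a\<bar> powr (p - 1) + 1)"
    using deriv_bound[OF \<open>R > 0\<close>] by metis
  obtain C0 where C0: "C0 > 0" "\<And>i s x a. s \<in> {0..T} \<Longrightarrow> x \<ge> 0 \<Longrightarrow> L i (m s) x a \<ge> C0 * (\<bar>a\<bar> powr p - 1)"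
    using L_lower_bound by metis
  obtain B0 where B0: "B0 \<ge> 0" "\<And>i s x a. s \<in> {0..T} \<Longrightarrow> x \<in> {0..R} \<Longrightarrow> \<bar>L i (m s) x a\<bar> \<le> B0 * (\<bar>a\<bar> powr p + 1)"
    using L_upper_bound[OF \<open>R > 0\<close>] by metis
  define B1 where "B1 = c0 * (B + (\<beta> - \<alpha>))"
  define B2 where "B2 = (c0 * (B + 2 * (\<beta> - \<alpha>)) + B1 * (\<beta> - \<alpha>)) / (\<beta> - \<alpha>)"
  define B3 where "B3 = B2 + B1"
  \<comment> \<open>The value for which the inequality between momentum and velocity yields |a|^(p -
    1) \<le> q whenever |a| > 1; K is solved from it.\<close>
  define q where "q = (B3 + C0 + B0) / C0"
  define K where "K = max 1 (q powr (1 / (p - 1)))"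
  have B1: "B1 \<ge> 0" unfolding B1_def using c0 B ab by simp
  have B2: "B2 \<ge> 0" unfolding B2_def using c0 B ab B1 by (intro divide_nonneg_pos add_nonneg_nonneg mult_nonneg_nonneg) auto
  show ?thesis
  proof (rule exI[of _ K], intro conjI allI impI)
    show "K > 0" by (simp add: K_def)
    fix y v assume opt: "optimal y v" and edge': "\<forall>s\<in>?I. y s \<in> edge i \<and> \<rho> \<le> norm (y s) \<and> norm (y s) \<le> R"
      and le: "integral ?I (\<lambda>s. \<bar>speed v s\<bar> powr p) \<le> B"
    have edge: "y s \<in> edge i \<and> \<rho> \<le> norm (y s) \<and> norm (y s) \<le> R" if "s \<in> ?I" for s
      using edge' that by blast
    define A where "A = (\<lambda>s. Lx i s (norm (y s)) (speed v s))"
    define P where "P = (\<lambda>s. La i s (norm (y s)) (speed v s))"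
    define Q where "Q = (\<lambda>s. integral {\<alpha>..s} A)"
    have y0: "ac_path p 0 T y v" using opt by (simp add: optimal_def)
    have y: "ac_path p \<alpha> \<beta> y v" using ab by (intro ac_path_sub[OF y0]) auto
    note spp = speed_powr_absint[OF y]
    have spc: "integral ?I (\<lambda>r. \<bar>speed v r\<bar> powr p + k) = integral ?I (\<lambda>r. \<bar>speed v r\<bar> powr p) + k * (\<beta> - \<alpha>)" for k
      using ab Henstock_Kurzweil_Integration.integral_add[OF absint_imp_int[OF spp] absint_imp_int[OF absint_const], of k]
      by (simp add: mult.commute)
    have rng: "s \<in> {0..T}" "norm (y s) \<in> {0..R}" "norm (y s) \<ge> 0" if "s \<in> ?I" for s
      using that ab edge[OF that] by auto
    have A: "A absolutely_integrable_on ?I"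
      unfolding A_def by (rule euler_lagrange(1)[OF opt ab \<rho>(1)]) (use edge in auto)
    have "\<exists>c N. negligible N \<and> (\<forall>s\<in>?I - N. P s = c + Q s)"
      unfolding P_def Q_def A_def by (rule euler_lagrange(2)[OF opt ab \<rho>(1)]) (use edge in auto)
    then obtain c N where N: "negligible N" "\<And>s. s \<in> ?I - N \<Longrightarrow> P s = c + Q s"
      by blast
    have Q: "\<bar>Q s\<bar> \<le> B1" if s: "s \<in> ?I" for s
    proof -
      have "norm (Q s) \<le> integral {\<alpha>..s} (\<lambda>r. c0 * (\<bar>speed v r\<bar> powr p + 1))"
        unfolding Q_def
      proof (rule integral_norm_bound_integral)
        show "A integrable_on {\<alpha>..s}" using s by (intro absint_imp_int absint_sub[OF A]) auto
        show "(\<lambda>r. c0 * (\<bar>speed v r\<bar> powr p + 1)) integrable_on {\<alpha>..s}"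
          using s by (intro integrable_on_mult_right integrable_add absint_imp_int absint_sub[OF spp] absint_const) auto
        show "norm (A r) \<le> c0 * (\<bar>speed v r\<bar> powr p + 1)" if "r \<in> {\<alpha>..s}" for r
          using c0(2)[OF rng(1,2)[of r], of i "speed v r"] that s by (simp add: A_def)
      qed
      also have "\<dots> \<le> integral ?I (\<lambda>r. c0 * (\<bar>speed v r\<bar> powr p + 1))"
        using s c0(1) by (intro integral_subset_le integrable_on_mult_right integrable_add absint_imp_int absint_sub[OF spp] absint_const) auto
      also have "\<dots> = c0 * (integral ?I (\<lambda>r. \<bar>speed v r\<bar> powr p) + (\<beta> - \<alpha>))"
        using ab spc[of 1] by simp
      also have "\<dots> \<le> B1" unfolding B1_def using le c0(1) by (intro mult_left_mono) auto
      finally show ?thesis by simp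
    qed
    have cb: "\<bar>c\<bar> \<le> B2"
    proof -
      define g where "g = (\<lambda>s. c0 * (\<bar>speed v s\<bar> powr p + 2) + B1)"
      \<comment> \<open>Redefined on the null set, so that the almost everywhere bound holds
        pointwise and integrals may be compared.\<close>
      define g' where "g' = (\<lambda>s. if s \<in> N then \<bar>c\<bar> else g s)"
      have g: "g integrable_on ?I" unfolding g_def
        by (intro integrable_on_mult_right integrable_add absint_imp_int spp absint_const)
      have g': "g' integrable_on ?I" by (rule integrable_spike[OF g N(1)]) (simp add: g'_def)
      have "\<bar>c\<bar> \<le> g' s" if s: "s \<in> ?I" for s
      proof (cases "s \<in> N")
        case False
        have "\<bar>c\<bar> \<le> \<bar>P s\<bar> + \<bar>Q s\<bar>" using N(2)[of s] s False by simp
        also have "\<bar>P s\<bar> \<le> c0 * (\<bar>speed v s\<bar> powr (p - 1) + 1)" unfolding P_def by (intro c0(3) rng s)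
        also have "\<dots> \<le> c0 * (\<bar>speed v s\<bar> powr p + 2)"
          using abs_powr_bounds(3)[of "speed v s"] c0(1) by (intro mult_left_mono) auto
        finally show ?thesis using Q[OF s] False by (simp add: g'_def g_def)
      qed (simp add: g'_def)
      then have "integral ?I (\<lambda>_. \<bar>c\<bar>) \<le> integral ?I g'"
        by (intro Henstock_Kurzweil_Integration.integral_le g' absint_imp_int absint_const) auto
      also have "integral ?I g' = integral ?I g" by (rule integral_spike[OF N(1)]) (simp add: g'_def)
      also have "\<dots> = c0 * (integral ?I (\<lambda>r. \<bar>speed v r\<bar> powr p) + 2 * (\<beta> - \<alpha>)) + B1 * (\<beta> - \<alpha>)"
      proof -
        have "integral ?I g = integral ?I (\<lambda>s. c0 * (\<bar>speed v s\<bar> powr p + 2)) + integral ?I (\<lambda>_. B1)"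
          unfolding g_def by (intro Henstock_Kurzweil_Integration.integral_add integrable_on_mult_right integrable_add absint_imp_int spp absint_const)
        then show ?thesis using ab spc[of 2] by simp
      qed
      also have "\<dots> \<le> c0 * (B + 2 * (\<beta> - \<alpha>)) + B1 * (\<beta> - \<alpha>)"
        using le c0(1) by (intro add_right_mono mult_left_mono) auto
      finally show ?thesis unfolding B2_def using ab by (simp add: pos_le_divide_eq mult.commute)
    qed
    have "\<bar>speed v s\<bar> \<le> K" if s: "s \<in> ?I - N" for s
    proof (rule ccontr)
      define a where "a = speed v s"
      assume "\<not> \<bar>speed v s\<bar> \<le> K"
      then have a: "\<bar>a\<bar> > 1" "\<bar>a\<bar> > q powr (1 / (p - 1))" by (auto simp: a_def K_def)
      have sI: "s \<in> ?I" using s by simp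
      have Pb: "\<bar>P s\<bar> \<le> B3" using N(2)[OF s] cb Q[OF sI] by (simp add: B3_def)
      \<comment> \<open>The tangent at a, evaluated at velocity 0: coercivity makes L at a of order
        |a|^p, while the momentum term is of order |a| only.\<close>
      have "L i (m s) (norm (y s)) 0 \<ge> L i (m s) (norm (y s)) a + P s * (0 - a)"
        unfolding P_def a_def by (intro L_tangent rng sI)
      moreover have "L i (m s) (norm (y s)) 0 \<le> B0"
        using B0(2)[OF rng(1,2)[OF sI], of i 0] p by simp
      moreover have "L i (m s) (norm (y s)) a \<ge> C0 * (\<bar>a\<bar> powr p - 1)"
        by (intro C0 rng sI)
      ultimately have "C0 * (\<bar>a\<bar> powr p - 1) \<le> B0 + P s * a" by simp
      also have "P s * a \<le> B3 * \<bar>a\<bar>"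
      proof -
        have "P s * a \<le> \<bar>P s\<bar> * \<bar>a\<bar>" by (metis abs_ge_self abs_mult)
        also have "\<dots> \<le> B3 * \<bar>a\<bar>" using Pb by (intro mult_right_mono) auto
        finally show ?thesis .
      qed
      finally have "C0 * \<bar>a\<bar> powr p \<le> (B0 + C0) * 1 + B3 * \<bar>a\<bar>" by (simp add: algebra_simps)
      also have "\<dots> \<le> (B0 + C0) * \<bar>a\<bar> + B3 * \<bar>a\<bar>" using a B0(1) C0(1) by (intro add_right_mono mult_left_mono) auto
      also have "\<bar>a\<bar> powr p = \<bar>a\<bar> powr (p - 1) * \<bar>a\<bar>" by (rule abs_powr_bounds(1)[symmetric])
      finally have "(C0 * \<bar>a\<bar> powr (p - 1)) * \<bar>a\<bar> \<le> (B3 + C0 + B0) * \<bar>a\<bar>" by (simp add: algebra_simps)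
      then have "C0 * \<bar>a\<bar> powr (p - 1) \<le> B3 + C0 + B0" using a by (simp add: mult_le_cancel_right)
      then have "\<bar>a\<bar> powr (p - 1) \<le> q" using C0(1) by (simp add: q_def field_simps)
      moreover have "q > 0" unfolding q_def B3_def using B1 B2 B0(1) C0(1) by (intro divide_pos_pos) auto
      moreover have "q = (q powr (1 / (p - 1))) powr (p - 1)" using \<open>q > 0\<close> p by (simp add: powr_powr)
      moreover have "(q powr (1 / (p - 1))) powr (p - 1) < \<bar>a\<bar> powr (p - 1)"
        using a p by (intro powr_less_mono2) auto
      ultimately show False by linarith
    qed
    then have "\<forall>s\<in>?I - N. \<bar>speed v s\<bar> \<le> K \<and> P s = c + Q s" using N(2) by blast
    then show "\<exists>c N. negligible N \<and> (\<forall>s\<in>?I - N. \<bar>speed v s\<bar> \<le> K \<and>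
        La i s (norm (y s)) (speed v s) = c + integral {\<alpha>..s} (\<lambda>r. Lx i r (norm (y r)) (speed v r)))"
      unfolding P_def Q_def A_def using N(1) by blast
  qed
qed

text \<open>Strict monotonicity made quantitative: on a compact set of quadruples the positive
  continuous difference attains its minimum. It stands in for uniform convexity.\<close>

lemma La_gap:
  assumes "0 \<le> \<rho>" "\<epsilon> > 0"
  shows "\<exists>\<kappa>>0. \<forall>s\<in>{0..T}. \<forall>x\<in>{\<rho>..R}. \<forall>a\<in>{-K..K}. \<forall>b\<in>{-K..K}. b \<ge> a + \<epsilon> \<longrightarrow> La i s x b - La i s x a \<ge> \<kappa>"
proof -
  define Z where "Z = {(s, x, a, b). s \<in> {0..T} \<and> x \<in> {\<rho>..R} \<and> a \<in> {-K..K} \<and> b \<in> {-K..K} \<and> b \<ge> a + \<epsilon>}"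
  define f where "f = (\<lambda>(s, x, a, b). La i s x b - La i s x a)"
  show ?thesis
  proof (cases "Z = {}")
    case True
    have "La i s x b - La i s x a \<ge> 1" if "s \<in> {0..T}" "x \<in> {\<rho>..R}" "a \<in> {-K..K}" "b \<in> {-K..K}" "b \<ge> a + \<epsilon>" for s x a b
    proof -
      have "(s, x, a, b) \<in> Z" using that by (simp add: Z_def)
      then show ?thesis unfolding True by simp
    qed
    then show ?thesis by (intro exI[of _ 1]) auto
  next
    case False
    have "Z = ({0..T} \<times> {\<rho>..R} \<times> {-K..K} \<times> {-K..K}) \<inter> {q. snd (snd (snd q)) \<ge> fst (snd (snd q)) + \<epsilon>}"
      by (auto simp: Z_def)
    moreover have "compact \<dots>"
      by (intro compact_Int_closed compact_Times closed_Collect_le continuous_intros) auto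
    ultimately have "compact Z" by simp
    moreover have "continuous_on Z f"
    proof -
      have 1: "continuous_on Z (\<lambda>q. (\<lambda>(s, x, a). La i s x a) (fst q, fst (snd q), snd (snd (snd q))))"
      proof (rule continuous_on_compose2[OF La_continuous])
        show "(\<lambda>q. (fst q, fst (snd q), snd (snd (snd q)))) ` Z \<subseteq> {0..T} \<times> {0..} \<times> UNIV"
          unfolding Z_def using assms(1) by force
      qed (intro continuous_intros)
      have 2: "continuous_on Z (\<lambda>q. (\<lambda>(s, x, a). La i s x a) (fst q, fst (snd q), fst (snd (snd q))))"
      proof (rule continuous_on_compose2[OF La_continuous])
        show "(\<lambda>q. (fst q, fst (snd q), fst (snd (snd q)))) ` Z \<subseteq> {0..T} \<times> {0..} \<times> UNIV"
          unfolding Z_def using assms(1) by force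
      qed (intro continuous_intros)
      show ?thesis using continuous_on_diff[OF 1 2] by (simp add: f_def case_prod_unfold)
    qed
    ultimately obtain z where z: "z \<in> Z" "\<And>z'. z' \<in> Z \<Longrightarrow> f z \<le> f z'"
      using continuous_attains_inf[of Z f] False by blast
    have "f z > 0"
    proof -
      obtain s x a b where zz: "z = (s, x, a, b)" by (metis surj_pair)
      then have "La i s x a < La i s x b" using z(1) assms by (intro La_strict_mono) (auto simp: Z_def)
      then show ?thesis by (simp add: f_def zz)
    qed
    moreover have "La i s x b - La i s x a \<ge> f z"
      if "s \<in> {0..T}" "x \<in> {\<rho>..R}" "a \<in> {-K..K}" "b \<in> {-K..K}" "b \<ge> a + \<epsilon>" for s x a b
      using z(2)[of "(s, x, a, b)"] that by (auto simp: Z_def f_def)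
    ultimately show ?thesis by blast
  qed
qed

text \<open>With bounded velocities the force is bounded, so the momentum is Lipschitz in time off a
  null set. If velocities at nearby times differed by more than \<epsilon>, their momenta at a
  common time and position would differ by at least \<kappa>, whereas the drift of the momentum and
  the change of time and position account for less than \<kappa> / 2 each. The modulus \<eta> is
  fixed before y, which the passage to a common velocity relies on.\<close>

lemma optimal_velocity_modulus:
  assumes ab: "0 \<le> \<alpha>" "\<alpha> < \<beta>" "\<beta> \<le> T" and \<rho>: "0 < \<rho>" "\<rho> \<le> R" and B: "B \<ge> 0"
  shows "\<exists>K>0. \<exists>\<eta>. (\<forall>\<epsilon>>0. \<eta> \<epsilon> > 0) \<and>
    (\<forall>y v. optimal y v \<longrightarrow> (\<forall>s\<in>{\<alpha>..\<beta>}. y s \<in> edge i \<and> \<rho> \<le> norm (y s) \<and> norm (y s) \<le> R) \<longrightarrow>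
      integral {\<alpha>..\<beta>} (\<lambda>s. \<bar>speed v s\<bar> powr p) \<le> B \<longrightarrow>
      (\<exists>N. negligible N \<and> (\<forall>s\<in>{\<alpha>..\<beta>} - N. \<bar>speed v s\<bar> \<le> K) \<and>
        (\<forall>\<epsilon>>0. \<forall>s\<in>{\<alpha>..\<beta>} - N. \<forall>s'\<in>{\<alpha>..\<beta>} - N. \<bar>s - s'\<bar> < \<eta> \<epsilon> \<longrightarrow> \<bar>speed v s - speed v s'\<bar> \<le> \<epsilon>)))"
proof -
  let ?I = "{\<alpha>..\<beta>}"
  obtain K where K: "K > 0" "\<forall>y v. optimal y v \<longrightarrow> (\<forall>s\<in>?I. y s \<in> edge i \<and> \<rho> \<le> norm (y s) \<and> norm (y s) \<le> R) \<longrightarrow>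
      integral ?I (\<lambda>s. \<bar>speed v s\<bar> powr p) \<le> B \<longrightarrow>
      (\<exists>c N. negligible N \<and> (\<forall>s\<in>?I - N. \<bar>speed v s\<bar> \<le> K \<and>
        La i s (norm (y s)) (speed v s) = c + integral {\<alpha>..s} (\<lambda>r. Lx i r (norm (y r)) (speed v r))))"
    using optimal_velocity_bound[OF ab \<rho> B, of i] by (elim exE conjE)
  have "R > 0" using \<rho> by simp
  obtain c0 where c0: "c0 \<ge> 0" "\<And>i s x a. s \<in> {0..T} \<Longrightarrow> x \<in> {0..R} \<Longrightarrow> \<bar>Lx i s x a\<bar> \<le> c0 * (\<bar>a\<bar> powr p + 1)"
    using deriv_bound[OF \<open>R > 0\<close>] by metis
  define M1 where "M1 = c0 * (K powr p + 1)"
  have M1: "M1 \<ge> 0" unfolding M1_def using c0(1) by simp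
  define D where "D = ?I \<times> {\<rho>..R} \<times> {-K..K}"
  have "compact D" unfolding D_def by (intro compact_Times) auto
  moreover have "continuous_on D (\<lambda>(s, x, a). La i s x a)"
    by (rule continuous_on_subset[OF La_continuous]) (use ab \<rho> in \<open>auto simp: D_def\<close>)
  ultimately have uc: "uniformly_continuous_on D (\<lambda>(s, x, a). La i s x a)"
    by (rule compact_uniformly_continuous[rotated])
  \<comment> \<open>Quantifies over all minimisers at once, so that the \<eta> selected for
    \<epsilon> does not depend on them.\<close>
  define Prop where "Prop = (\<lambda>\<epsilon> \<eta>. \<forall>y v c N. optimal y v \<longrightarrow> (\<forall>s\<in>?I. y s \<in> edge i \<and> \<rho> \<le> norm (y s) \<and> norm (y s) \<le> R) \<longrightarrow> negligible N \<longrightarrow>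
      (\<forall>s\<in>?I - N. \<bar>speed v s\<bar> \<le> K \<and>
        La i s (norm (y s)) (speed v s) = c + integral {\<alpha>..s} (\<lambda>r. Lx i r (norm (y r)) (speed v r))) \<longrightarrow>
      (\<forall>s\<in>?I - N. \<forall>s'\<in>?I - N. s \<le> s' \<longrightarrow> \<bar>s - s'\<bar> < \<eta> \<longrightarrow> \<bar>speed v s - speed v s'\<bar> \<le> \<epsilon>))"
  have ex: "\<exists>\<eta>. \<eta> > 0 \<and> Prop \<epsilon> \<eta>" if \<epsilon>: "\<epsilon> > 0" for \<epsilon>
  proof -
    obtain \<kappa> where \<kappa>: "\<kappa> > 0" "\<And>s x a b. s \<in> {0..T} \<Longrightarrow> x \<in> {\<rho>..R} \<Longrightarrow> a \<in> {-K..K} \<Longrightarrow> b \<in> {-K..K} \<Longrightarrow> b \<ge> a + \<epsilon> \<Longrightarrow>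
       La i s x b - La i s x a \<ge> \<kappa>"
      using La_gap[of \<rho> \<epsilon> R K i, OF less_imp_le[OF \<rho>(1)] \<epsilon>] by blast
    obtain d where d: "d > 0" "\<And>q q'. q \<in> D \<Longrightarrow> q' \<in> D \<Longrightarrow> dist q' q < d \<Longrightarrow>
        dist ((\<lambda>(s, x, a). La i s x a) q') ((\<lambda>(s, x, a). La i s x a) q) < \<kappa> / 2"
      using uc \<kappa>(1) unfolding uniformly_continuous_on_def by (metis half_gt_zero)
    \<comment> \<open>The first bound keeps (s, |y s|) within d of (s', |y s'|), as |y| moves at
      velocity at most K; the second keeps the drift of the momentum below \<kappa> / 2.\<close>
    define \<eta> where "\<eta> = min (d / (1 + K)) (\<kappa> / (2 * (M1 + 1)))"
    have \<eta>: "\<eta> > 0" "\<eta> * (1 + K) \<le> d" "M1 * \<eta> < \<kappa> / 2"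
    proof -
      show \<eta>0: "\<eta> > 0" unfolding \<eta>_def using d \<kappa> K M1 by simp
      have "\<eta> \<le> d / (1 + K)" "\<eta> \<le> \<kappa> / (2 * (M1 + 1))" by (auto simp: \<eta>_def)
      then show "\<eta> * (1 + K) \<le> d" using K(1) by (simp add: pos_le_divide_eq)
      have "M1 * \<eta> < (M1 + 1) * \<eta>" using \<eta>0 by simp
      also have "\<dots> \<le> \<kappa> / 2" using \<open>\<eta> \<le> \<kappa> / (2 * (M1 + 1))\<close> M1 by (simp add: pos_le_divide_eq mult_ac)
      finally show "M1 * \<eta> < \<kappa> / 2" .
    qed
    have "\<bar>speed v s - speed v s'\<bar> \<le> \<epsilon>"
      if opt: "optimal y v" and edge: "\<forall>s\<in>?I. y s \<in> edge i \<and> \<rho> \<le> norm (y s) \<and> norm (y s) \<le> R" and N: "negligible N"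
        and EL: "\<forall>s\<in>?I - N. \<bar>speed v s\<bar> \<le> K \<and>
          La i s (norm (y s)) (speed v s) = c + integral {\<alpha>..s} (\<lambda>r. Lx i r (norm (y r)) (speed v r))"
        and s: "s \<in> ?I - N" "s' \<in> ?I - N" "s \<le> s'" "\<bar>s - s'\<bar> < \<eta>" for y v c N s s'
    proof (rule ccontr)
      assume "\<not> \<bar>speed v s - speed v s'\<bar> \<le> \<epsilon>"
      then have far: "speed v s' \<ge> speed v s + \<epsilon> \<or> speed v s \<ge> speed v s' + \<epsilon>" by linarith
      have y0: "ac_path p 0 T y v" using opt by (simp add: optimal_def)
      have y: "ac_path p \<alpha> \<beta> y v" using ab by (intro ac_path_sub[OF y0]) auto
      have A: "(\<lambda>r. Lx i r (norm (y r)) (speed v r)) absolutely_integrable_on ?I"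
        by (rule euler_lagrange(1)[OF opt ab \<rho>(1)]) (use edge in auto)
      have ks: "speed v s \<in> {-K..K}" "speed v s' \<in> {-K..K}"
      proof -
        have "\<bar>speed v s\<bar> \<le> K" "\<bar>speed v s'\<bar> \<le> K" using EL s by blast+
        then show "speed v s \<in> {-K..K}" "speed v s' \<in> {-K..K}" by auto
      qed
      have sub: "{s..s'} \<subseteq> ?I" using s by auto
      have aeb: "norm (integral {s..s'} f) \<le> b * (s' - s)"
        if f: "f absolutely_integrable_on ?I" and b: "\<And>r. r \<in> ?I - N \<Longrightarrow> \<bar>f r\<bar> \<le> b" for f :: "real \<Rightarrow> real" and b
      proof -
        define f' where "f' = (\<lambda>r. if r \<in> N then 0 else f r)"
        have b0: "0 \<le> b" using b[OF s(1)] by linarith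
        have fs: "f absolutely_integrable_on {s..s'}" using s by (intro absint_sub[OF f]) auto
        have "f' integrable_on {s..s'}" by (rule integrable_spike[OF absint_imp_int[OF fs] N]) (simp add: f'_def)
        then have "norm (integral {s..s'} f') \<le> integral {s..s'} (\<lambda>_. b)"
          using b sub b0 by (intro integral_norm_bound_integral absint_imp_int[OF absint_const]) (auto simp: f'_def)
        moreover have "integral {s..s'} f' = integral {s..s'} f" by (rule integral_spike[OF N]) (simp add: f'_def)
        ultimately show ?thesis using s by (simp add: mult.commute)
      qed
      have "\<bar>Lx i r (norm (y r)) (speed v r)\<bar> \<le> M1" if r: "r \<in> ?I - N" for r
      proof -
        have "\<bar>Lx i r (norm (y r)) (speed v r)\<bar> \<le> c0 * (\<bar>speed v r\<bar> powr p + 1)"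
          using r ab edge by (intro c0(2)) auto
        also have "\<dots> \<le> M1" unfolding M1_def using EL r p c0(1)
          by (intro mult_left_mono add_right_mono powr_mono2) auto
        finally show ?thesis .
      qed
      from aeb[OF A this] have "norm (integral {s..s'} (\<lambda>r. Lx i r (norm (y r)) (speed v r))) \<le> M1 * (s' - s)" .
      also have "\<dots> \<le> M1 * \<eta>" using s M1 by (intro mult_left_mono) auto
      also have "\<dots> < \<kappa> / 2" by (rule \<eta>)
      finally have Q: "\<bar>La i s' (norm (y s')) (speed v s') - La i s (norm (y s)) (speed v s)\<bar> < \<kappa> / 2"
        using EL s integral_diff_subinterval[OF absint_imp_int[OF A], of s s'] by simp
      have "norm (integral {s..s'} (speed v)) \<le> K * (s' - s)"
        using EL by (intro aeb speed_absint ac_path_absint[OF y]) auto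
      moreover have "norm (y s') - norm (y s) = integral {s..s'} (speed v)"
        using ac_path_norm[OF ac_path_sub[OF y, of s s'], of s'] s by simp
      ultimately have ny: "\<bar>norm (y s') - norm (y s)\<bar> \<le> K * (s' - s)" by simp
      \<comment> \<open>The velocity argument stays at its value at s', only time and position are
        moved. What is left is a comparison of two velocities at the same time and position, to
        which the gap applies.\<close>
      have "dist (s, norm (y s), speed v s') (s', norm (y s'), speed v s') \<le> \<bar>s - s'\<bar> + \<bar>norm (y s) - norm (y s')\<bar>"
        using sqrt_sum_squares_le_sum_abs[of "dist s s'" "dist (norm (y s)) (norm (y s'))"]
        by (simp add: dist_Pair_Pair dist_real_def)
      also have "\<dots> \<le> (s' - s) * (1 + K)" using ny s by (simp add: algebra_simps abs_minus_commute)
      also have "\<dots> < \<eta> * (1 + K)" using s K(1) by (intro mult_strict_right_mono) auto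
      also have "\<dots> \<le> d" by (rule \<eta>)
      finally have "dist (La i s (norm (y s)) (speed v s')) (La i s' (norm (y s')) (speed v s')) < \<kappa> / 2"
        using d(2)[of "(s', norm (y s'), speed v s')" "(s, norm (y s), speed v s')"] s edge ks
        by (auto simp: D_def)
      then have close: "\<bar>La i s (norm (y s)) (speed v s') - La i s (norm (y s)) (speed v s)\<bar> < \<kappa>"
        using Q unfolding dist_real_def by linarith
      have "s \<in> {0..T}" "norm (y s) \<in> {\<rho>..R}" using s ab edge by auto
      from \<kappa>(2)[OF this, of "speed v s" "speed v s'"] \<kappa>(2)[OF this, of "speed v s'" "speed v s"] far ks close
      show False by auto
    qed
    then have "Prop \<epsilon> \<eta>" unfolding Prop_def by blast
    then show ?thesis using \<eta>(1) by blast
  qed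
  define \<eta> where "\<eta> = (\<lambda>\<epsilon>. SOME \<eta>. \<eta> > 0 \<and> Prop \<epsilon> \<eta>)"
  have \<eta>: "\<eta> \<epsilon> > 0" and \<eta>': "Prop \<epsilon> (\<eta> \<epsilon>)" if "\<epsilon> > 0" for \<epsilon>
    unfolding \<eta>_def using someI_ex[OF ex[OF that]] by blast+
  show ?thesis
  proof (rule exI[of _ K], intro conjI K(1), rule exI[of _ \<eta>], intro conjI allI impI \<eta>)
    fix y v assume opt: "optimal y v" and edge: "\<forall>s\<in>?I. y s \<in> edge i \<and> \<rho> \<le> norm (y s) \<and> norm (y s) \<le> R"
      and le: "integral ?I (\<lambda>s. \<bar>speed v s\<bar> powr p) \<le> B"
    obtain c N where N: "negligible N" and EL: "\<forall>s\<in>?I - N. \<bar>speed v s\<bar> \<le> K \<and>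
        La i s (norm (y s)) (speed v s) = c + integral {\<alpha>..s} (\<lambda>r. Lx i r (norm (y r)) (speed v r))"
      using K(2)[rule_format, OF opt bspec[OF edge] le] by blast
    have "\<bar>speed v s - speed v s'\<bar> \<le> \<epsilon>" if "\<epsilon> > 0" "s \<in> ?I - N" "s' \<in> ?I - N" "\<bar>s - s'\<bar> < \<eta> \<epsilon>" for \<epsilon> s s'
    proof -
      have *: "\<bar>speed v r - speed v r'\<bar> \<le> \<epsilon>" if "r \<in> ?I - N" "r' \<in> ?I - N" "r \<le> r'" "\<bar>r - r'\<bar> < \<eta> \<epsilon>" for r r'
        using \<eta>'[OF \<open>\<epsilon> > 0\<close>] opt edge N EL that unfolding Prop_def by blast
      show ?thesis using *[of s s'] *[of s' s] that by (cases "s \<le> s'") (auto simp: abs_minus_commute)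
    qed
    with N EL show "\<exists>N. negligible N \<and> (\<forall>s\<in>?I - N. \<bar>speed v s\<bar> \<le> K) \<and>
        (\<forall>\<epsilon>>0. \<forall>s\<in>?I - N. \<forall>s'\<in>?I - N. \<bar>s - s'\<bar> < \<eta> \<epsilon> \<longrightarrow> \<bar>speed v s - speed v s'\<bar> \<le> \<epsilon>)"
      by blast
  qed
qed

end

section \<open>Measures on trajectories\<close>

lemma mspace_trajs_bdd:
  assumes "T > 0"
  shows "trajs_bdd p T C \<subseteq> mspace (cfunspace (top_of_set {0..T}) euclidean_metric)"
proof
  fix y assume "y \<in> trajs_bdd p T C"
  then have y: "y \<in> extensional {0..T}" "continuous_on {0..T} y"
    by (auto simp: trajs_bdd_def trajs_bdd_at_def trajs_def)
  then have "bounded (y ` {0..T})"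
    using compact_Icc compact_continuous_image compact_imp_bounded by blast
  then have "Metric_space.mbounded UNIV dist (y ` {0..T})"
    by (simp add: mbounded_iff_bounded)
  then show "y \<in> mspace (cfunspace (top_of_set {0..T}) euclidean_metric)"
    using y by (simp add: continuous_map_in_subtopology)
qed

lemma topspace_trajs_topology:
  assumes "T > 0" shows "topspace (trajs_topology p T C) = trajs_bdd p T C"
  using mspace_trajs_bdd[OF assms, of p C] unfolding trajs_topology_def topspace_subtopology topspace_mtopology_of by blast

text \<open>The uniform distance is a supremum over a nonempty interval, so a non-strict bound on it
  is the same as a pointwise one. Closed balls therefore give a description by values of
  trajectories, and halving the radius relates them to open balls.\<close>

lemma openin_trajs_topology:
  fixes U :: "(real \<Rightarrow> real^'n::finite) set"
  assumes "T > 0"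
  shows "openin (trajs_topology p T C) U \<longleftrightarrow> U \<subseteq> trajs_bdd p T C \<and>
    (\<forall>y\<in>U. \<exists>r>0. \<forall>z\<in>trajs_bdd p T C. (\<forall>s\<in>{0..T}. dist (y s) (z s) \<le> r) \<longrightarrow> z \<in> U)"
proof -
  let ?cf = "cfunspace (top_of_set {0..T}) (euclidean_metric :: (real^'n) metric)"
  let ?\<Gamma> = "trajs_bdd p T C :: (real \<Rightarrow> real^'n) set"
  note sub = mspace_trajs_bdd[OF assms, of p C]
  have ne: "topspace (top_of_set {0..T}) \<noteq> {}" using assms by simp
  have mdist: "mdist ?cf y z \<le> r \<longleftrightarrow> (\<forall>s\<in>{0..T}. dist (y s) (z s) \<le> r)" if "y \<in> ?\<Gamma>" "z \<in> ?\<Gamma>" for y z r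
    using cfunspace_mdist_le[of y "top_of_set {0..T}" euclidean_metric z r] that sub ne by auto
  interpret M: Metric_space "mspace (submetric ?cf ?\<Gamma>)" "mdist (submetric ?cf ?\<Gamma>)"
    by (rule Metric_space_mspace_mdist)
  have X: "trajs_topology p T C = M.mtopology"
    unfolding trajs_topology_def mtopology_of_submetric[symmetric] by (simp only: mtopology_of_def)
  have sp: "mspace (submetric ?cf ?\<Gamma>) = ?\<Gamma>" using sub by auto
  have ball: "M.mball y r = {z \<in> ?\<Gamma>. mdist ?cf y z < r}" if "y \<in> ?\<Gamma>" for y r
    using that unfolding M.mball_def unfolding sp mdist_submetric by blast
  have "(\<exists>r>0. M.mball y r \<subseteq> U) \<longleftrightarrow> (\<exists>r>0. \<forall>z\<in>?\<Gamma>. (\<forall>s\<in>{0..T}. dist (y s) (z s) \<le> r) \<longrightarrow> z \<in> U)"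
    if y: "y \<in> ?\<Gamma>" for y
  proof
    assume "\<exists>r>0. M.mball y r \<subseteq> U"
    then obtain r where r: "r > 0" "M.mball y r \<subseteq> U" by blast
    have "z \<in> U" if "z \<in> ?\<Gamma>" "\<forall>s\<in>{0..T}. dist (y s) (z s) \<le> r / 2" for z
    proof -
      have "mdist ?cf y z \<le> r / 2" using mdist y that by blast
      then have "z \<in> M.mball y r" using ball[OF y] that r by simp
      then show ?thesis using r by blast
    qed
    then show "\<exists>r>0. \<forall>z\<in>?\<Gamma>. (\<forall>s\<in>{0..T}. dist (y s) (z s) \<le> r) \<longrightarrow> z \<in> U"
      using r by (intro exI[of _ "r / 2"]) auto
  next
    assume "\<exists>r>0. \<forall>z\<in>?\<Gamma>. (\<forall>s\<in>{0..T}. dist (y s) (z s) \<le> r) \<longrightarrow> z \<in> U"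
    then obtain r where r: "r > 0" "\<And>z. z \<in> ?\<Gamma> \<Longrightarrow> (\<forall>s\<in>{0..T}. dist (y s) (z s) \<le> r) \<Longrightarrow> z \<in> U" by blast
    have "M.mball y r \<subseteq> U"
      using ball[OF y] mdist[OF y] r(2) by (smt (verit) mem_Collect_eq subsetI)
    then show "\<exists>r>0. M.mball y r \<subseteq> U" using r(1) by blast
  qed
  then show ?thesis unfolding X M.openin_mtopology unfolding sp by blast
qed

section \<open>Equicontinuity of trajectories of bounded energy\<close>

text \<open>If l r is at most 1 the last term suffices; otherwise (l r)^(p - 1) is at least 1 and
  may be multiplied to r. With l free it replaces Hoelder's inequality in deriving equicontinuity
  from bounded energy.\<close>

lemma powr_young:
  fixes r l p :: real assumes "l > 0" "r \<ge> 0" "p > 1"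
  shows "r \<le> l powr (p - 1) * r powr p + 1 / l"
proof (cases "l * r \<le> 1")
  case True
  then have "r \<le> 1 / l" using assms by (simp add: field_simps)
  then show ?thesis by (simp add: add_increasing)
next
  case False
  then have "r > 0" using assms by (cases "r = 0") auto
  have "1 \<le> (l * r) powr (p - 1)" using False assms by (intro ge_one_powr_ge_zero) auto
  then have "r \<le> (l * r) powr (p - 1) * r" using \<open>r > 0\<close> by simp
  also have "\<dots> = l powr (p - 1) * (r powr (p - 1) * r)" using assms by (simp add: powr_mult)
  also have "r powr (p - 1) * r = r powr p" using \<open>r > 0\<close> by (simp add: powr_diff)
  finally show ?thesis using assms by (simp add: add_increasing2)
qed

text \<open>The set of interior times with |y| > C is open and null, hence empty, and continuity
  settles the endpoints. The energy bound passes from the selected weak derivative to the witness v,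
  which agrees with it almost everywhere.\<close>

lemma trajs_bdd_path:
  fixes y :: "real \<Rightarrow> real^'n::finite"
  assumes "T > 0" "p > 1" "C > 0" and y: "y \<in> trajs_bdd p T C"
  obtains v where "ac_path p 0 T y v" "integral {0..T} (\<lambda>s. norm (v s) powr p) \<le> C powr p"
    "\<And>s. s \<in> {0..T} \<Longrightarrow> norm (y s) \<le> C"
proof -
  obtain x where x: "y \<in> trajs p T 0 x" and ae: "AE s in lebesgue_on {0<..<T}. norm (y s) \<le> C"
    and Lp: "Lp_norm p 0 T (weak_deriv 0 T y) \<le> C"
    using y by (auto simp: trajs_bdd_def trajs_bdd_at_def)
  obtain v where v: "ac_path p 0 T y v" using x trajs_iff_ac_path[OF assms(1,2)] by blast
  have cont: "continuous_on {0..T} y" by (rule ac_path_continuous[OF v])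
  have "norm (y s) \<le> C" if s: "s \<in> {0<..<T}" for s
  proof (rule ccontr)
    assume "\<not> norm (y s) \<le> C"
    define U where "U = {0<..<T} \<inter> (\<lambda>r. norm (y r)) -` {C<..}"
    have "open U" unfolding U_def
      by (intro continuous_open_preimage continuous_intros continuous_on_subset[OF cont]) auto
    moreover have "s \<in> U" using s \<open>\<not> norm (y s) \<le> C\<close> by (simp add: U_def)
    moreover have "negligible U"
    proof -
      have "AE r in lebesgue. r \<in> {0<..<T} \<longrightarrow> norm (y r) \<le> C"
        using ae by (subst (asm) AE_restrict_space_iff) auto
      then obtain N where "negligible N" "{r. \<not> (r \<in> {0<..<T} \<longrightarrow> norm (y r) \<le> C)} \<subseteq> N"
        unfolding eventually_ae_filter_negligible by blast
      moreover have "U \<subseteq> {r. \<not> (r \<in> {0<..<T} \<longrightarrow> norm (y r) \<le> C)}" by (auto simp: U_def)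
      ultimately show ?thesis by (meson negligible_subset order_trans)
    qed
    ultimately show False using open_not_negligible by blast
  qed
  moreover have "closure {0<..<T} = {0..T}" using assms by simp
  ultimately have bound: "norm (y s) \<le> C" if "s \<in> {0..T}" for s
    using continuous_le_on_closure[of "{0<..<T}" "\<lambda>s. norm (y s)" s C] that continuous_on_norm[OF cont] by simp
  obtain N where N: "negligible N" "\<And>s. s \<in> {0<..<T} - N \<Longrightarrow> weak_deriv 0 T y s = v s"
    using ac_path_weak_deriv[OF v assms(1)] by blast
  have vp: "(\<lambda>s. norm (v s) powr p) absolutely_integrable_on {0<..<T}"
    using ac_path_absint(2)[OF v] by (simp add: absolutely_integrable_on_Icc_iff_Ioo)
  have wp: "(\<lambda>s. norm (weak_deriv 0 T y s) powr p) absolutely_integrable_on {0<..<T}"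
    by (rule absolutely_integrable_spike[OF vp N(1)]) (simp add: N(2))
  have "(LINT s|lebesgue_on {0<..<T}. norm (weak_deriv 0 T y s) powr p) = integral {0<..<T} (\<lambda>s. norm (weak_deriv 0 T y s) powr p)"
    using wp by (intro lebesgue_integral_eq_integral) (auto simp: integrable_lebesgue_on_iff)
  also have "\<dots> = integral {0<..<T} (\<lambda>s. norm (v s) powr p)"
    by (rule integral_spike[OF N(1)]) (simp add: N(2))
  also have "\<dots> = integral {0..T} (\<lambda>s. norm (v s) powr p)" by (rule integral_open_interval_real[symmetric])
  finally have le: "integral {0..T} (\<lambda>s. norm (v s) powr p) powr (1 / p) \<le> C"
    using Lp by (simp add: Lp_norm_def)
  have nn: "integral {0..T} (\<lambda>s. norm (v s) powr p) \<ge> 0"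
    by (intro Henstock_Kurzweil_Integration.integral_nonneg absint_imp_int ac_path_absint(2)[OF v]) simp
  have "integral {0..T} (\<lambda>s. norm (v s) powr p) = (integral {0..T} (\<lambda>s. norm (v s) powr p) powr (1 / p)) powr p"
    using nn assms by (simp add: powr_powr)
  also have "\<dots> \<le> C powr p" using le assms by (intro powr_mono2) auto
  finally show thesis using that v bound by blast
qed

lemma trajs_bdd_equicontinuous:
  assumes "T > 0" "p > 1" "C > 0" "\<epsilon> > 0"
  obtains \<delta> where "\<delta> > 0" "\<And>(y :: real \<Rightarrow> real^'n::finite) s s'. y \<in> trajs_bdd p T C \<Longrightarrow> s \<in> {0..T} \<Longrightarrow> s' \<in> {0..T} \<Longrightarrow>
    \<bar>s - s'\<bar> \<le> \<delta> \<Longrightarrow> dist (y s) (y s') \<le> \<epsilon>"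
proof -
  \<comment> \<open>Solves \<open>l powr (p - 1) * C powr p = \<epsilon> / 2\<close>, so that the
    energy uses one half of \<epsilon>; \<delta> is chosen so that the elapsed time divided by l
    uses the other half.\<close>
  define l where "l = (\<epsilon> / (2 * C powr p)) powr (1 / (p - 1))"
  have l: "l > 0" "l powr (p - 1) * C powr p = \<epsilon> / 2"
    using assms by (auto simp: l_def powr_powr)
  define \<delta> where "\<delta> = l * \<epsilon> / 2"
  have "\<delta> > 0" using l assms by (simp add: \<delta>_def)
  have main: "dist (y s) (y s') \<le> \<epsilon>" if y: "y \<in> trajs_bdd p T C" and s: "0 \<le> s" "s \<le> s'" "s' \<le> T" "s' - s \<le> \<delta>"
    for y :: "real \<Rightarrow> real^'n" and s s'
  proof -
    obtain v where v: "ac_path p 0 T y v" "integral {0..T} (\<lambda>s. norm (v s) powr p) \<le> C powr p"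
      using trajs_bdd_path[OF assms(1-3) y] by metis
    have sub: "ac_path p s s' y v" using s by (intro ac_path_sub[OF v(1)]) auto
    note vi = ac_path_absint[OF sub]
    have "y s' - y s = integral {s..s'} v"
      using ac_path_eq[OF sub, of s'] s by (metis add_diff_cancel_left' atLeastAtMost_iff order_refl)
    also have "norm \<dots> \<le> integral {s..s'} (\<lambda>r. l powr (p - 1) * norm (v r) powr p + 1 / l)"
      using l(1) assms(2) by (intro integral_norm_bound_integral integrable_add integrable_on_mult_right absint_imp_int vi absint_const powr_young) auto
    also have "\<dots> = integral {s..s'} (\<lambda>r. l powr (p - 1) * norm (v r) powr p) + integral {s..s'} (\<lambda>r. 1 / l)"
      by (intro Henstock_Kurzweil_Integration.integral_add integrable_on_mult_right absint_imp_int vi absint_const)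
    also have "\<dots> = l powr (p - 1) * integral {s..s'} (\<lambda>r. norm (v r) powr p) + (s' - s) / l"
      using s by simp
    also have "\<dots> \<le> l powr (p - 1) * C powr p + \<delta> / l"
    proof (intro add_mono mult_left_mono divide_right_mono)
      have "integral {s..s'} (\<lambda>r. norm (v r) powr p) \<le> integral {0..T} (\<lambda>r. norm (v r) powr p)"
        using s by (intro integral_subset_le absint_imp_int vi ac_path_absint(2)[OF v(1)]) auto
      then show "integral {s..s'} (\<lambda>r. norm (v r) powr p) \<le> C powr p" using v(2) by linarith
    qed (use s l in auto)
    also have "\<dots> = \<epsilon>" using l by (simp add: \<delta>_def)
    finally show ?thesis by (simp add: dist_norm norm_minus_commute)
  qed
  show thesis
  proof (rule that[OF \<open>\<delta> > 0\<close>])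
    fix y :: "real \<Rightarrow> real^'n" and s s'
    assume "y \<in> trajs_bdd p T C" "s \<in> {0..T}" "s' \<in> {0..T}" "\<bar>s - s'\<bar> \<le> \<delta>"
    then show "dist (y s) (y s') \<le> \<epsilon>"
      using main[of y s s'] main[of y s' s] by (cases "s \<le> s'") (auto simp: dist_commute)
  qed
qed

lemma junction_dist_le:
  fixes x y :: "real^'n::finite"
  assumes "x \<in> junction" "y \<in> junction" shows "junction_dist x y \<le> 2 * dist x y"
proof (cases "\<exists>i. x \<in> edge i \<and> y \<in> edge i")
  case False
  obtain i r where x: "x = r *\<^sub>R axis i 1" "r \<ge> 0" using assms junctionE by blast
  obtain j q where y: "y = q *\<^sub>R axis j 1" "q \<ge> 0" using assms junctionE by blast
  have "i \<noteq> j" using False x y by (auto simp: edge_def)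
  have "\<bar>(x - y) $ i\<bar> \<le> norm (x - y)" "\<bar>(x - y) $ j\<bar> \<le> norm (x - y)" by (rule component_le_norm_cart)+
  then have "r \<le> norm (x - y)" "q \<le> norm (x - y)" using x y \<open>i \<noteq> j\<close> by (auto simp: axis_def)
  then show ?thesis using False x y by (simp add: junction_dist_def dist_norm norm_axis_1)
qed (simp add: junction_dist_def dist_norm)

text \<open>A point of another edge has i-th coordinate 0, so its distance from x is at least that
  coordinate of x, which is |x|.\<close>

lemma edge_if_close:
  fixes x y :: "real^'n::finite"
  assumes "x \<in> edge i" "y \<in> junction" "dist x y < norm x" shows "y \<in> edge i"
proof -
  obtain r where x: "x = r *\<^sub>R axis i 1" "r \<ge> 0" using assms by (auto simp: edge_def)
  obtain j q where y: "y = q *\<^sub>R axis j 1" "q \<ge> 0" using assms junctionE by blast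
  have "i = j"
  proof (rule ccontr)
    assume "i \<noteq> j"
    have "\<bar>(x - y) $ i\<bar> \<le> norm (x - y)" by (rule component_le_norm_cart)
    then have "r \<le> norm (x - y)" using x y \<open>i \<noteq> j\<close> by (auto simp: axis_def)
    then show False using assms x by (simp add: dist_norm norm_axis_1)
  qed
  then show ?thesis using y by (auto simp: edge_def)
qed

section \<open>Marginals and support of a measure on trajectories\<close>

locale path_measure =
  fixes T p C :: real and m0 :: "(real^'n::finite) measure" and \<mu> :: "(real \<Rightarrow> real^'n) measure"
  assumes T: "T > 0" and p: "p > 1" and C: "C > 0" and \<mu>: "\<mu> \<in> traj_probs p T C m0"
begin

abbreviation \<Gamma> :: "(real \<Rightarrow> real^'n) set" where "\<Gamma> \<equiv> trajs_bdd p T C"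
abbreviation X :: "(real \<Rightarrow> real^'n) topology" where "X \<equiv> trajs_topology p T C"

lemma prob: "prob_space \<mu>"
  using \<mu> by (simp add: traj_probs_def borel_probs_def)

lemma opens_subset: "{U. openin X U} \<subseteq> Pow (topspace X)"
  by (auto dest: openin_subset)

lemma space_\<mu>: "space \<mu> = \<Gamma>"
proof -
  have "sets \<mu> = sets (borel_sigma X)" using \<mu> by (simp add: traj_probs_def borel_probs_def)
  then have "space \<mu> = space (borel_sigma X)" by (rule sets_eq_imp_space_eq)
  also have "\<dots> = topspace X" unfolding borel_sigma_def by (rule space_measure_of[OF opens_subset])
  finally show ?thesis using topspace_trajs_topology[OF T] by simp
qed

lemma open_measurable: "openin X U \<Longrightarrow> U \<in> sets \<mu>"
proof -
  assume "openin X U"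
  then have "U \<in> sets (borel_sigma X)"
    unfolding borel_sigma_def sets_measure_of[OF opens_subset] by (intro sigma_sets.Basic) simp
  then show ?thesis using \<mu> by (simp add: traj_probs_def borel_probs_def)
qed

lemma open_eval:
  assumes "t \<in> {0..T}" "open S" shows "openin X {y \<in> \<Gamma>. y t \<in> S}"
  unfolding openin_trajs_topology[OF T]
proof (intro conjI ballI)
  fix y assume y: "y \<in> {y \<in> \<Gamma>. y t \<in> S}"
  obtain e where "e > 0" "ball (y t) e \<subseteq> S" using assms y open_contains_ball by blast
  then show "\<exists>r>0. \<forall>z\<in>\<Gamma>. (\<forall>s\<in>{0..T}. dist (y s) (z s) \<le> r) \<longrightarrow> z \<in> {y \<in> \<Gamma>. y t \<in> S}"
    using assms(1) by (intro exI[of _ "e / 2"]) force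
qed auto

lemma \<Gamma>_junction: "y \<in> \<Gamma> \<Longrightarrow> t \<in> {0..T} \<Longrightarrow> y t \<in> junction"
  using trajs_bdd_path[OF T p C] ac_path_in_junction by metis

lemma \<Gamma>_bound: "y \<in> \<Gamma> \<Longrightarrow> t \<in> {0..T} \<Longrightarrow> norm (y t) \<le> C"
  using trajs_bdd_path[OF T p C] by metis

lemma eval_borel: "t \<in> {0..T} \<Longrightarrow> (\<lambda>y. y t) \<in> borel_measurable \<mu>"
proof (rule borel_measurableI)
  fix S :: "(real^'n) set" assume "open S" "t \<in> {0..T}"
  have "(\<lambda>y. y t) -` S \<inter> space \<mu> = {y \<in> \<Gamma>. y t \<in> S}" using space_\<mu> by auto
  then show "(\<lambda>y. y t) -` S \<inter> space \<mu> \<in> sets \<mu>"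
    using open_measurable[OF open_eval] \<open>open S\<close> \<open>t \<in> {0..T}\<close> by simp
qed

lemma eval_measurable: "t \<in> {0..T} \<Longrightarrow> (\<lambda>y. y t) \<in> measurable \<mu> junction_borel"
  by (intro measurable_restrict_space2 eval_borel) (auto simp: space_\<mu> \<Gamma>_junction)

lemma norm_junction_borel: "norm \<in> borel_measurable (junction_borel :: (real^'n) measure)"
  by (intro borel_measurable_continuous_on_restrict continuous_intros)

lemma marginal_P1: assumes t: "t \<in> {0..T}" shows "marginal \<mu> t \<in> P1"
proof -
  interpret prob_space \<mu> by (rule prob)
  have "prob_space (marginal \<mu> t)" unfolding marginal_def by (rule prob_space_distr[OF eval_measurable[OF t]])
  moreover have "integrable (marginal \<mu> t) norm"
    unfolding marginal_def integrable_distr_eq[OF eval_measurable[OF t] norm_junction_borel]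
  proof (rule integrable_const_bound[of _ C])
    show "AE y in \<mu>. norm (norm (y t)) \<le> C" using \<Gamma>_bound t space_\<mu> by (intro AE_I2) simp
    show "(\<lambda>y. norm (y t)) \<in> borel_measurable \<mu>" using eval_borel[OF t] by measurable
  qed
  ultimately show ?thesis by (simp add: P1_def borel_probs_def marginal_def)
qed

text \<open>The measure itself couples its marginals at s and s': both integrals are taken along the
  same trajectory, whose two positions are \<epsilon>-close. The factor 2 compares the junction
  distance with the Euclidean one.\<close>

lemma kr_dist_marginal:
  assumes s: "s \<in> {0..T}" "s' \<in> {0..T}" and \<epsilon>: "\<And>y. y \<in> \<Gamma> \<Longrightarrow> dist (y s) (y s') \<le> \<epsilon>"
  shows "kr_dist (marginal \<mu> s) (marginal \<mu> s') \<le> 2 * \<epsilon>"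
  unfolding kr_dist_def
proof (rule cSUP_least)
  interpret prob_space \<mu> by (rule prob)
  have "junction_dist x y \<ge> 0" for x y :: "real^'n" by (simp add: junction_dist_def)
  then show "{\<phi> :: real^'n \<Rightarrow> real. \<forall>x\<in>junction. \<forall>y\<in>junction. \<bar>\<phi> x - \<phi> y\<bar> \<le> junction_dist x y} \<noteq> {}"
    by (auto intro!: exI[of _ "\<lambda>_. 0"])
  fix \<phi> :: "real^'n \<Rightarrow> real"
  assume "\<phi> \<in> {\<phi>. \<forall>x\<in>junction. \<forall>y\<in>junction. \<bar>\<phi> x - \<phi> y\<bar> \<le> junction_dist x y}"
  then have lip: "\<bar>\<phi> x - \<phi> y\<bar> \<le> 2 * dist x y" if "x \<in> junction" "y \<in> junction" for x y
    using junction_dist_le[OF that] that by fastforce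
  have "2-lipschitz_on junction \<phi>" using lip by (intro lipschitz_onI) (auto simp: dist_real_def)
  then have "continuous_on junction \<phi>" by (rule lipschitz_on_continuous_on)
  then have \<phi>m: "\<phi> \<in> borel_measurable junction_borel" by (rule borel_measurable_continuous_on_restrict)
  have zj: "(0 :: real^'n) \<in> junction" using edge_line[of 0] by simp
  have int: "integrable \<mu> (\<lambda>y. \<phi> (y r))" if r: "r \<in> {0..T}" for r
  proof (rule integrable_const_bound[of _ "\<bar>\<phi> 0\<bar> + 2 * C"])
    show "(\<lambda>y. \<phi> (y r)) \<in> borel_measurable \<mu>"
      using measurable_comp[OF eval_measurable[OF r] \<phi>m] by (simp add: o_def)
    have "\<bar>\<phi> (y r)\<bar> \<le> \<bar>\<phi> 0\<bar> + 2 * C" if y: "y \<in> \<Gamma>" for y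
      using lip[OF \<Gamma>_junction[OF y r] zj] \<Gamma>_bound[OF y r] by simp
    then show "AE y in \<mu>. norm (\<phi> (y r)) \<le> \<bar>\<phi> 0\<bar> + 2 * C" using space_\<mu> by (intro AE_I2) simp
  qed
  have "integral\<^sup>L (marginal \<mu> s) \<phi> - integral\<^sup>L (marginal \<mu> s') \<phi> = (\<integral>y. \<phi> (y s) - \<phi> (y s') \<partial>\<mu>)"
    unfolding marginal_def using s int
    by (simp add: integral_distr[OF eval_measurable \<phi>m])
  also have "\<dots> \<le> 2 * \<epsilon>"
  proof (rule integral_le_const)
    show "integrable \<mu> (\<lambda>y. \<phi> (y s) - \<phi> (y s'))" using int s by auto
    have "\<phi> (y s) - \<phi> (y s') \<le> 2 * \<epsilon>" if y: "y \<in> \<Gamma>" for y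
      using lip[OF \<Gamma>_junction[OF y s(1)] \<Gamma>_junction[OF y s(2)]] \<epsilon>[OF y] by linarith
    then show "AE y in \<mu>. \<phi> (y s) - \<phi> (y s') \<le> 2 * \<epsilon>" using space_\<mu> by (intro AE_I2) simp
  qed
  finally show "integral\<^sup>L (marginal \<mu> s) \<phi> - integral\<^sup>L (marginal \<mu> s') \<phi> \<le> 2 * \<epsilon>" .
qed

lemma marginal_continuous:
  assumes s: "s \<in> {0..T}"
  shows "filterlim (marginal \<mu>) (P1_nhds (marginal \<mu> s)) (at s within {0..T})"
  unfolding P1_nhds_def filterlim_INF filterlim_principal
proof
  fix e :: real assume "e \<in> {0<..}"
  then have "e / 4 > 0" by simp
  from trajs_bdd_equicontinuous[OF T p C this] obtain \<delta> where \<delta>: "\<delta> > 0"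
    "\<And>(y :: real \<Rightarrow> real^'n) s s'. y \<in> \<Gamma> \<Longrightarrow> s \<in> {0..T} \<Longrightarrow> s' \<in> {0..T} \<Longrightarrow> \<bar>s - s'\<bar> \<le> \<delta> \<Longrightarrow> dist (y s) (y s') \<le> e / 4"
    by metis
  show "\<forall>\<^sub>F s' in at s within {0..T}. marginal \<mu> s' \<in> {m' \<in> P1. kr_dist (marginal \<mu> s) m' < e}"
    unfolding eventually_at
  proof (intro exI[of _ \<delta>] conjI ballI impI \<delta>(1))
    fix s' assume s': "s' \<in> {0..T}" "s' \<noteq> s \<and> dist s' s < \<delta>"
    have "kr_dist (marginal \<mu> s) (marginal \<mu> s') \<le> 2 * (e / 4)"
      using s s' by (intro kr_dist_marginal \<delta>(2)) (auto simp: dist_real_def)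
    then show "marginal \<mu> s' \<in> {m' \<in> P1. kr_dist (marginal \<mu> s) m' < e}"
      using marginal_P1[OF s'(1)] \<open>e \<in> {0<..}\<close> by simp
  qed
qed

text \<open>By equicontinuity, a trajectory is determined up to \<open>\<epsilon>\<close> by its rounded values on a finite time
  grid. This replaces separability of the space of continuous functions.\<close>

lemma countable_net:
  assumes "\<epsilon> > 0"
  obtains code :: "(real \<Rightarrow> real^'n) \<Rightarrow> ('n \<Rightarrow> int) list" where
    "\<And>y z s. y \<in> \<Gamma> \<Longrightarrow> z \<in> \<Gamma> \<Longrightarrow> code y = code z \<Longrightarrow> s \<in> {0..T} \<Longrightarrow> dist (y s) (z s) \<le> \<epsilon>"
proof -
  have "\<epsilon> / 3 > 0" using assms by simp
  from trajs_bdd_equicontinuous[OF T p C this] obtain \<delta> where \<delta>: "\<delta> > 0"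
    "\<And>(y :: real \<Rightarrow> real^'n) s s'. y \<in> \<Gamma> \<Longrightarrow> s \<in> {0..T} \<Longrightarrow> s' \<in> {0..T} \<Longrightarrow> \<bar>s - s'\<bar> \<le> \<delta> \<Longrightarrow> dist (y s) (y s') \<le> \<epsilon> / 3"
    by metis
  \<comment> \<open>Equal roundings at scale 1 / K leave an error of at most 1 / K per coordinate, N
    / K = \<epsilon> / 3 in total. The other two thirds are spent on moving each trajectory between
    s and the grid time.\<close>
  define K where "K = 3 * real CARD('n) / \<epsilon>"
  have K: "K > 0" "real CARD('n) / K = \<epsilon> / 3" using assms by (auto simp: K_def)
  define M where "M = nat \<lceil>T / \<delta>\<rceil>"
  define code :: "(real \<Rightarrow> real^'n) \<Rightarrow> ('n \<Rightarrow> int) list"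
    where "code = (\<lambda>y. map (\<lambda>j i. \<lfloor>K * (y (min T (real j * \<delta>)) $ i)\<rfloor>) [0..<Suc M])"
  show thesis
  proof (rule that[of code])
    fix y z s assume yz: "y \<in> \<Gamma>" "z \<in> \<Gamma>" "code y = code z" and s: "s \<in> {0..T}"
    define j where "j = nat \<lfloor>s / \<delta>\<rfloor>"
    define r where "r = min T (real j * \<delta>)"
    have sd: "s / \<delta> \<ge> 0" using s \<delta>(1) by simp
    have "real j \<le> s / \<delta>" "s / \<delta> < real j + 1" unfolding j_def using sd by linarith+
    then have j: "real j * \<delta> \<le> s" "s < real j * \<delta> + \<delta>" using \<delta>(1) by (auto simp: field_simps)
    then have r: "r \<in> {0..T}" "\<bar>s - r\<bar> \<le> \<delta>" "\<bar>r - s\<bar> \<le> \<delta>" using s \<delta>(1) T by (auto simp: r_def)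
    have "s / \<delta> \<le> T / \<delta>" using s \<delta>(1) by (simp add: divide_right_mono)
    then have "j \<le> M" unfolding j_def M_def by (intro nat_mono) linarith
    then have "code y ! j = code z ! j \<and> j < Suc M" using yz(3) by simp
    then have eq: "\<lfloor>K * (y r $ i)\<rfloor> = \<lfloor>K * (z r $ i)\<rfloor>" for i
      unfolding code_def r_def by (metis (no_types, lifting) add_0 diff_zero length_upt nth_map nth_upt)
    have "\<bar>(y r - z r) $ i\<bar> \<le> 1 / K" for i
    proof -
      have "\<bar>K * (y r $ i) - K * (z r $ i)\<bar> \<le> 1" using eq[of i] by linarith
      moreover have "K * (y r $ i) - K * (z r $ i) = K * (y r - z r) $ i" by (simp add: algebra_simps)
      ultimately have "K * \<bar>(y r - z r) $ i\<bar> \<le> 1" using K(1) by (simp add: abs_mult)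
      then show ?thesis using K(1) by (simp add: field_simps)
    qed
    then have "(\<Sum>i\<in>UNIV. \<bar>(y r - z r) $ i\<bar>) \<le> (\<Sum>i\<in>(UNIV::'n set). 1 / K)" by (intro sum_mono)
    then have "dist (y r) (z r) \<le> \<epsilon> / 3"
      unfolding dist_norm using norm_le_l1_cart[of "y r - z r"] K(2) by simp
    moreover have "dist (y s) (y r) \<le> \<epsilon> / 3" "dist (z r) (z s) \<le> \<epsilon> / 3"
      using \<delta>(2)[OF yz(1) s r(1,2)] \<delta>(2)[OF yz(2) r(1) s r(3)] by auto
    ultimately show "dist (y s) (z s) \<le> \<epsilon>"
      using dist_triangle[of "y s" "z s" "y r"] dist_triangle[of "y r" "z s" "z r"] by linarith
  qed
qed

text \<open>Otherwise every trajectory in V has a null neighbourhood, and V would be null if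
  countably many of these covered it. Trajectories are sorted by a radius up to which such a
  neighbourhood reaches; at a fixed radius one representative per code suffices.\<close>

lemma supp_meets_positive_open:
  assumes V: "openin X V" and pos: "emeasure \<mu> V > 0"
  shows "\<exists>y\<in>V. y \<in> supp X \<mu>"
proof (rule ccontr)
  assume no: "\<not> (\<exists>y\<in>V. y \<in> supp X \<mu>)"
  have V\<Gamma>: "V \<subseteq> \<Gamma>" using openin_subset[OF V] topspace_trajs_topology[OF T] by blast
  define A where "A = (\<lambda>k::nat. {y \<in> V. \<exists>U. openin X U \<and> emeasure \<mu> U = 0 \<and>
     (\<forall>z\<in>\<Gamma>. (\<forall>s\<in>{0..T}. dist (y s) (z s) \<le> 1 / Suc k) \<longrightarrow> z \<in> U)})"
  have VA: "V \<subseteq> (\<Union>k. A k)"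
  proof
    fix y assume y: "y \<in> V"
    then have "y \<in> topspace X" "y \<notin> supp X \<mu>" using no openin_subset[OF V] by blast+
    then obtain U where U: "openin X U" "y \<in> U" "emeasure \<mu> U = 0"
      unfolding supp_def by (auto simp: not_less)
    obtain r where r: "r > 0" "\<forall>z\<in>\<Gamma>. (\<forall>s\<in>{0..T}. dist (y s) (z s) \<le> r) \<longrightarrow> z \<in> U"
      using U(1,2) unfolding openin_trajs_topology[OF T] by blast
    obtain k where k: "1 / Suc k < r" using r(1) nat_approx_posE by blast
    have "\<forall>z\<in>\<Gamma>. (\<forall>s\<in>{0..T}. dist (y s) (z s) \<le> 1 / Suc k) \<longrightarrow> z \<in> U"
      using r(2) k by (meson order_trans less_imp_le)
    then show "y \<in> (\<Union>k. A k)" using y U unfolding A_def by blast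
  qed
  have "\<exists>N\<in>null_sets \<mu>. A k \<subseteq> N" for k
  proof -
    have "1 / real (Suc k) > 0" by simp
    from countable_net[OF this] obtain code :: "(real \<Rightarrow> real^'n) \<Rightarrow> ('n \<Rightarrow> int) list" where
      code: "\<And>y z s. y \<in> \<Gamma> \<Longrightarrow> z \<in> \<Gamma> \<Longrightarrow> code y = code z \<Longrightarrow> s \<in> {0..T} \<Longrightarrow> dist (y s) (z s) \<le> 1 / Suc k"
      by metis
    have "\<forall>y\<in>A k. \<exists>U. openin X U \<and> emeasure \<mu> U = 0 \<and>
       (\<forall>z\<in>\<Gamma>. (\<forall>s\<in>{0..T}. dist (y s) (z s) \<le> 1 / Suc k) \<longrightarrow> z \<in> U)" unfolding A_def by blast
    then obtain U where U: "\<And>y. y \<in> A k \<Longrightarrow> openin X (U y)" "\<And>y. y \<in> A k \<Longrightarrow> emeasure \<mu> (U y) = 0"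
       "\<And>y z. y \<in> A k \<Longrightarrow> z \<in> \<Gamma> \<Longrightarrow> (\<forall>s\<in>{0..T}. dist (y s) (z s) \<le> 1 / Suc k) \<Longrightarrow> z \<in> U y"
      unfolding bchoice_iff by blast
    \<comment> \<open>Trajectories with the code of a representative lie in the null set chosen for
      it, and there are only countably many codes.\<close>
    define rep where "rep = (\<lambda>c. SOME y. y \<in> A k \<and> code y = c)"
    have rep: "rep (code y) \<in> A k" "code (rep (code y)) = code y" if "y \<in> A k" for y
      unfolding rep_def using someI[of "\<lambda>z. z \<in> A k \<and> code z = code y" y] that by auto
    define N where "N = (\<Union>c\<in>code ` A k. U (rep c))"
    have "N \<in> null_sets \<mu>" unfolding N_def
    proof (rule null_sets_UN')
      show "countable (code ` A k)" by (rule countableI_type)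
      show "U (rep c) \<in> null_sets \<mu>" if "c \<in> code ` A k" for c
        using that rep U open_measurable by (auto simp: null_sets_def)
    qed
    moreover have "A k \<subseteq> N"
    proof
      fix y assume y: "y \<in> A k"
      have "A k \<subseteq> \<Gamma>" using V\<Gamma> by (auto simp: A_def)
      then have "y \<in> U (rep (code y))" using rep[OF y] y by (intro U(3) ballI code) auto
      then show "y \<in> N" unfolding N_def using y by blast
    qed
    ultimately show ?thesis by blast
  qed
  then obtain N where N: "\<And>k. N k \<in> null_sets \<mu>" "\<And>k. A k \<subseteq> N k" by metis
  have "(\<Union>k. N k) \<in> null_sets \<mu>" using N(1) by (intro null_sets_UN) auto
  moreover have "V \<subseteq> (\<Union>k. N k)" using VA N(2) by blast
  ultimately have "V \<in> null_sets \<mu>" using null_sets_subset[OF _ open_measurable[OF V]] by blast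
  then show False using pos by (auto simp: null_sets_def)
qed

text \<open>The trajectories that are \<rho>-close to x at time t form an open set of positive
  measure. This yields trajectories of the support arbitrarily near x at time t, not necessarily one
  through x.\<close>

lemma supp_marginal:
  assumes t: "t \<in> {0..T}" and x: "x \<in> supp (top_of_set junction) (marginal \<mu> t)" and "\<rho> > 0"
  shows "\<exists>y\<in>supp X \<mu>. y \<in> \<Gamma> \<and> dist (y t) x < \<rho>"
proof -
  define W where "W = junction \<inter> ball x \<rho>"
  have xj: "x \<in> junction" using x by (simp add: supp_def)
  have "openin (top_of_set junction) W" unfolding W_def by (intro openin_open_Int) simp
  moreover have "x \<in> W" using xj \<open>\<rho> > 0\<close> by (simp add: W_def)
  ultimately have pos: "emeasure (marginal \<mu> t) W > 0" using x by (simp add: supp_def)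
  have Wm: "W \<in> sets junction_borel"
    unfolding W_def sets_restrict_space by auto
  have "emeasure (marginal \<mu> t) W = emeasure \<mu> ((\<lambda>y. y t) -` W \<inter> space \<mu>)"
    unfolding marginal_def by (rule emeasure_distr[OF eval_measurable[OF t] Wm])
  also have "(\<lambda>y. y t) -` W \<inter> space \<mu> = {y \<in> \<Gamma>. y t \<in> ball x \<rho>}"
    using space_\<mu> \<Gamma>_junction[OF _ t] by (auto simp: W_def)
  finally have "emeasure \<mu> {y \<in> \<Gamma>. y t \<in> ball x \<rho>} > 0" using pos by simp
  from supp_meets_positive_open[OF open_eval[OF t open_ball] this] show ?thesis
    by (auto simp: dist_commute)
qed

end

section \<open>Differentiability of the value function\<close>

text \<open>With X - r = \<xi> and S - t = \<sigma>, the first bound contains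
  \<open>q * \<Lambda> b\<close> with q = h + \<sigma> and q (b - a) = \<xi> - a \<sigma>. To first
  order this is q \<Lambda>(a) + D (\<xi> - a \<sigma>), and h \<Lambda>(a) minus it is -D \<xi> +
  (a D - \<Lambda>(a)) \<sigma>. The second bound has the mirrored form and the same linear part, so
  U is squeezed.\<close>

lemma derivative_from_rescaled_bounds:
  fixes U :: "real \<times> real \<Rightarrow> real"
  assumes \<Lambda>: "(\<Lambda> has_real_derivative D) (at a)"
    and bounds: "\<And>\<epsilon>. \<epsilon> > 0 \<Longrightarrow> \<exists>e>0. \<forall>h. 0 < h \<and> h < e \<longrightarrow> (\<forall>X S. \<bar>X - r\<bar> + \<bar>S - t\<bar> \<le> h / 2 \<longrightarrow>
        U (X, S) - U (r, t) \<ge> h * \<Lambda> a - (h + (S - t)) * \<Lambda> ((X - r + a * h) / (h + (S - t))) - \<epsilon> * h \<and>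
        U (X, S) - U (r, t) \<le> (h - (S - t)) * \<Lambda> ((r + a * h - X) / (h - (S - t))) - h * \<Lambda> a + \<epsilon> * h)"
  shows "(U has_derivative (\<lambda>(dX, dS). - D * dX + (a * D - \<Lambda> a) * dS)) (at (r, t))"
  unfolding has_derivative_at_alt
proof (intro conjI allI impI)
  have "bounded_linear (\<lambda>q :: real \<times> real. - D * fst q + (a * D - \<Lambda> a) * snd q)"
    by (intro bounded_linear_add bounded_linear_mult_right bounded_linear_compose[OF bounded_linear_mult_right bounded_linear_fst]
        bounded_linear_compose[OF bounded_linear_mult_right bounded_linear_snd])
  then show "bounded_linear (\<lambda>(dX, dS). - D * dX + (a * D - \<Lambda> a) * dS)" by (simp add: case_prod_unfold)
  fix \<kappa> :: real assume \<kappa>: "\<kappa> > 0"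
  \<comment> \<open>As |q (b - a)| is at most (1 + |a|) e, this slope error makes the linearisation
    cost at most \<kappa> e / 4.\<close>
  define k1 where "k1 = \<kappa> / (4 * (1 + \<bar>a\<bar>))"
  have k1: "k1 > 0" using \<kappa> by (simp add: k1_def add_pos_nonneg)
  obtain d where d: "d > 0" "\<And>b. \<bar>b - a\<bar> < d \<Longrightarrow> \<bar>\<Lambda> b - \<Lambda> a - D * (b - a)\<bar> \<le> k1 * \<bar>b - a\<bar>"
    using \<Lambda> k1 unfolding has_field_derivative_def has_derivative_at_alt by (auto simp: real_norm_def)
  \<comment> \<open>M \<ge> 2 puts e below h / 2, where the bounds are available; the second summand
    brings the segment velocities within d of a.\<close>
  define M where "M = 2 + 2 * (1 + \<bar>a\<bar>) / d"
  have M: "M \<ge> 2" "2 * (1 + \<bar>a\<bar>) / M < d"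
  proof -
    show M2: "M \<ge> 2" using d(1) by (simp add: M_def)
    have "2 * (1 + \<bar>a\<bar>) / d < M" by (simp add: M_def)
    then show "2 * (1 + \<bar>a\<bar>) / M < d" using d(1) M2 by (simp add: field_simps)
  qed
  \<comment> \<open>The tolerance is fixed after M: multiplied by h = M e it gives \<kappa> e /
    4.\<close>
  have "\<kappa> / (4 * M) > 0" using \<kappa> M by simp
  from bounds[OF this] obtain e0 where e0: "e0 > 0" and B: "\<And>h X S. 0 < h \<Longrightarrow> h < e0 \<Longrightarrow> \<bar>X - r\<bar> + \<bar>S - t\<bar> \<le> h / 2 \<Longrightarrow>
        U (X, S) - U (r, t) \<ge> h * \<Lambda> a - (h + (S - t)) * \<Lambda> ((X - r + a * h) / (h + (S - t))) - \<kappa> / (4 * M) * h \<and>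
        U (X, S) - U (r, t) \<le> (h - (S - t)) * \<Lambda> ((r + a * h - X) / (h - (S - t))) - h * \<Lambda> a + \<kappa> / (4 * M) * h"
    by blast
  show "\<exists>d>0. \<forall>y. norm (y - (r, t)) < d \<longrightarrow>
     norm (U y - U (r, t) - (case y - (r, t) of (dX, dS) \<Rightarrow> - D * dX + (a * D - \<Lambda> a) * dS)) \<le> \<kappa> * norm (y - (r, t))"
  proof (intro exI[of _ "e0 / (2 * M)"] conjI allI impI)
    show "e0 / (2 * M) > 0" using e0 M by simp
    fix y assume y: "norm (y - (r, t)) < e0 / (2 * M)"
    obtain X S where XS: "y = (X, S)" by (cases y)
    define e where "e = \<bar>X - r\<bar> + \<bar>S - t\<bar>"
    have comp: "\<bar>X - r\<bar> \<le> norm (y - (r, t))" "\<bar>S - t\<bar> \<le> norm (y - (r, t))"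
      using norm_fst_le[of "X - r" "S - t"] norm_snd_le[of "S - t" "X - r"] by (auto simp: XS real_norm_def)
    then have e_le: "e \<le> 2 * norm (y - (r, t))" by (simp add: e_def)
    show "norm (U y - U (r, t) - (case y - (r, t) of (dX, dS) \<Rightarrow> - D * dX + (a * D - \<Lambda> a) * dS)) \<le> \<kappa> * norm (y - (r, t))"
    proof (cases "e = 0")
      case True
      then have "X = r" "S = t" by (auto simp: e_def)
      then show ?thesis by (simp add: XS zero_prod_def)
    next
      case False
      then have e: "e > 0" by (auto simp: e_def)
      define h where "h = M * e"
      have h: "h > 0" "h < e0" "e \<le> h / 2"
      proof -
        show "h > 0" using M e by (simp add: h_def)
        have "M * e \<le> M * (2 * norm (y - (r, t)))" using e_le M by (intro mult_left_mono) auto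
        also have "\<dots> < e0" using y M by (simp add: field_simps)
        finally show "h < e0" by (simp add: h_def)
        show "e \<le> h / 2" using M e by (simp add: h_def)
      qed
      have den: "h + (S - t) \<ge> h / 2" "h - (S - t) \<ge> h / 2" using h(3) unfolding e_def by linarith+
      have close: "\<bar>q * \<Lambda> b - q * \<Lambda> a - D * (q * (b - a))\<bar> \<le> k1 * ((1 + \<bar>a\<bar>) * e)"
        if q: "q \<ge> h / 2" and b: "\<bar>q * (b - a)\<bar> \<le> (1 + \<bar>a\<bar>) * e" for q b
      proof -
        have q0: "q > 0" using q h by linarith
        have "\<bar>b - a\<bar> * (h / 2) \<le> \<bar>b - a\<bar> * q" using q by (intro mult_left_mono) auto
        also have "\<dots> \<le> (1 + \<bar>a\<bar>) * e" using b q0 by (simp add: abs_mult mult.commute)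
        finally have "\<bar>b - a\<bar> * M * e \<le> 2 * (1 + \<bar>a\<bar>) * e" by (simp add: h_def mult_ac)
        then have "\<bar>b - a\<bar> * M \<le> 2 * (1 + \<bar>a\<bar>)" using e by (simp add: mult_le_cancel_right)
        then have "\<bar>b - a\<bar> \<le> 2 * (1 + \<bar>a\<bar>) / M" using M by (simp add: field_simps)
        then have "\<bar>\<Lambda> b - \<Lambda> a - D * (b - a)\<bar> \<le> k1 * \<bar>b - a\<bar>" using M by (intro d) linarith
        then have "q * \<bar>\<Lambda> b - \<Lambda> a - D * (b - a)\<bar> \<le> q * (k1 * \<bar>b - a\<bar>)" using q0 by (intro mult_left_mono) auto
        also have "\<dots> = k1 * \<bar>q * (b - a)\<bar>" using q0 by (simp add: abs_mult mult_ac)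
        also have "\<dots> \<le> k1 * ((1 + \<bar>a\<bar>) * e)" using b k1 by (intro mult_left_mono) auto
        finally have "q * \<bar>\<Lambda> b - \<Lambda> a - D * (b - a)\<bar> \<le> k1 * ((1 + \<bar>a\<bar>) * e)" .
        moreover have "q * \<Lambda> b - q * \<Lambda> a - D * (q * (b - a)) = q * (\<Lambda> b - \<Lambda> a - D * (b - a))" by (simp add: algebra_simps)
        ultimately show ?thesis using q0 by (simp add: abs_mult)
      qed
      have lin: "\<bar>(X - r) - a * (S - t)\<bar> \<le> (1 + \<bar>a\<bar>) * e"
      proof -
        have "\<bar>(X - r) - a * (S - t)\<bar> \<le> \<bar>X - r\<bar> + \<bar>a\<bar> * \<bar>S - t\<bar>" by (metis abs_mult abs_triangle_ineq4)
        also have "\<dots> \<le> e + \<bar>a\<bar> * e" by (intro add_mono mult_left_mono) (auto simp: e_def)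
        finally show ?thesis by (simp add: algebra_simps)
      qed
      have k1e: "k1 * ((1 + \<bar>a\<bar>) * e) = \<kappa> / 4 * e" unfolding k1_def by (simp add: field_simps)
      have k2e: "\<kappa> / (4 * M) * h = \<kappa> / 4 * e" using M by (simp add: h_def)
      have q1: "h + (S - t) > 0" "h - (S - t) > 0" using den h by linarith+
      define b1 where "b1 = (X - r + a * h) / (h + (S - t))"
      define b2 where "b2 = (r + a * h - X) / (h - (S - t))"
      have "(h + (S - t)) * b1 = X - r + a * h" "(h - (S - t)) * b2 = r + a * h - X"
        unfolding b1_def b2_def using q1 by auto
      then have b1: "(h + (S - t)) * (b1 - a) = (X - r) - a * (S - t)"
        and b2: "(h - (S - t)) * (b2 - a) = - ((X - r) - a * (S - t))"
        by (simp_all add: right_diff_distrib) (simp_all add: algebra_simps)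
      have c1: "\<bar>(h + (S - t)) * \<Lambda> b1 - (h + (S - t)) * \<Lambda> a - D * ((X - r) - a * (S - t))\<bar> \<le> \<kappa> / 4 * e"
        using close[OF den(1), of b1] lin unfolding b1 k1e by simp
      have c2: "\<bar>(h - (S - t)) * \<Lambda> b2 - (h - (S - t)) * \<Lambda> a + D * ((X - r) - a * (S - t))\<bar> \<le> \<kappa> / 4 * e"
      proof -
        have "\<bar>(h - (S - t)) * (b2 - a)\<bar> \<le> (1 + \<bar>a\<bar>) * e" unfolding b2 abs_minus_cancel by (rule lin)
        from close[OF den(2) this] show ?thesis unfolding b2 k1e by (simp only: mult_minus_right diff_minus_eq_add)
      qed
      have lo: "U (X, S) - U (r, t) \<ge> h * \<Lambda> a - (h + (S - t)) * \<Lambda> b1 - \<kappa> / 4 * e"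
        and up: "U (X, S) - U (r, t) \<le> (h - (S - t)) * \<Lambda> b2 - h * \<Lambda> a + \<kappa> / 4 * e"
        using B[OF h(1,2), of X S] h(3) unfolding b1_def b2_def k2e e_def by auto
      define V where "V = - D * (X - r) + (a * D - \<Lambda> a) * (S - t)"
      \<comment> \<open>Both linear parts reduce to the same V. The two errors of \<kappa> e / 4 add
        up to \<kappa> e / 2, and e is at most twice the norm of the increment.\<close>
      have v1: "h * \<Lambda> a - (h + (S - t)) * \<Lambda> a - D * ((X - r) - a * (S - t)) = V"
        and v2: "(h - (S - t)) * \<Lambda> a - D * ((X - r) - a * (S - t)) - h * \<Lambda> a = V"
        unfolding V_def by (simp_all add: algebra_simps)
      have "U (X, S) - U (r, t) - V \<ge> - (\<kappa> / 2 * e)" "U (X, S) - U (r, t) - V \<le> \<kappa> / 2 * e"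
        using c1 c2 lo up v1 v2 by linarith+
      then have "\<bar>U (X, S) - U (r, t) - V\<bar> \<le> \<kappa> / 2 * e" by linarith
      also have "\<dots> \<le> \<kappa> / 2 * (2 * norm (y - (r, t)))" using e_le \<kappa> by (intro mult_left_mono) auto
      finally show ?thesis by (simp add: XS V_def)
    qed
  qed
qed

text \<open>The upper bound of the superdifferential and the expansion at a point of
  differentiability are compared along the four coordinate directions, both signs of each, which
  forces equality of the coefficients.\<close>

lemma superdiff_of_differentiable:
  fixes u :: "real^'n::finite \<Rightarrow> real \<Rightarrow> real"
  assumes der: "((\<lambda>(r, \<theta>). u (r *\<^sub>R axis i 1) \<theta>) has_derivative (\<lambda>(dX, dS). q' * dX + \<pi>' * dS)) (at (norm x, t))"
    and x: "x \<in> edge i" "x \<noteq> 0" and t: "0 < t" "t < T" and sd: "(\<pi>, q) \<in> superdiff T u x t"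
  shows "\<pi> = \<pi>'" "q = q'"
proof -
  have key: "(q' - q) * dr + (\<pi>' - \<pi>) * d\<theta> \<le> 2 * \<epsilon>" if \<epsilon>: "\<epsilon> > 0" and unit: "\<bar>dr\<bar> + \<bar>d\<theta>\<bar> = 1" for \<epsilon> dr d\<theta> :: real
  proof -
    have xeq: "x = norm x *\<^sub>R axis i 1" by (rule edge_eq_norm[OF x(1)])
    have nx: "norm x > 0" using x by simp
    let ?f = "\<lambda>(y, \<theta>). ereal ((u y \<theta> - u x t - \<pi> * (\<theta> - t) - q * (norm y - norm x)) / (\<bar>norm y - norm x\<bar> + \<bar>\<theta> - t\<bar>))"
    have "Limsup (at (x, t) within junction \<times> {0<..<T}) ?f \<le> 0" using sd by (simp add: superdiff_def)
    then have "\<forall>\<^sub>F z in at (x, t) within junction \<times> {0<..<T}. ?f z < ereal \<epsilon>"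
      unfolding Limsup_le_iff using \<epsilon> by (auto simp: zero_ereal_def)
    then obtain d1 where d1: "d1 > 0" "\<And>z. z \<in> junction \<times> {0<..<T} \<Longrightarrow> z \<noteq> (x, t) \<Longrightarrow> dist z (x, t) < d1 \<Longrightarrow> ?f z < ereal \<epsilon>"
      unfolding eventually_at by blast
    obtain d2 where d2: "d2 > 0" "\<And>z. norm (z - (norm x, t)) < d2 \<Longrightarrow>
        norm ((\<lambda>(r, \<theta>). u (r *\<^sub>R axis i 1) \<theta>) z - u (norm x *\<^sub>R axis i 1) t - (\<lambda>(dX, dS). q' * dX + \<pi>' * dS) (z - (norm x, t)))
          \<le> \<epsilon> * norm (z - (norm x, t))"
      using der \<epsilon> unfolding has_derivative_at_alt by auto
    \<comment> \<open>Small enough for both estimates, and for the shifted point to stay on the edge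
      and inside the time interval.\<close>
    define s where "s = min (min (d1 / 2) (d2 / 2)) (min (norm x / 2) (min (t / 2) ((T - t) / 2)))"
    have s: "s > 0" "s < d1" "s < d2" "s < norm x" "s < t" "s < T - t"
      using d1(1) d2(1) nx t by (auto simp: s_def min_less_iff_disj)
    have unit': "\<bar>dr\<bar> \<le> 1" "\<bar>d\<theta>\<bar> \<le> 1" using unit by auto
    then have sm: "\<bar>s * dr\<bar> \<le> s" "\<bar>s * d\<theta>\<bar> \<le> s" using s(1) by (auto simp: abs_mult)
    define X where "X = norm x + s * dr"
    define S where "S = t + s * d\<theta>"
    have X: "X > 0" "S \<in> {0<..<T}" using sm s by (auto simp: X_def S_def)
    have nz: "norm ((s * dr, s * d\<theta>) :: real \<times> real) \<le> s"
    proof -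
      have "norm ((s * dr, s * d\<theta>) :: real \<times> real) \<le> \<bar>s * dr\<bar> + \<bar>s * d\<theta>\<bar>"
        using norm_Pair_le[of "s * dr" "s * d\<theta>"] by simp
      also have "\<dots> = s * (\<bar>dr\<bar> + \<bar>d\<theta>\<bar>)" using s(1) by (simp add: abs_mult distrib_left)
      finally show ?thesis using unit by simp
    qed
    have diff: "X *\<^sub>R axis i 1 - x = (s * dr) *\<^sub>R (axis i 1 :: real^'n)"
      by (subst xeq) (simp add: X_def algebra_simps)
    have dd: "dist (X *\<^sub>R axis i 1, S) (x, t) \<le> s"
      using nz by (simp add: dist_norm diff norm_Pair norm_axis_1 S_def)
    have nX: "norm (X *\<^sub>R axis i 1 :: real^'n) = X" using X by (simp add: norm_axis_1)
    have ne: "(X *\<^sub>R axis i 1, S) \<noteq> (x, t)"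
    proof
      assume "(X *\<^sub>R axis i 1, S) = (x, t)"
      then have "X = norm x" "S = t" using nX by auto
      then show False using unit s(1) by (simp add: X_def S_def)
    qed
    have "?f (X *\<^sub>R axis i 1, S) < ereal \<epsilon>"
      using X dd s(2) ne by (intro d1(2)) (auto intro: edge_line)
    moreover have "\<bar>norm (X *\<^sub>R axis i 1 :: real^'n) - norm x\<bar> + \<bar>S - t\<bar> = s"
      unfolding nX using s(1) unit by (simp add: X_def S_def abs_mult distrib_left[symmetric])
    ultimately have "(u (X *\<^sub>R axis i 1) S - u x t - \<pi> * (S - t) - q * (X - norm x)) / s < \<epsilon>"
      using nX by simp
    then have 1: "u (X *\<^sub>R axis i 1) S - u x t - \<pi> * (s * d\<theta>) - q * (s * dr) < \<epsilon> * s"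
      using s(1) by (simp add: divide_less_eq X_def S_def)
    have "norm ((X, S) - (norm x, t)) \<le> s" using nz by (simp add: X_def S_def)
    then have "\<bar>u (X *\<^sub>R axis i 1) S - u x t - (q' * (s * dr) + \<pi>' * (s * d\<theta>))\<bar> \<le> \<epsilon> * norm ((X, S) - (norm x, t))"
      using d2(2)[of "(X, S)"] s(3) xeq[symmetric] by (simp add: X_def S_def)
    also have "\<dots> \<le> \<epsilon> * s" using \<open>norm ((X, S) - (norm x, t)) \<le> s\<close> \<epsilon> by (intro mult_left_mono) auto
    finally have "(q' * (s * dr) + \<pi>' * (s * d\<theta>)) - \<pi> * (s * d\<theta>) - q * (s * dr) < 2 * (\<epsilon> * s)" using 1 by linarith
    then have "s * ((q' - q) * dr + (\<pi>' - \<pi>) * d\<theta>) < s * (2 * \<epsilon>)" by (simp add: algebra_simps)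
    then show ?thesis using s(1) by simp
  qed
  have le0: "c \<le> 0" if "\<And>\<epsilon>. \<epsilon> > 0 \<Longrightarrow> c \<le> 2 * \<epsilon>" for c :: real
    using that[of "c / 4"] by (cases "c > 0") auto
  have "q' - q \<le> 0" using key[of _ 1 0] by (intro le0) simp
  moreover have "q - q' \<le> 0" using key[of _ "-1" 0] by (intro le0) simp
  moreover have "\<pi>' - \<pi> \<le> 0" using key[of _ 0 1] by (intro le0) simp
  moreover have "\<pi> - \<pi>' \<le> 0" using key[of _ 0 "-1"] by (intro le0) simp
  ultimately show "\<pi> = \<pi>'" "q = q'" by auto
qed

section \<open>Comparison of values with the costs of segments\<close>

context mfg_costs
begin

text \<open>By the tangent inequality the supremum is attained at the velocity a: this is equality
  in Fenchel's inequality.\<close>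

lemma hamiltonian_at_slope:
  assumes "s \<in> {0..T}" "r \<ge> 0"
  shows "hamiltonian L m i r (- La i s r a) s = a * La i s r a - L i (m s) r a"
  unfolding hamiltonian_def
proof (rule cSup_eq_maximum)
  show "a * La i s r a - L i (m s) r a \<in> range (\<lambda>\<zeta>. - (- La i s r a) * \<zeta> - L i (m s) r \<zeta>)"
    by (intro image_eqI[of _ _ a]) auto
  fix z assume "z \<in> range (\<lambda>\<zeta>. - (- La i s r a) * \<zeta> - L i (m s) r \<zeta>)"
  then obtain \<zeta> where "z = La i s r a * \<zeta> - L i (m s) r \<zeta>" by auto
  then show "z \<le> a * La i s r a - L i (m s) r a"
    using L_tangent[OF assms, of i a \<zeta>] by (simp add: algebra_simps)
qed

lemma trajs_restrict_path:
  assumes \<mu>: "\<And>s. s \<in> {0..T} \<Longrightarrow> marginal \<mu> s = m s" and z: "ac_path p t T z w" and t: "0 \<le> t" "t < T"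
  shows "restrict z {t..T} \<in> trajs p T t (z t)"
    "cost T L Ls G Gs \<mu> t (restrict z {t..T}) = integral {t..T} (lagr z w) + final_cost G Gs (m T) (z T)"
proof -
  have z': "ac_path p t T (restrict z {t..T}) w"
    by (rule ac_path_cong[OF z, where N="{}"]) (use t in auto)
  show "restrict z {t..T} \<in> trajs p T t (z t)"
    unfolding trajs_iff_ac_path[OF t(2) p] using z' t by auto
  have "integral {t..T} (lagr (restrict z {t..T}) w) = integral {t..T} (lagr z w)"
    by (intro Henstock_Kurzweil_Integration.integral_cong) (simp add: lagr_def)
  then show "cost T L Ls G Gs \<mu> t (restrict z {t..T}) = integral {t..T} (lagr z w) + final_cost G Gs (m T) (z T)"
    using cost_eq[OF \<mu> z' t] t by simp
qed

text \<open>A real infimum is below its terms only when they are bounded below; coercivity and the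
  bounded final cost provide that.\<close>

lemma cost_bdd_below:
  assumes \<mu>: "\<And>s. s \<in> {0..T} \<Longrightarrow> marginal \<mu> s = m s" and t: "0 \<le> t" "t < T"
  shows "bdd_below (cost T L Ls G Gs \<mu> t ` trajs p T t x)"
proof -
  obtain C0 where C0: "C0 > 0" "\<And>y v s. s \<in> {0..T} \<Longrightarrow> (y s :: real^'n) \<in> junction \<Longrightarrow> lagr y v s \<ge> - C0"
    using lagr_lower_bound by blast
  obtain B where B: "\<And>x :: real^'n. x \<in> junction \<Longrightarrow> \<bar>final_cost G Gs (m T) x\<bar> \<le> B"
    using final_cost_bounded by blast
  have "- C0 * (T - t) - B \<le> cost T L Ls G Gs \<mu> t z" if z: "z \<in> trajs p T t x" for z
  proof -
    obtain w where w: "ac_path p t T z w" using z trajs_iff_ac_path[OF t(2) p] by blast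
    have "integral {t..T} (\<lambda>_. - C0) \<le> integral {t..T} (lagr z w)"
      using t by (intro Henstock_Kurzweil_Integration.integral_le absint_imp_int absint_const lagr_absint[OF w] C0 ac_path_in_junction[OF w]) auto
    moreover have "integral {t..T} (\<lambda>_. - C0) = - C0 * (T - t)" using t by (simp add: mult.commute)
    moreover have "\<bar>final_cost G Gs (m T) (z T)\<bar> \<le> B" using t by (intro B ac_path_in_junction[OF w]) auto
    ultimately show ?thesis using cost_eq[OF \<mu> w t] by linarith
  qed
  then show ?thesis by (intro bdd_belowI2)
qed

lemma integral_lagr_join:
  assumes L: "ac_path p a b y v" and R: "ac_path p b c z w" and "y b = z b" "0 \<le> a" "a \<le> b" "b \<le> c" "c \<le> T"
  shows "integral {a..c} (lagr (\<lambda>s. if s \<le> b then y s else z s) (\<lambda>s. if s \<le> b then v s else w s))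
    = integral {a..b} (lagr y v) + integral {b..c} (lagr z w)" (is "integral _ (lagr ?y ?v) = _")
proof -
  have J: "ac_path p a c ?y ?v" by (rule ac_path_join) fact+
  have "lagr ?y ?v integrable_on {a..c}" using assms by (intro absint_imp_int lagr_absint[OF J]) auto
  then have "integral {a..c} (lagr ?y ?v) = integral {a..b} (lagr ?y ?v) + integral {b..c} (lagr ?y ?v)"
    using assms by (intro Henstock_Kurzweil_Integration.integral_combine[symmetric])
  also have "integral {a..b} (lagr ?y ?v) = integral {a..b} (lagr y v)"
    by (intro Henstock_Kurzweil_Integration.integral_cong) (simp add: lagr_def speed_def)
  also have "integral {b..c} (lagr ?y ?v) = integral {b..c} (lagr z w)"
    by (intro integral_spike[of "{b}"]) (auto simp: lagr_def speed_def)
  finally show ?thesis .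
qed

definition line_cost :: "'n \<Rightarrow> real \<Rightarrow> real \<Rightarrow> real \<Rightarrow> real \<Rightarrow> real" where
  "line_cost i a b r c = integral {a..b} (\<lambda>s. L i (m s) (r + c * (s - a)) c)"

lemma lagr_line:
  assumes "r > 0" "r + c * (b - a) > 0" "a \<le> b"
  shows "integral {a..b} (lagr (\<lambda>s. (r + c * (s - a)) *\<^sub>R axis i 1) (\<lambda>_. c *\<^sub>R axis i 1)) = line_cost i a b r c"
  unfolding line_cost_def
proof (intro Henstock_Kurzweil_Integration.integral_cong)
  fix s assume s: "s \<in> {a..b}"
  have "r + c * (s - a) > 0"
  proof (cases "c \<ge> 0")
    case False
    then have "c * (b - a) \<le> c * (s - a)" using s by (intro mult_left_mono_neg) auto
    then show ?thesis using assms by linarith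
  qed (use assms s in \<open>auto intro: add_pos_nonneg\<close>)
  moreover have "speed (\<lambda>_. c *\<^sub>R (axis i 1 :: real^'n)) s = c"
  proof -
    have "(\<Sum>j\<in>UNIV. (axis i 1 :: real^'n) $ j) = 1" by (simp add: axis_def)
    then show ?thesis unfolding speed_def by (simp add: sum_distrib_left[symmetric])
  qed
  ultimately show "lagr (\<lambda>s. (r + c * (s - a)) *\<^sub>R axis i 1) (\<lambda>_. c *\<^sub>R axis i 1) s = L i (m s) (r + c * (s - a)) c"
    by (simp add: lagr_def running_cost_edge)
qed

text \<open>A reference level attached to y: values at nearby points are measured against it, and it
  cancels when they are subtracted.\<close>

definition remaining_cost :: "(real \<Rightarrow> real^'n) \<Rightarrow> (real \<Rightarrow> real^'n) \<Rightarrow> real \<Rightarrow> real" where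
  "remaining_cost y v s = integral {s..T} (lagr y v) + final_cost G Gs (m T) (y T)"

lemma remaining_cost_split:
  assumes y: "ac_path p 0 T y v" and "0 \<le> a" "a \<le> b" "b \<le> T"
  shows "remaining_cost y v a = integral {a..b} (lagr y v) + remaining_cost y v b"
proof -
  have "lagr y v integrable_on {a..T}"
    using assms by (intro absint_imp_int absint_sub[OF lagr_absint[OF y]]) auto
  then show ?thesis
    unfolding remaining_cost_def using Henstock_Kurzweil_Integration.integral_combine[of a b T "lagr y v"] assms by simp
qed

text \<open>The competitor runs along the segment from (X, S) to y b and then follows y.\<close>

lemma value_le:
  assumes \<mu>: "\<And>s. s \<in> {0..T} \<Longrightarrow> marginal \<mu> s = m s" and y: "ac_path p 0 T y v"
    and S: "0 \<le> S" "S < b" "b < T" and X: "X > 0" and yb: "y b = R *\<^sub>R axis i 1" "R > 0"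
  shows "(INF z\<in>trajs p T S (X *\<^sub>R axis i 1). cost T L Ls G Gs \<mu> S z)
    \<le> line_cost i S b X ((R - X) / (b - S)) + remaining_cost y v b"
proof -
  define c where "c = (R - X) / (b - S)"
  have c: "X + c * (b - S) = R" using S by (simp add: c_def)
  have line: "ac_path p S b (\<lambda>s. (X + c * (s - S)) *\<^sub>R axis i 1) (\<lambda>_. c *\<^sub>R axis i 1)"
    using S X yb c by (intro ac_path_line) auto
  have yb': "ac_path p b T y v" using S by (intro ac_path_sub[OF y]) auto
  have meet: "(X + c * (b - S)) *\<^sub>R axis i 1 = y b" unfolding c yb ..
  define z where "z = (\<lambda>s. if s \<le> b then (X + c * (s - S)) *\<^sub>R axis i 1 else y s)"
  define w where "w = (\<lambda>s. if s \<le> b then c *\<^sub>R axis i 1 else v s)"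
  have z: "ac_path p S T z w" unfolding z_def w_def using S by (intro ac_path_join[OF line yb'] meet) auto
  have zS: "z S = X *\<^sub>R axis i 1" "z T = y T" using S by (auto simp: z_def)
  have S': "S < T" using S by simp
  note tr = trajs_restrict_path[OF \<mu> z S(1) S']
  have "integral {S..T} (lagr z w) = line_cost i S b X c + integral {b..T} (lagr y v)"
    unfolding z_def w_def using S X yb c
    by (subst integral_lagr_join[OF line yb' meet]) (auto simp: lagr_line)
  then have "cost T L Ls G Gs \<mu> S (restrict z {S..T}) = line_cost i S b X c + remaining_cost y v b"
    using tr(2) zS by (simp add: remaining_cost_def)
  moreover have "(INF z\<in>trajs p T S (X *\<^sub>R axis i 1). cost T L Ls G Gs \<mu> S z) \<le> cost T L Ls G Gs \<mu> S (restrict z {S..T})"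
    using tr(1) zS by (intro cINF_lower cost_bdd_below[OF \<mu> S(1) S']) auto
  ultimately show ?thesis by (simp add: c_def)
qed

text \<open>Each competitor z from (X, S) is made into one for y: y up to a, the segment to (X, S),
  then z. Optimality of y from time 0 bounds the cost of z from below, uniformly in z.\<close>

lemma value_ge:
  assumes \<mu>: "\<And>s. s \<in> {0..T} \<Longrightarrow> marginal \<mu> s = m s" and opt: "optimal y v"
    and S: "0 \<le> a" "a < S" "S < T" and X: "X > 0" and ya: "y a = R *\<^sub>R axis i 1" "R > 0"
  shows "(INF z\<in>trajs p T S (X *\<^sub>R axis i 1). cost T L Ls G Gs \<mu> S z)
    \<ge> remaining_cost y v a - line_cost i a S R ((X - R) / (S - a))"
proof -
  have y: "ac_path p 0 T y v" using opt by (simp add: optimal_def)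
  define c where "c = (X - R) / (S - a)"
  have c: "R + c * (S - a) = X" using S by (simp add: c_def)
  have S0: "0 \<le> S" using S by simp
  show ?thesis
  proof (rule cINF_greatest)
    \<comment> \<open>The path resting at X shows that there are competitors at all, as a lower
      bound for the infimum requires.\<close>
    have "ac_path p S T (\<lambda>s. (X + 0 * (s - S)) *\<^sub>R axis i 1 :: real^'n) (\<lambda>_. 0 *\<^sub>R axis i 1)"
      using S X by (intro ac_path_line) auto
    from trajs_restrict_path(1)[OF \<mu> this S0 S(3)]
    show "trajs p T S (X *\<^sub>R axis i 1 :: real^'n) \<noteq> {}" by auto
    fix z assume z: "z \<in> trajs p T S (X *\<^sub>R axis i 1 :: real^'n)"
    then obtain w where w: "ac_path p S T z w" and zS: "z S = X *\<^sub>R axis i 1"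
      using trajs_iff_ac_path[OF S(3) p] by blast
    have line: "ac_path p a S (\<lambda>s. (R + c * (s - a)) *\<^sub>R axis i 1) (\<lambda>_. c *\<^sub>R axis i 1)"
      using S X ya c by (intro ac_path_line) auto
    have y0a: "ac_path p 0 a y v" using S by (intro ac_path_sub[OF y]) auto
    have meet: "y a = (R + c * (a - a)) *\<^sub>R axis i 1" using ya by simp
    define z1 where "z1 = (\<lambda>s. if s \<le> a then y s else (R + c * (s - a)) *\<^sub>R axis i 1)"
    define w1 where "w1 = (\<lambda>s. if s \<le> a then v s else c *\<^sub>R axis i 1)"
    have p1: "ac_path p 0 S z1 w1" unfolding z1_def w1_def using S by (intro ac_path_join[OF y0a line] meet) auto
    have i1: "integral {0..S} (lagr z1 w1) = integral {0..a} (lagr y v) + line_cost i a S R c"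
      unfolding z1_def w1_def using S X ya c by (subst integral_lagr_join[OF y0a line meet]) (auto simp: lagr_line)
    have meet1: "z1 S = z S" using S c zS by (simp add: z1_def)
    define z2 where "z2 = (\<lambda>s. if s \<le> S then z1 s else z s)"
    define w2 where "w2 = (\<lambda>s. if s \<le> S then w1 s else w s)"
    have p2: "ac_path p 0 T z2 w2" unfolding z2_def w2_def using S by (intro ac_path_join[OF p1 w] meet1) auto
    have i2: "integral {0..T} (lagr z2 w2) = integral {0..S} (lagr z1 w1) + integral {S..T} (lagr z w)"
      unfolding z2_def w2_def using S by (subst integral_lagr_join[OF p1 w meet1]) auto
    have "z2 0 = y 0" using S by (simp add: z2_def z1_def)
    then have "total_cost y v \<le> total_cost z2 w2" using opt p2 unfolding optimal_def by blast
    moreover have "total_cost y v = integral {0..a} (lagr y v) + remaining_cost y v a"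
      using remaining_cost_split[OF y, of 0 a] S by (simp add: total_cost_def remaining_cost_def)
    moreover have "total_cost z2 w2 = integral {0..a} (lagr y v) + line_cost i a S R c + cost T L Ls G Gs \<mu> S z"
      unfolding total_cost_def i2 i1 using S cost_eq[OF \<mu> w S0 S(3)] by (simp add: z2_def)
    ultimately show "remaining_cost y v a - line_cost i a S R ((X - R) / (S - a)) \<le> cost T L Ls G Gs \<mu> S z"
      by (simp add: c_def)
  qed
qed

end

lemma integral_ge_ae:
  fixes f :: "real \<Rightarrow> real"
  assumes f: "f integrable_on {c..d}" and N: "negligible N" and ge: "\<And>s. s \<in> {c..d} - N \<Longrightarrow> k \<le> f s" and "c \<le> d"
  shows "k * (d - c) \<le> integral {c..d} f"
proof -
  define g where "g = (\<lambda>s. if s \<in> N then k else f s)"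
  have g: "g integrable_on {c..d}" by (rule integrable_spike[OF f N]) (simp add: g_def)
  have "integral {c..d} (\<lambda>_. k) \<le> integral {c..d} g"
    using ge by (intro Henstock_Kurzweil_Integration.integral_le g absint_imp_int absint_const) (auto simp: g_def)
  also have "integral {c..d} g = integral {c..d} f" by (rule integral_spike[OF N]) (simp add: g_def)
  finally show ?thesis using \<open>c \<le> d\<close> by (simp add: mult.commute)
qed

text \<open>The velocity is controlled only off a null set that may contain t, so a is a cluster
  value along times that tend to t outside it. The oscillation bound passes to the limit with the
  same \<eta>.\<close>

lemma essential_limit:
  fixes w :: "real \<Rightarrow> real"
  assumes "\<delta> > 0" and N: "negligible N" and K: "\<And>s. s \<in> {t - \<delta>..t + \<delta>} - N \<Longrightarrow> \<bar>w s\<bar> \<le> K"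
    and \<eta>: "\<And>\<epsilon>. \<epsilon> > 0 \<Longrightarrow> \<eta> \<epsilon> > 0"
    and osc: "\<And>\<epsilon> s s'. \<epsilon> > 0 \<Longrightarrow> s \<in> {t - \<delta>..t + \<delta>} - N \<Longrightarrow> s' \<in> {t - \<delta>..t + \<delta>} - N \<Longrightarrow> \<bar>s - s'\<bar> < \<eta> \<epsilon> \<Longrightarrow> \<bar>w s - w s'\<bar> \<le> \<epsilon>"
  shows "\<exists>a. \<bar>a\<bar> \<le> K \<and> (\<forall>\<epsilon>>0. \<forall>s\<in>{t - \<delta>..t + \<delta>} - N. \<bar>s - t\<bar> < \<eta> \<epsilon> \<longrightarrow> \<bar>w s - a\<bar> \<le> \<epsilon>)"
proof -
  have "\<exists>s. s \<in> {t - \<delta>..t + \<delta>} - N \<and> \<bar>s - t\<bar> < 1 / Suc k" for k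
  proof -
    define e where "e = min \<delta> (1 / Suc k)"
    have "e > 0" using \<open>\<delta> > 0\<close> by (simp add: e_def)
    have "\<not> negligible (ball t e)" using \<open>e > 0\<close> by (intro open_not_negligible) auto
    then have "\<not> ball t e \<subseteq> N" using negligible_subset[OF N] by blast
    then obtain s where "s \<in> ball t e" "s \<notin> N" by blast
    moreover from this have "\<bar>s - t\<bar> < e" by (simp add: dist_real_def abs_minus_commute)
    ultimately show ?thesis by (intro exI[of _ s]) (auto simp: e_def)
  qed
  then obtain \<sigma> where \<sigma>: "\<And>k. \<sigma> k \<in> {t - \<delta>..t + \<delta>} - N" "\<And>k. \<bar>\<sigma> k - t\<bar> < 1 / Suc k" by metis
  have "w (\<sigma> k) \<in> {-K..K}" for k using K[OF \<sigma>(1), of k] by auto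
  then have "\<forall>k. (\<lambda>k. w (\<sigma> k)) k \<in> {-K..K}" by blast
  then have "\<exists>a\<in>{-K..K}. \<exists>r. strict_mono r \<and> ((\<lambda>k. w (\<sigma> k)) \<circ> r) \<longlonglongrightarrow> a"
    by (rule compact_imp_seq_compact[OF compact_Icc, unfolded seq_compact_def, THEN spec[of _ "\<lambda>k. w (\<sigma> k)"], THEN mp])
  then obtain a r where a: "a \<in> {-K..K}" "strict_mono (r :: nat \<Rightarrow> nat)" "(\<lambda>k. w (\<sigma> (r k))) \<longlonglongrightarrow> a"
    unfolding o_def by blast
  have "(\<lambda>k. \<sigma> k - t) \<longlonglongrightarrow> 0"
    by (rule Lim_null_comparison[OF _ LIMSEQ_Suc[OF lim_const_over_n[of 1]]])
      (use \<sigma>(2) in \<open>auto intro!: always_eventually less_imp_le simp del: of_nat_Suc\<close>)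
  then have "\<sigma> \<longlonglongrightarrow> t" by (simp add: LIM_zero_iff)
  then have \<sigma>r: "(\<lambda>k. \<sigma> (r k)) \<longlonglongrightarrow> t" using LIMSEQ_subseq_LIMSEQ[OF _ a(2)] by (simp add: o_def)
  have "\<bar>w s - a\<bar> \<le> \<epsilon>" if "\<epsilon> > 0" "s \<in> {t - \<delta>..t + \<delta>} - N" "\<bar>s - t\<bar> < \<eta> \<epsilon>" for \<epsilon> s
  proof (rule tendsto_upperbound)
    show "(\<lambda>k. \<bar>w s - w (\<sigma> (r k))\<bar>) \<longlonglongrightarrow> \<bar>w s - a\<bar>" by (intro tendsto_intros a)
    have "(\<lambda>k. \<bar>s - \<sigma> (r k)\<bar>) \<longlonglongrightarrow> \<bar>s - t\<bar>" by (intro tendsto_intros \<sigma>r)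
    then have "\<forall>\<^sub>F k in sequentially. \<bar>s - \<sigma> (r k)\<bar> < \<eta> \<epsilon>" using that(3) by (rule order_tendstoD)
    then show "\<forall>\<^sub>F k in sequentially. \<bar>w s - w (\<sigma> (r k))\<bar> \<le> \<epsilon>"
      by eventually_elim (use osc[OF that(1,2) \<sigma>(1)] in blast)
  qed auto
  then show ?thesis using a(1) by (intro exI[of _ a]) auto
qed

context mfg_costs
begin

definition edge_value :: "(real \<Rightarrow> real^'n) measure \<Rightarrow> 'n \<Rightarrow> real \<times> real \<Rightarrow> real" where
  "edge_value \<mu> i = (\<lambda>(X, S). INF z\<in>trajs p T S (X *\<^sub>R axis i 1). cost T L Ls G Gs \<mu> S z)"

lemma line_cost_le:
  assumes "0 \<le> a" "a \<le> b" "b \<le> T" and ends: "\<bar>r1 - r\<bar> \<le> d" "\<bar>r1 + c * (b - a) - r\<bar> \<le> d" "d < r"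
    and bound: "\<And>s \<xi>. s \<in> {a..b} \<Longrightarrow> \<bar>\<xi> - r\<bar> \<le> d \<Longrightarrow> L i (m s) \<xi> c \<le> k"
  shows "line_cost i a b r1 c \<le> (b - a) * k"
proof -
  have pos: "\<bar>r1 + c * (s - a) - r\<bar> \<le> d" if s: "s \<in> {a..b}" for s
  proof (cases "c \<ge> 0")
    case True
    then have "0 \<le> c * (s - a)" "c * (s - a) \<le> c * (b - a)" using s by (auto intro: mult_left_mono)
    then show ?thesis using ends by linarith
  next
    case False
    then have "c * (s - a) \<le> 0" "c * (b - a) \<le> c * (s - a)" using s by (auto intro: mult_nonpos_nonneg mult_left_mono_neg)
    then show ?thesis using ends by linarith
  qed
  have "continuous_on {a..b} (\<lambda>s. (\<lambda>(s, x, a). L i (m s) x a) (s, r1 + c * (s - a), c))"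
  proof (rule continuous_on_compose2[OF L_continuous])
    show "continuous_on {a..b} (\<lambda>s. (s, r1 + c * (s - a), c))" by (intro continuous_intros)
    have "0 \<le> r1 + c * (s - a)" if "s \<in> {a..b}" for s using pos[OF that] ends(3) by linarith
    then show "(\<lambda>s. (s, r1 + c * (s - a), c)) ` {a..b} \<subseteq> {0..T} \<times> {0..} \<times> UNIV" using assms by auto
  qed
  then have "(\<lambda>s. L i (m s) (r1 + c * (s - a)) c) integrable_on {a..b}" by (intro integrable_continuous_real) simp
  then have "line_cost i a b r1 c \<le> integral {a..b} (\<lambda>_. k)"
    unfolding line_cost_def using bound pos
    by (intro Henstock_Kurzweil_Integration.integral_le absint_imp_int[OF absint_const]) auto
  then show ?thesis using assms by simp
qed

text \<open>The trajectory \<open>y\<close> almost passes through \<open>(r, t)\<close> with velocity almost \<open>a\<close>. Comparing it with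
  segments joining \<open>(X, S)\<close> to \<open>y (t - h)\<close> and to \<open>y (t + h)\<close> bounds the value at \<open>(X, S)\<close> from below
  and from above.\<close>

lemma value_rescaled_bounds:
  assumes \<mu>: "\<And>s. s \<in> {0..T} \<Longrightarrow> marginal \<mu> s = m s" and \<delta>: "\<delta> > 0" "0 \<le> t - \<delta>" "t + \<delta> \<le> T" and r: "r > 0"
    and near: "\<And>\<epsilon>. \<epsilon> > 0 \<Longrightarrow> \<exists>\<eta>>0. \<forall>\<rho>>0. \<exists>y v N. optimal y v \<and> (\<forall>s\<in>{t - \<delta>..t + \<delta>}. y s \<in> edge i) \<and>
       \<bar>norm (y t) - r\<bar> < \<rho> \<and> negligible N \<and> (\<forall>s\<in>{t - \<delta>..t + \<delta>} - N. \<bar>s - t\<bar> < \<eta> \<longrightarrow> \<bar>speed v s - a\<bar> \<le> \<epsilon>)"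
    and \<epsilon>: "\<epsilon> > 0"
  defines "\<Lambda> \<equiv> L i (m t) r"
  shows "\<exists>e>0. \<forall>h. 0 < h \<and> h < e \<longrightarrow> (\<forall>X S. \<bar>X - r\<bar> + \<bar>S - t\<bar> \<le> h / 2 \<longrightarrow>
        edge_value \<mu> i (X, S) - edge_value \<mu> i (r, t) \<ge> h * \<Lambda> a - (h + (S - t)) * \<Lambda> ((X - r + a * h) / (h + (S - t))) - \<epsilon> * h \<and>
        edge_value \<mu> i (X, S) - edge_value \<mu> i (r, t) \<le> (h - (S - t)) * \<Lambda> ((r + a * h - X) / (h - (S - t))) - h * \<Lambda> a + \<epsilon> * h)"
proof -
  \<comment> \<open>Each one-sided estimate below has error 5 \<epsilon>2 h: 2 from the action of y
    over a time h and 2 per unit of time from a segment, which lasts at most 3 h / 2. Two of them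
    are subtracted, and 10 is below 12.\<close>
  define \<epsilon>2 where "\<epsilon>2 = \<epsilon> / 12"
  have \<epsilon>2: "\<epsilon>2 > 0" using \<epsilon> by (simp add: \<epsilon>2_def)
  \<comment> \<open>Bounds all velocities that occur: the ideal segment velocities are at most 2 |a|
    + 1, the actual ones are within 1 of them, and that of y is within 1 of a.\<close>
  define A where "A = 2 * \<bar>a\<bar> + 3"
  define D where "D = {0..T} \<times> {0..2 * r} \<times> {-A..A}"
  have "compact D" unfolding D_def by (intro compact_Times) auto
  moreover have "continuous_on D (\<lambda>(s, x, a). L i (m s) x a)"
    by (rule continuous_on_subset[OF L_continuous]) (auto simp: D_def)
  ultimately have "uniformly_continuous_on D (\<lambda>(s, x, a). L i (m s) x a)"
    by (rule compact_uniformly_continuous[rotated])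
  then obtain d where d: "d > 0" "\<And>q q'. q \<in> D \<Longrightarrow> q' \<in> D \<Longrightarrow> dist q' q < d \<Longrightarrow>
      dist ((\<lambda>(s, x, a). L i (m s) x a) q') ((\<lambda>(s, x, a). L i (m s) x a) q) < \<epsilon>2"
    unfolding uniformly_continuous_on_def using \<epsilon>2 by metis
  have t: "t \<in> {0..T}" using \<delta> by auto
  \<comment> \<open>Deviations of d / 3 in time and position stay below d together; r / 2 keeps
    positions positive and below 2 r.\<close>
  define r' where "r' = min (d / 3) (r / 2)"
  have r': "r' > 0" "r' < r" using d(1) r by (auto simp: r'_def)
  have Lclose: "\<bar>L i (m s) \<xi> b - \<Lambda> b\<bar> \<le> \<epsilon>2"
    if "s \<in> {0..T}" "\<bar>s - t\<bar> \<le> r'" "\<bar>\<xi> - r\<bar> \<le> r'" "\<bar>b\<bar> \<le> A" for s \<xi> b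
  proof -
    have "dist (s, \<xi>, b) (t, r, b) \<le> \<bar>s - t\<bar> + \<bar>\<xi> - r\<bar>"
      using sqrt_sum_squares_le_sum_abs[of "dist s t" "dist \<xi> r"] by (simp add: dist_Pair_Pair dist_real_def)
    then have "dist (s, \<xi>, b) (t, r, b) < d" using that d(1) by (auto simp: r'_def)
    moreover have "\<bar>\<xi> - r\<bar> \<le> r / 2" using that(3) by (simp add: r'_def)
    then have "0 \<le> \<xi>" "\<xi> \<le> 2 * r" using r by linarith+
    then have "(s, \<xi>, b) \<in> D" "(t, r, b) \<in> D" using that t r by (auto simp: D_def)
    ultimately show ?thesis using d(2)[of "(t, r, b)" "(s, \<xi>, b)"] by (simp add: dist_real_def \<Lambda>_def)
  qed
  define \<epsilon>3 where "\<epsilon>3 = d / 2"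
  have \<Lambda>close: "\<bar>\<Lambda> b - \<Lambda> b'\<bar> \<le> \<epsilon>2" if "\<bar>b\<bar> \<le> A" "\<bar>b'\<bar> \<le> A" "\<bar>b - b'\<bar> \<le> \<epsilon>3" for b b'
  proof -
    have "dist (t, r, b) (t, r, b') < d" using that d(1) by (simp add: dist_Pair_Pair dist_real_def \<epsilon>3_def)
    moreover have "(t, r, b) \<in> D" "(t, r, b') \<in> D" using that t r by (auto simp: D_def)
    ultimately show ?thesis using d(2)[of "(t, r, b')" "(t, r, b)"] by (simp add: dist_real_def \<Lambda>_def)
  qed
  \<comment> \<open>The endpoints of y are off by at most 2 \<epsilon>1 h, and a segment lasts at
    least h / 2, so its velocity is off by at most 4 \<epsilon>1.\<close>
  define \<epsilon>1 where "\<epsilon>1 = min (\<epsilon>3 / 4) (1 / 4)"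
  have \<epsilon>1: "\<epsilon>1 > 0" "4 * \<epsilon>1 \<le> \<epsilon>3" "4 * \<epsilon>1 \<le> 1" using d(1) by (auto simp: \<epsilon>1_def \<epsilon>3_def)
  obtain \<eta> where \<eta>: "\<eta> > 0" "\<And>\<rho>. \<rho> > 0 \<Longrightarrow> \<exists>y v N. optimal y v \<and> (\<forall>s\<in>{t - \<delta>..t + \<delta>}. y s \<in> edge i) \<and>
       \<bar>norm (y t) - r\<bar> < \<rho> \<and> negligible N \<and> (\<forall>s\<in>{t - \<delta>..t + \<delta>} - N. \<bar>s - t\<bar> < \<eta> \<longrightarrow> \<bar>speed v s - a\<bar> \<le> \<epsilon>1)"
    using near[OF \<epsilon>1(1)] by blast
  \<comment> \<open>The last bound gives (|a| + 3) h \<le> r', which keeps y within r' of r on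
    [t - h, t + h].\<close>
  define e where "e = min (min \<eta> \<delta>) (r' / (\<bar>a\<bar> + 3))"
  have "e > 0" using \<eta>(1) \<delta>(1) r' by (simp add: e_def add_nonneg_pos)
  show ?thesis
  proof (intro exI[of _ e] conjI allI impI)
    show "e > 0" by fact
    fix h X S assume h: "0 < h \<and> h < e" and XS: "\<bar>X - r\<bar> + \<bar>S - t\<bar> \<le> h / 2"
    have h1: "h > 0" "h < \<eta>" "h < \<delta>" using h by (auto simp: e_def)
    have h2: "(\<bar>a\<bar> + 3) * h \<le> r'"
    proof -
      have "h \<le> r' / (\<bar>a\<bar> + 3)" using h by (simp add: e_def)
      then show ?thesis by (simp add: pos_le_divide_eq add_nonneg_pos mult.commute)
    qed
    have ah: "\<bar>a\<bar> * h \<ge> 0" using h1 by simp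
    have hr: "h \<le> r'" using h2 ah h1 unfolding distrib_right by linarith
    \<comment> \<open>The trajectory is chosen after h, and its distance from r at time t is small
      compared with h. This is possible because \<eta>, and with it e, does not depend on
      \<rho>.\<close>
    have "\<epsilon>1 * h > 0" using \<epsilon>1 h1 by simp
    from \<eta>(2)[OF this] obtain y v N where opt: "optimal y v" and edge: "\<And>s. s \<in> {t - \<delta>..t + \<delta>} \<Longrightarrow> y s \<in> edge i"
      and yt: "\<bar>norm (y t) - r\<bar> < \<epsilon>1 * h" and N: "negligible N"
      and vel: "\<And>s. s \<in> {t - \<delta>..t + \<delta>} - N \<Longrightarrow> \<bar>s - t\<bar> < \<eta> \<Longrightarrow> \<bar>speed v s - a\<bar> \<le> \<epsilon>1" by blast
    have y: "ac_path p 0 T y v" using opt by (simp add: optimal_def)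
    have vel': "\<bar>speed v s - a\<bar> \<le> \<epsilon>1" if "s \<in> {t - h..t + h} - N" for s
      using that h1 by (intro vel) auto
    have incr: "\<bar>norm (y d') - norm (y c) - a * (d' - c)\<bar> \<le> \<epsilon>1 * (d' - c)" if cd: "t - h \<le> c" "c \<le> d'" "d' \<le> t + h" for c d'
    proof -
      have yc: "ac_path p c d' y v" using cd h1 \<delta> by (intro ac_path_sub[OF y]) auto
      have si: "speed v integrable_on {c..d'}" by (intro absint_imp_int speed_absint ac_path_absint[OF yc])
      have n: "norm (y d') - norm (y c) = integral {c..d'} (speed v)" using ac_path_norm[OF yc, of d'] cd by simp
      have vs: "\<bar>speed v s - a\<bar> \<le> \<epsilon>1" if "s \<in> {c..d'} - N" for s using that cd by (intro vel') auto
      have "(a - \<epsilon>1) * (d' - c) \<le> integral {c..d'} (speed v)"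
      proof (rule integral_ge_ae[OF si N _ cd(2)])
        show "a - \<epsilon>1 \<le> speed v s" if "s \<in> {c..d'} - N" for s using vs[OF that] by linarith
      qed
      moreover have "- (a + \<epsilon>1) * (d' - c) \<le> integral {c..d'} (\<lambda>s. - speed v s)"
      proof (rule integral_ge_ae[OF integrable_neg[OF si] N _ cd(2)])
        show "- (a + \<epsilon>1) \<le> - speed v s" if "s \<in> {c..d'} - N" for s using vs[OF that] by linarith
      qed
      ultimately show ?thesis unfolding n by (simp add: algebra_simps abs_le_iff)
    qed
    have incr0: "\<bar>norm (y s) - norm (y t) - a * (s - t)\<bar> \<le> \<epsilon>1 * h" if s: "s \<in> {t - h..t + h}" for s
    proof (cases "s \<ge> t")
      case True
      have "\<epsilon>1 * (s - t) \<le> \<epsilon>1 * h" using s \<epsilon>1 by (intro mult_left_mono) auto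
      then show ?thesis using incr[of t s] s True h1 by auto
    next
      case False
      have "\<epsilon>1 * (t - s) \<le> \<epsilon>1 * h" using s \<epsilon>1 by (intro mult_left_mono) auto
      moreover have "\<bar>norm (y t) - norm (y s) - a * (t - s)\<bar> \<le> \<epsilon>1 * (t - s)" using incr[of s t] s False h1 by auto
      moreover have "norm (y s) - norm (y t) - a * (s - t) = - (norm (y t) - norm (y s) - a * (t - s))" by (simp add: algebra_simps)
      ultimately show ?thesis by linarith
    qed
    have \<epsilon>1h: "4 * (\<epsilon>1 * h) \<le> h" using \<epsilon>1(3) h1 mult_right_mono[of "4 * \<epsilon>1" 1 h] by (simp add: mult_ac)
    have yr: "\<bar>norm (y s) - r\<bar> \<le> r'" if s: "s \<in> {t - h..t + h}" for s
    proof -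
      have "\<bar>a * (s - t)\<bar> \<le> \<bar>a\<bar> * h" unfolding abs_mult using s by (intro mult_left_mono) auto
      then have "\<bar>norm (y s) - r\<bar> \<le> \<bar>a\<bar> * h + 2 * (\<epsilon>1 * h)" using incr0[OF s] yt by linarith
      then show ?thesis using h2 \<epsilon>1h h1 unfolding distrib_right by linarith
    qed
    \<comment> \<open>A lower bound on the action of y serves both sides: its past action is added
      in the lower estimate, its future action is subtracted in the upper one.\<close>
    have lagr_ge: "\<Lambda> a - 2 * \<epsilon>2 \<le> lagr y v s" if s: "s \<in> {t - h..t + h} - N" for s
    proof -
      have s1: "s \<in> {t - h..t + h}" "s \<in> {0..T}" "\<bar>s - t\<bar> \<le> r'" "s \<in> {t - \<delta>..t + \<delta>}" using s h1 hr \<delta> by auto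
      have b: "\<bar>speed v s\<bar> \<le> A" using vel'[OF s] \<epsilon>1(3) by (simp add: A_def)
      have "norm (y s) > 0" using yr[OF s1(1)] r' by linarith
      then have "lagr y v s = L i (m s) (norm (y s)) (speed v s)" using edge[OF s1(4)] by (rule lagr_edge)
      moreover have "\<bar>L i (m s) (norm (y s)) (speed v s) - \<Lambda> (speed v s)\<bar> \<le> \<epsilon>2"
        by (intro Lclose s1 yr b)
      moreover have "\<bar>\<Lambda> (speed v s) - \<Lambda> a\<bar> \<le> \<epsilon>2"
        using vel'[OF s] \<epsilon>1 b by (intro \<Lambda>close) (auto simp: A_def)
      ultimately show ?thesis by linarith
    qed
    have action: "(\<Lambda> a - 2 * \<epsilon>2) * (d' - c) \<le> integral {c..d'} (lagr y v)" if cd: "t - h \<le> c" "c \<le> d'" "d' \<le> t + h" for c d'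
    proof (rule integral_ge_ae[OF _ N _ cd(2)])
      show "lagr y v integrable_on {c..d'}"
        using cd h1 \<delta> by (intro absint_imp_int absint_sub[OF lagr_absint[OF y]]) auto
      show "\<Lambda> a - 2 * \<epsilon>2 \<le> lagr y v s" if "s \<in> {c..d'} - N" for s using that cd by (intro lagr_ge) auto
    qed
    have ends: "y s = norm (y s) *\<^sub>R axis i 1" "norm (y s) > 0" if "s \<in> {t - h..t + h}" for s
      using edge_eq_norm[OF edge[of s]] yr[OF that] r' that h1 by auto
    have rem: "remaining_cost y v (t - h) = integral {t - h..t} (lagr y v) + remaining_cost y v t"
      "remaining_cost y v t = integral {t..t + h} (lagr y v) + remaining_cost y v (t + h)"
      using h1 \<delta> by (auto intro!: remaining_cost_split[OF y])
    have seg: "line_cost i s s' r1 c \<le> (s' - s) * (\<Lambda> c0 + 2 * \<epsilon>2)"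
      if "t - h \<le> s" "s \<le> s'" "s' \<le> t + h" "\<bar>r1 - r\<bar> \<le> r'" "\<bar>r1 + c * (s' - s) - r\<bar> \<le> r'" "\<bar>c0\<bar> \<le> 2 * \<bar>a\<bar> + 1" "\<bar>c - c0\<bar> \<le> 4 * \<epsilon>1"
      for s s' r1 c c0
    proof (rule line_cost_le[OF _ that(2) _ that(4,5) r'(2)])
      show "0 \<le> s" "s' \<le> T" using that h1 \<delta> by auto
      fix \<sigma> \<xi> assume \<sigma>: "\<sigma> \<in> {s..s'}" "\<bar>\<xi> - r\<bar> \<le> r'"
      have cA: "\<bar>c\<bar> \<le> A" "\<bar>c0\<bar> \<le> A" using that(6,7) \<epsilon>1(3) by (auto simp: A_def)
      have "\<bar>L i (m \<sigma>) \<xi> c - \<Lambda> c\<bar> \<le> \<epsilon>2" using \<sigma> that(1,3) h1 hr \<delta> by (intro Lclose cA) auto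
      moreover have "\<bar>\<Lambda> c - \<Lambda> c0\<bar> \<le> \<epsilon>2" using that(7) \<epsilon>1(2) by (intro \<Lambda>close cA) auto
      ultimately show "L i (m \<sigma>) \<xi> c \<le> \<Lambda> c0 + 2 * \<epsilon>2" by linarith
    qed
    have quot: "\<bar>z / q\<bar> \<le> 2 * \<bar>a\<bar> + 1" if "q \<ge> h / 2" "\<bar>z\<bar> \<le> h / 2 + \<bar>a\<bar> * h" for z q
    proof -
      have "q > 0" using that(1) h1 by linarith
      have "(2 * \<bar>a\<bar> + 1) * (h / 2) \<le> (2 * \<bar>a\<bar> + 1) * q" using that(1) by (intro mult_left_mono) auto
      then have "\<bar>z\<bar> \<le> (2 * \<bar>a\<bar> + 1) * q" using that(2) by (simp add: algebra_simps)
      then show ?thesis using \<open>q > 0\<close> by (simp add: abs_divide divide_le_eq)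
    qed
    have quot': "\<bar>z / q\<bar> \<le> 4 * \<epsilon>1" if "q \<ge> h / 2" "\<bar>z\<bar> \<le> 2 * (\<epsilon>1 * h)" for z q
    proof -
      have "q > 0" using that(1) h1 by linarith
      have "4 * \<epsilon>1 * (h / 2) \<le> 4 * \<epsilon>1 * q" using that(1) \<epsilon>1 by (intro mult_left_mono) auto
      then have "\<bar>z\<bar> \<le> 4 * \<epsilon>1 * q" using that(2) by simp
      then show ?thesis using \<open>q > 0\<close> by (simp add: abs_divide divide_le_eq)
    qed
    have lower: "edge_value \<mu> i (X, S) \<ge> remaining_cost y v t + h * \<Lambda> a - (h + (S - t)) * \<Lambda> ((X - r + a * h) / (h + (S - t))) - 5 * \<epsilon>2 * h"
      and upper: "edge_value \<mu> i (X, S) \<le> remaining_cost y v t + (h - (S - t)) * \<Lambda> ((r + a * h - X) / (h - (S - t))) - h * \<Lambda> a + 5 * \<epsilon>2 * h"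
      if XS: "\<bar>X - r\<bar> + \<bar>S - t\<bar> \<le> h / 2" for X S
    proof -
      have Xr: "\<bar>X - r\<bar> \<le> r'" "X > 0" "\<bar>X - r\<bar> \<le> h / 2" "\<bar>S - t\<bar> \<le> h / 2" using XS hr h1 r' by linarith+
      have aah: "\<bar>a * h\<bar> = \<bar>a\<bar> * h" using h1 by (simp add: abs_mult)
      define q where "q = h + (S - t)"
      define R where "R = norm (y (t - h))"
      define c where "c = (X - R) / q"
      define c0 where "c0 = (X - r + a * h) / q"
      have Sb: "S - t \<le> h / 2" "t - S \<le> h / 2" using Xr(4) by linarith+
      have St: "0 \<le> t - h" "t - h < S" "S < t + h" "t + h < T" "0 \<le> S" "S < T" "t - h \<le> t + h"
        using Sb h1 \<delta> by linarith+
      have q: "q \<ge> h / 2" "q > 0" "q \<le> 3 / 2 * h" using Sb h1 unfolding q_def by linarith+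
      have tm: "t - h \<in> {t - h..t + h}" "t + h \<in> {t - h..t + h}" using h1 by auto
      have "c - c0 = (r - a * h - R) / q" by (simp add: c_def c0_def diff_divide_distrib[symmetric])
      moreover have "\<bar>r - a * h - R\<bar> \<le> 2 * (\<epsilon>1 * h)" using incr0[OF tm(1)] yt by (simp add: R_def)
      ultimately have cc: "\<bar>c - c0\<bar> \<le> 4 * \<epsilon>1" using quot'[OF q(1)] by simp
      have c0b: "\<bar>c0\<bar> \<le> 2 * \<bar>a\<bar> + 1" unfolding c0_def using Xr(3) aah by (intro quot q) linarith
      have qS: "S - (t - h) = q" by (simp add: q_def)
      have "edge_value \<mu> i (X, S) \<ge> remaining_cost y v (t - h) - line_cost i (t - h) S R c"
        unfolding edge_value_def prod.case c_def qS[symmetric] R_def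
        by (rule value_ge[OF \<mu> opt St(1,2,6) Xr(2) ends[OF tm(1)]])
      moreover have "line_cost i (t - h) S R c \<le> (S - (t - h)) * (\<Lambda> c0 + 2 * \<epsilon>2)"
        using St Xr(1) yr[OF tm(1)] q(2) by (intro seg cc c0b) (auto simp: qS c_def R_def)
      moreover have "(\<Lambda> a - 2 * \<epsilon>2) * h \<le> integral {t - h..t} (lagr y v)" using action[of "t - h" t] h1 by simp
      moreover have "q * \<epsilon>2 \<le> (3 / 2 * h) * \<epsilon>2" using \<epsilon>2 q(3) by (intro mult_right_mono) auto
      ultimately have "edge_value \<mu> i (X, S) \<ge> remaining_cost y v t + h * \<Lambda> a - q * \<Lambda> c0 - 5 * \<epsilon>2 * h"
        unfolding rem(1) qS by (simp add: algebra_simps)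
      then show "edge_value \<mu> i (X, S) \<ge> remaining_cost y v t + h * \<Lambda> a - (h + (S - t)) * \<Lambda> ((X - r + a * h) / (h + (S - t))) - 5 * \<epsilon>2 * h"
        by (simp add: q_def c0_def)
      define q' where "q' = h - (S - t)"
      define R' where "R' = norm (y (t + h))"
      define c' where "c' = (R' - X) / q'"
      define c0' where "c0' = (r + a * h - X) / q'"
      have q': "q' \<ge> h / 2" "q' > 0" "q' \<le> 3 / 2 * h" using Sb h1 unfolding q'_def by linarith+
      have "c' - c0' = (R' - r - a * h) / q'" by (simp add: c'_def c0'_def diff_divide_distrib[symmetric])
      moreover have "\<bar>R' - r - a * h\<bar> \<le> 2 * (\<epsilon>1 * h)" using incr0[OF tm(2)] yt by (simp add: R'_def)
      ultimately have cc': "\<bar>c' - c0'\<bar> \<le> 4 * \<epsilon>1" using quot'[OF q'(1)] by simp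
      have c0b': "\<bar>c0'\<bar> \<le> 2 * \<bar>a\<bar> + 1" unfolding c0'_def using Xr(3) aah by (intro quot q') linarith
      have qS': "t + h - S = q'" by (simp add: q'_def)
      have "edge_value \<mu> i (X, S) \<le> line_cost i S (t + h) X c' + remaining_cost y v (t + h)"
        unfolding edge_value_def prod.case c'_def qS'[symmetric] R'_def
        by (rule value_le[OF \<mu> y St(5,3,4) Xr(2) ends[OF tm(2)]])
      moreover have "line_cost i S (t + h) X c' \<le> (t + h - S) * (\<Lambda> c0' + 2 * \<epsilon>2)"
        using St Xr(1) yr[OF tm(2)] q'(2) by (intro seg cc' c0b') (auto simp: qS' c'_def R'_def)
      moreover have "(\<Lambda> a - 2 * \<epsilon>2) * h \<le> integral {t..t + h} (lagr y v)" using action[of t "t + h"] h1 by simp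
      moreover have "q' * \<epsilon>2 \<le> (3 / 2 * h) * \<epsilon>2" using \<epsilon>2 q'(3) by (intro mult_right_mono) auto
      ultimately have "edge_value \<mu> i (X, S) \<le> remaining_cost y v t + q' * \<Lambda> c0' - h * \<Lambda> a + 5 * \<epsilon>2 * h"
        unfolding rem(2) qS' by (simp add: algebra_simps)
      then show "edge_value \<mu> i (X, S) \<le> remaining_cost y v t + (h - (S - t)) * \<Lambda> ((r + a * h - X) / (h - (S - t))) - h * \<Lambda> a + 5 * \<epsilon>2 * h"
        by (simp add: q'_def c0'_def)
    qed
    \<comment> \<open>At (r, t) itself both segment velocities are a and the main terms cancel, so
      the value there is pinned to the reference level of y.\<close>
    have "edge_value \<mu> i (r, t) \<ge> remaining_cost y v t - 5 * \<epsilon>2 * h" "edge_value \<mu> i (r, t) \<le> remaining_cost y v t + 5 * \<epsilon>2 * h"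
      using lower[of r t] upper[of r t] h1 by auto
    moreover have "10 * \<epsilon>2 * h \<le> \<epsilon> * h" using \<epsilon> h1 by (simp add: \<epsilon>2_def)
    ultimately show "edge_value \<mu> i (X, S) - edge_value \<mu> i (r, t) \<ge> h * \<Lambda> a - (h + (S - t)) * \<Lambda> ((X - r + a * h) / (h + (S - t))) - \<epsilon> * h"
      "edge_value \<mu> i (X, S) - edge_value \<mu> i (r, t) \<le> (h - (S - t)) * \<Lambda> ((r + a * h - X) / (h - (S - t))) - h * \<Lambda> a + \<epsilon> * h"
      using lower[OF XS] upper[OF XS] by linarith+
  qed
qed

end

section \<open>A common velocity of the trajectories near a point\<close>

context mfg_costs
begin

lemma equilibrium_optimal:
  assumes PM: "path_measure T p C m0 \<mu>" and \<mu>: "\<And>s. s \<in> {0..T} \<Longrightarrow> marginal \<mu> s = m s"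
    and eq: "relaxed_equilibrium p T C L Ls G Gs m0 \<mu>"
    and y: "y \<in> supp (trajs_topology p T C) \<mu>" "y \<in> trajs_bdd p T C"
  obtains v where "optimal y v" "integral {0..T} (\<lambda>s. norm (v s) powr p) \<le> C powr p"
proof -
  interpret PM: path_measure T p C m0 \<mu> by (rule PM)
  obtain v where v: "ac_path p 0 T y v" "integral {0..T} (\<lambda>s. norm (v s) powr p) \<le> C powr p"
    using trajs_bdd_path[OF T p PM.C y(2)] by metis
  obtain x where x: "y \<in> trajs_bdd_at p T C x" "\<And>z. z \<in> trajs p T 0 x \<Longrightarrow> cost T L Ls G Gs \<mu> 0 y \<le> cost T L Ls G Gs \<mu> 0 z"
    using eq y(1) unfolding relaxed_equilibrium_def by blast
  have y0: "y 0 = x" using x(1) by (simp add: trajs_bdd_at_def trajs_def)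
  have "total_cost y v \<le> total_cost z w" if z: "ac_path p 0 T z w" "z 0 = y 0" for z w
  proof -
    have "cost T L Ls G Gs \<mu> 0 y \<le> cost T L Ls G Gs \<mu> 0 (restrict z {0..T})"
      using trajs_restrict_path(1)[OF \<mu> z(1) order_refl T] z(2) y0 by (intro x(2)) simp
    then show ?thesis
      using trajs_restrict_path(2)[OF \<mu> z(1) order_refl T] cost_eq[OF \<mu> v(1) order_refl T] by (simp add: total_cost_def)
  qed
  then have "optimal y v" using v(1) by (simp add: optimal_def)
  then show thesis using that v(2) by blast
qed

text \<open>The order of quantifiers is the point: a is fixed first, then \<eta> from \<epsilon>,
  and only then a trajectory as close to x as desired. Trajectories within 1 / (k + 1) of x in norm
  at time t have essential velocities in [-K, K], a subsequence of which converges to a; the uniform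
  modulus at \<epsilon> / 2 then serves all late members.\<close>

lemma equilibrium_near_velocity:
  assumes PM: "path_measure T p C m0 \<mu>" and \<mu>: "\<And>s. s \<in> {0..T} \<Longrightarrow> marginal \<mu> s = m s"
    and eq: "relaxed_equilibrium p T C L Ls G Gs m0 \<mu>"
    and x: "x \<in> edge i" "x \<noteq> 0" "x \<in> supp (top_of_set junction) (marginal \<mu> t)" and t: "0 < t" "t < T"
  shows "\<exists>\<delta>>0. 0 \<le> t - \<delta> \<and> t + \<delta> \<le> T \<and> (\<exists>a. \<forall>\<epsilon>>0. \<exists>\<eta>>0. \<forall>\<rho>>0. \<exists>y v N. optimal y v \<and> (\<forall>s\<in>{t - \<delta>..t + \<delta>}. y s \<in> edge i) \<and>
       \<bar>norm (y t) - norm x\<bar> < \<rho> \<and> negligible N \<and> (\<forall>s\<in>{t - \<delta>..t + \<delta>} - N. \<bar>s - t\<bar> < \<eta> \<longrightarrow> \<bar>speed v s - a\<bar> \<le> \<epsilon>))"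
proof -
  interpret PM: path_measure T p C m0 \<mu> by (rule PM)
  have nx: "norm x > 0" using x by simp
  \<comment> \<open>One quarter of |x| is allowed for missing x at time t and one for moving from t
    to s, so y s stays within |x| / 2 of x, on the same edge.\<close>
  then have "norm x / 4 > 0" by simp
  from trajs_bdd_equicontinuous[OF T p PM.C this] obtain \<delta>1 where \<delta>1: "\<delta>1 > 0"
    "\<And>(y :: real \<Rightarrow> real^'n) s s'. y \<in> PM.\<Gamma> \<Longrightarrow> s \<in> {0..T} \<Longrightarrow> s' \<in> {0..T} \<Longrightarrow> \<bar>s - s'\<bar> \<le> \<delta>1 \<Longrightarrow> dist (y s) (y s') \<le> norm x / 4"
    by metis
  define \<delta> where "\<delta> = min \<delta>1 (min (t / 2) ((T - t) / 2))"
  have dpos: "\<delta> > 0" and d1: "\<delta> \<le> \<delta>1" and d2: "\<delta> \<le> t / 2" and d3: "\<delta> \<le> (T - t) / 2"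
    using \<delta>1(1) t unfolding \<delta>_def min_less_iff_conj min_le_iff_disj by auto
  have d4: "t + \<delta> \<le> T" using d3 t(2) by (simp add: field_simps)
  have \<delta>: "\<delta> > 0" "0 \<le> t - \<delta>" "t - \<delta> < t + \<delta>" "t + \<delta> \<le> T" "\<delta> \<le> \<delta>1"
    using dpos d1 d2 d4 t(1) by simp_all
  let ?I = "{t - \<delta>..t + \<delta>}"
  \<comment> \<open>The energy bound C^p concerns the full velocity; its radial part is larger by a
    factor of at most N.\<close>
  define B where "B = real CARD('n) powr p * C powr p"
  have B: "B \<ge> 0" by (simp add: B_def)
  have half: "0 < norm x / 2" "norm x / 2 \<le> 2 * norm x" using nx by auto
  obtain K \<eta> where K: "K > 0" and \<eta>: "\<forall>\<epsilon>>0. \<eta> \<epsilon> > 0" and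
    mod: "\<forall>y v. optimal y v \<longrightarrow> (\<forall>s\<in>?I. y s \<in> edge i \<and> norm x / 2 \<le> norm (y s) \<and> norm (y s) \<le> 2 * norm x) \<longrightarrow>
      integral ?I (\<lambda>s. \<bar>speed v s\<bar> powr p) \<le> B \<longrightarrow>
      (\<exists>N. negligible N \<and> (\<forall>s\<in>?I - N. \<bar>speed v s\<bar> \<le> K) \<and>
        (\<forall>\<epsilon>>0. \<forall>s\<in>?I - N. \<forall>s'\<in>?I - N. \<bar>s - s'\<bar> < \<eta> \<epsilon> \<longrightarrow> \<bar>speed v s - speed v s'\<bar> \<le> \<epsilon>))"
    using optimal_velocity_modulus[OF \<delta>(2-4) half B, of i] by (elim exE conjE)
  have tT: "t \<in> {0..T}" using t by simp
  have ex: "\<exists>y v N a. optimal y v \<and> (\<forall>s\<in>?I. y s \<in> edge i) \<and> \<bar>norm (y t) - norm x\<bar> < \<rho> \<and> negligible N \<and> a \<in> {-K..K} \<and>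
      (\<forall>\<epsilon>>0. \<forall>s\<in>?I - N. \<bar>s - t\<bar> < \<eta> \<epsilon> \<longrightarrow> \<bar>speed v s - a\<bar> \<le> \<epsilon>)" if \<rho>: "\<rho> > 0" for \<rho>
  proof -
    have "min \<rho> (norm x / 4) > 0" using \<rho> nx by simp
    from PM.supp_marginal[OF tT x(3) this] obtain y where y: "y \<in> supp PM.X \<mu>" "y \<in> PM.\<Gamma>" "dist (y t) x < min \<rho> (norm x / 4)"
      by blast
    obtain v where opt: "optimal y v" and v: "integral {0..T} (\<lambda>s. norm (v s) powr p) \<le> C powr p"
      using equilibrium_optimal[OF PM \<mu> eq y(1,2)] by metis
    have near: "dist x (y s) \<le> norm x / 2" if s: "s \<in> ?I" for s
    proof -
      have "dist (y s) (y t) \<le> norm x / 4" using s \<delta> by (intro \<delta>1(2)[OF y(2) _ tT]) auto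
      then show ?thesis using y(3) dist_triangle[of x "y s" "y t"] by (simp add: dist_commute)
    qed
    have edge: "y s \<in> edge i \<and> norm x / 2 \<le> norm (y s) \<and> norm (y s) \<le> 2 * norm x" if s: "s \<in> ?I" for s
    proof -
      have "y s \<in> junction" using s \<delta> by (intro PM.\<Gamma>_junction[OF y(2)]) auto
      moreover have "dist x (y s) < norm x" using near[OF s] nx by linarith
      ultimately have "y s \<in> edge i" by (rule edge_if_close[OF x(1)])
      moreover have "\<bar>norm x - norm (y s)\<bar> \<le> norm x / 2"
        using near[OF s] norm_triangle_ineq3[of x "y s"] unfolding dist_norm by linarith
      then have "norm x / 2 \<le> norm (y s)" "norm (y s) \<le> 2 * norm x" using nx by linarith+
      ultimately show ?thesis by blast
    qed
    have path: "ac_path p 0 T y v" using opt by (simp add: optimal_def)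
    have "integral ?I (\<lambda>s. \<bar>speed v s\<bar> powr p) \<le> integral {0..T} (\<lambda>s. \<bar>speed v s\<bar> powr p)"
      using \<delta> by (intro integral_subset_le absint_imp_int absint_sub[OF speed_powr_absint[OF path]] speed_powr_absint[OF path]) auto
    also have "\<dots> \<le> integral {0..T} (\<lambda>s. real CARD('n) powr p * norm (v s) powr p)"
    proof (intro Henstock_Kurzweil_Integration.integral_le integrable_on_mult_right absint_imp_int speed_powr_absint[OF path] ac_path_absint(2)[OF path])
      fix s
      have "\<bar>speed v s\<bar> powr p \<le> (real CARD('n) * norm (v s)) powr p" using p speed_le[of v s] by (intro powr_mono2) auto
      then show "\<bar>speed v s\<bar> powr p \<le> real CARD('n) powr p * norm (v s) powr p" by (simp add: powr_mult)
    qed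
    also have "\<dots> \<le> B" unfolding B_def using v by (simp add: mult_left_mono)
    finally have le: "integral ?I (\<lambda>s. \<bar>speed v s\<bar> powr p) \<le> B" .
    have edge': "\<forall>s\<in>?I. y s \<in> edge i \<and> norm x / 2 \<le> norm (y s) \<and> norm (y s) \<le> 2 * norm x" using edge by blast
    from mod[THEN spec, THEN spec, THEN mp, THEN mp, THEN mp, OF opt edge' le]
    obtain N where N: "negligible N" and NK: "\<forall>s\<in>?I - N. \<bar>speed v s\<bar> \<le> K"
      and osc: "\<forall>\<epsilon>>0. \<forall>s\<in>?I - N. \<forall>s'\<in>?I - N. \<bar>s - s'\<bar> < \<eta> \<epsilon> \<longrightarrow> \<bar>speed v s - speed v s'\<bar> \<le> \<epsilon>"
      by (elim exE conjE)
    have "\<exists>a. \<bar>a\<bar> \<le> K \<and> (\<forall>\<epsilon>>0. \<forall>s\<in>?I - N. \<bar>s - t\<bar> < \<eta> \<epsilon> \<longrightarrow> \<bar>speed v s - a\<bar> \<le> \<epsilon>)"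
      by (rule essential_limit[OF \<delta>(1) N]) (use NK \<eta> osc in blast)+
    then obtain a where a: "\<bar>a\<bar> \<le> K" "\<forall>\<epsilon>>0. \<forall>s\<in>?I - N. \<bar>s - t\<bar> < \<eta> \<epsilon> \<longrightarrow> \<bar>speed v s - a\<bar> \<le> \<epsilon>" by blast
    have "\<bar>norm (y t) - norm x\<bar> < \<rho>" using y(3) norm_triangle_ineq3[of "y t" x] by (simp add: dist_norm)
    moreover have "a \<in> {-K..K}" using a(1) by auto
    ultimately show ?thesis using opt edge' N a(2) by blast
  qed
  have "\<forall>k::nat. \<exists>a. a \<in> {-K..K} \<and> (\<exists>y v N. optimal y v \<and> (\<forall>s\<in>?I. y s \<in> edge i) \<and> \<bar>norm (y t) - norm x\<bar> < 1 / Suc k \<and> negligible N \<and>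
      (\<forall>\<epsilon>>0. \<forall>s\<in>?I - N. \<bar>s - t\<bar> < \<eta> \<epsilon> \<longrightarrow> \<bar>speed v s - a\<bar> \<le> \<epsilon>))" (is "\<forall>k. \<exists>a. _ \<and> ?Q k a")
  proof
    fix k :: nat
    have "1 / real (Suc k) > 0" by simp
    from ex[OF this] show "\<exists>a. a \<in> {-K..K} \<and> ?Q k a" by blast
  qed
  then obtain \<alpha> where \<alpha>: "\<forall>k. \<alpha> k \<in> {-K..K} \<and> ?Q k (\<alpha> k)" by (subst (asm) choice_iff) blast
  then have "\<forall>k. \<alpha> k \<in> {-K..K}" by blast
  then have "\<exists>a\<in>{-K..K}. \<exists>r. strict_mono r \<and> (\<alpha> \<circ> r) \<longlonglongrightarrow> a"
    by (rule compact_imp_seq_compact[OF compact_Icc, unfolded seq_compact_def, THEN spec[of _ \<alpha>], THEN mp])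
  then obtain a r where r: "strict_mono (r :: nat \<Rightarrow> nat)" and a: "(\<alpha> \<circ> r) \<longlonglongrightarrow> a" by blast
  have "\<exists>\<eta>>0. \<forall>\<rho>>0. \<exists>y v N. optimal y v \<and> (\<forall>s\<in>?I. y s \<in> edge i) \<and>
       \<bar>norm (y t) - norm x\<bar> < \<rho> \<and> negligible N \<and> (\<forall>s\<in>?I - N. \<bar>s - t\<bar> < \<eta> \<longrightarrow> \<bar>speed v s - a\<bar> \<le> \<epsilon>)" if \<epsilon>: "\<epsilon> > 0" for \<epsilon>
  proof (intro exI[of _ "\<eta> (\<epsilon> / 2)"] conjI allI impI)
    show "\<eta> (\<epsilon> / 2) > 0" using \<eta> \<epsilon> by simp
    fix \<rho> :: real assume \<rho>: "\<rho> > 0"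
    obtain n1 where n1: "\<And>n. n \<ge> n1 \<Longrightarrow> \<bar>\<alpha> (r n) - a\<bar> < \<epsilon> / 2"
      using a \<epsilon> half_gt_zero[OF \<epsilon>] unfolding LIMSEQ_iff real_norm_def o_def by blast
    obtain n2 where n2: "1 / real (Suc n2) < \<rho>" using \<rho> nat_approx_posE by blast
    define n where "n = max n1 n2"
    have "n2 \<le> r n" using seq_suble[OF r, of n] by (simp add: n_def)
    then have "1 / real (Suc (r n)) \<le> 1 / real (Suc n2)" by (intro divide_left_mono) auto
    then have small: "1 / real (Suc (r n)) < \<rho>" using n2 by linarith
    from \<alpha>[THEN spec, of "r n"] obtain y v N where y: "optimal y v" "\<forall>s\<in>?I. y s \<in> edge i" "\<bar>norm (y t) - norm x\<bar> < 1 / Suc (r n)" "negligible N"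
      and vel: "\<forall>\<epsilon>>0. \<forall>s\<in>?I - N. \<bar>s - t\<bar> < \<eta> \<epsilon> \<longrightarrow> \<bar>speed v s - \<alpha> (r n)\<bar> \<le> \<epsilon>" by (elim conjE exE)
    have "\<bar>speed v s - a\<bar> \<le> \<epsilon>" if s: "s \<in> ?I - N" "\<bar>s - t\<bar> < \<eta> (\<epsilon> / 2)" for s
    proof -
      have "\<bar>speed v s - \<alpha> (r n)\<bar> \<le> \<epsilon> / 2" using vel half_gt_zero[OF \<epsilon>] s by blast
      moreover have "\<bar>\<alpha> (r n) - a\<bar> < \<epsilon> / 2" by (intro n1) (simp add: n_def)
      ultimately show ?thesis by linarith
    qed
    moreover have "\<bar>norm (y t) - norm x\<bar> < \<rho>" using y(3) small by linarith
    ultimately show "\<exists>y v N. optimal y v \<and> (\<forall>s\<in>?I. y s \<in> edge i) \<and>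
       \<bar>norm (y t) - norm x\<bar> < \<rho> \<and> negligible N \<and> (\<forall>s\<in>?I - N. \<bar>s - t\<bar> < \<eta> (\<epsilon> / 2) \<longrightarrow> \<bar>speed v s - a\<bar> \<le> \<epsilon>)"
      using y by blast
  qed
  then show ?thesis using \<delta> by blast
qed

end

theorem proposition3p7:
  fixes T p C :: real
    and L :: "'n::finite \<Rightarrow> (real^'n) measure \<Rightarrow> real \<Rightarrow> real \<Rightarrow> real"
    and Ls :: "(real^'n) measure \<Rightarrow> real"
    and G :: "'n \<Rightarrow> (real^'n) measure \<Rightarrow> real \<Rightarrow> real"
    and Gs :: "(real^'n) measure \<Rightarrow> real"
    and m0 :: "(real^'n) measure"
    and \<mu> :: "(real \<Rightarrow> real^'n) measure"
    and u :: "real^'n \<Rightarrow> real \<Rightarrow> real"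
    and m :: "real \<Rightarrow> (real^'n) measure"
    and x :: "real^'n" and t :: real and i :: 'n
  assumes "CARD('n) > 1" and "T > 0" and "p > 1"
    and "m0 \<in> borel_probs junction_borel" and "bounded (supp (top_of_set junction) m0)"
    and "costs L Ls G Gs"
    and "coercive p L Ls"
    and "measure_modulus p L"
    and "deriv_growth p L"
    and "velocity_convex L"
    and "\<And>j m'. m' \<in> P1 \<Longrightarrow> C1_halfline (G j m')"
    and "C > 0"
    and "relaxed_equilibrium p T C L Ls G Gs m0 \<mu>"
    and "mild_solution p T L Ls G Gs \<mu> u m"
    and "(x, t) \<in> Q_set T m" and "x \<in> edge i - {0}"
  shows "(\<forall>(p1, p2) \<in> superdiff T u x t. - p1 + hamiltonian L m i (norm x) p2 t = 0) \<and>
         differentiable_on_edge u i x t"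
proof -
  have PM: "path_measure T p C m0 \<mu>"
    using assms(2,3,12,13) by (simp add: path_measure_def relaxed_equilibrium_def)
  interpret PM: path_measure T p C m0 \<mu> by (rule PM)
  \<comment> \<open>The curve of measures is taken to be the marginals of \<mu>; m agrees with them
    on [0, T], and the Hamiltonian involves m only at time t.\<close>
  interpret MC: mfg_costs T p L Ls G Gs "marginal \<mu>"
    using assms(2,3,6,7,9,10) PM.marginal_P1 PM.marginal_continuous by unfold_locales
  have t: "0 < t" "t < T" and tT: "t \<in> {0..T}" using assms(15) by (auto simp: Q_set_def)
  have mt: "m t = marginal \<mu> t" using assms(14) tT by (simp add: mild_solution_def)
  have xsupp: "x \<in> supp (top_of_set junction) (marginal \<mu> t)" using assms(15) mt by (simp add: Q_set_def)
  have x: "x \<in> edge i" "x \<noteq> 0" and nx: "norm x > 0" using assms(16) by auto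
  obtain \<delta> a where \<delta>: "\<delta> > 0" "0 \<le> t - \<delta>" "t + \<delta> \<le> T" and near: "\<forall>\<epsilon>>0. \<exists>\<eta>>0. \<forall>\<rho>>0. \<exists>y v N. MC.optimal y v \<and>
      (\<forall>s\<in>{t - \<delta>..t + \<delta>}. y s \<in> edge i) \<and> \<bar>norm (y t) - norm x\<bar> < \<rho> \<and> negligible N \<and>
      (\<forall>s\<in>{t - \<delta>..t + \<delta>} - N. \<bar>s - t\<bar> < \<eta> \<longrightarrow> \<bar>speed v s - a\<bar> \<le> \<epsilon>)"
    using MC.equilibrium_near_velocity[OF PM refl assms(13) x xsupp t] by (elim exE conjE)
  define \<Lambda> where "\<Lambda> = L i (marginal \<mu> t) (norm x)"
  define D where "D = da (L i (marginal \<mu> t)) (norm x) a"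
  have "(\<Lambda> has_real_derivative D) (at a)"
    unfolding \<Lambda>_def D_def using nx by (intro MC.La_deriv tT) auto
  then have "(MC.edge_value \<mu> i has_derivative (\<lambda>(dX, dS). - D * dX + (a * D - \<Lambda> a) * dS)) (at (norm x, t))"
  proof (rule derivative_from_rescaled_bounds)
    fix \<epsilon> :: real assume "\<epsilon> > 0"
    show "\<exists>e>0. \<forall>h. 0 < h \<and> h < e \<longrightarrow> (\<forall>X S. \<bar>X - norm x\<bar> + \<bar>S - t\<bar> \<le> h / 2 \<longrightarrow>
        MC.edge_value \<mu> i (X, S) - MC.edge_value \<mu> i (norm x, t) \<ge> h * \<Lambda> a - (h + (S - t)) * \<Lambda> ((X - norm x + a * h) / (h + (S - t))) - \<epsilon> * h \<and>
        MC.edge_value \<mu> i (X, S) - MC.edge_value \<mu> i (norm x, t) \<le> (h - (S - t)) * \<Lambda> ((norm x + a * h - X) / (h - (S - t))) - h * \<Lambda> a + \<epsilon> * h)"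
      unfolding \<Lambda>_def by (rule MC.value_rescaled_bounds[OF refl \<delta> nx near[rule_format] \<open>\<epsilon> > 0\<close>])
  qed
  \<comment> \<open>u is determined only on the junction and for times in [0, T], so the two
    functions are compared on an open set of positive positions and interior times.\<close>
  then have der: "((\<lambda>(r, \<theta>). u (r *\<^sub>R axis i 1) \<theta>) has_derivative (\<lambda>(dX, dS). - D * dX + (a * D - \<Lambda> a) * dS)) (at (norm x, t))"
  proof (rule has_derivative_transform_within_open[where s="{0<..} \<times> {0<..<T}"])
    show "open ({0<..} \<times> {0<..<T} :: (real \<times> real) set)" by (intro open_Times) auto
    show "(norm x, t) \<in> {0<..} \<times> {0<..<T}" using nx t by simp
    fix z :: "real \<times> real" assume "z \<in> {0<..} \<times> {0<..<T}"
    then show "MC.edge_value \<mu> i z = (\<lambda>(r, \<theta>). u (r *\<^sub>R axis i 1) \<theta>) z"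
      using assms(14) by (auto simp: MC.edge_value_def mild_solution_def edge_line)
  qed
  have "- p1 + hamiltonian L m i (norm x) p2 t = 0" if "(p1, p2) \<in> superdiff T u x t" for p1 p2
  proof -
    have "p1 = a * D - \<Lambda> a" "p2 = - D"
      using superdiff_of_differentiable[OF der x t that] by auto
    moreover have "hamiltonian L m i (norm x) (- D) t = hamiltonian L (marginal \<mu>) i (norm x) (- D) t"
      by (simp add: hamiltonian_def mt)
    moreover have "\<dots> = a * D - \<Lambda> a"
      unfolding D_def \<Lambda>_def using nx by (intro MC.hamiltonian_at_slope tT) auto
    ultimately show ?thesis by simp
  qed
  moreover have "differentiable_on_edge u i x t"
    unfolding differentiable_on_edge_def differentiable_def using der by blast
  ultimately show ?thesis by blast
qed

end
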